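(* Let $\mathcal A$ be an essential complex hyperplane arrangement with Orlik–Solomon algebra $A$ over a field $K$, and let $V=A_1$ with canonical basis $\{e_H\}_{H\in\mathcal A}$ and dual coordinates $\{x_H\}_{H\in\mathcal A}$. Write $\mathcal A$ as the product of irreducible arrangements. Then the singular variety of $A$ is the linear subspace of $V$ given by the system of equations $$\sum_{H\in\mathcal A_j}x_H=0,$$ one for each central irreducible factor $\mathcal A_j$ of $\mathcal A$. In particular, the codimension of the singular variety of $A$ equals the number of central factors in an irreducible decomposition of $\mathcal A$.
   Context: An arrangement $\mathcal A$ is a finite set of affine hyperplanes in $\mathbb C^\ell$, essential in the sense that its intersection poset has rank $\ell$; it is central if the intersection of all its hyperplanes is nonempty. The product of arrangements $\mathcal A_i$ in $\mathbb C^{\ell_i}$ ($i=1,2$) is the arrangement in $\mathbb C^{\ell_1+\ell_2}$ consisting of the hyperplanes $H\times\mathbb C^{\ell_2}$ for $H\in\mathcal A_1$ and $\mathbb C^{\ell_1}\times H$ for $H\in\mathcal A_2$. An arrangement is irreducible if it is not (up to an affine change of coordinates) a product of two arrangements in spaces of positive dimension; any arrangement can be expressed uniquely as a product of irreducible ones, and the hyperplanes of each factor are identified with the corresponding hyperplanes of $\mathcal A$. Let $E$ be the exterior algebra over $K$ on generators $e_H$, $H\in\mathcal A$. A set of $t$ hyperplanes is dependent if its intersection is nonempty of codimension less than $t$. Fixing an ordering $H_1,\dots,H_n$ of $\mathcal A$ and writing $e_i=e_{H_i}$, the Orlik–Solomon algebra is $A=E/I$, where $I$ is generated by $\partial(e_{i_1}\wedge\cdots\wedge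 e_{i_t})=\sum_j(-1)^j e_{i_1}\wedge\cdots\wedge\widehat{e_{i_j}}\wedge\cdots\wedge e_{i_t}$ for minimal dependent sets $\{H_{i_1},\dots,H_{i_t}\}$ and the monomials $e_{i_1}\wedge\cdots\wedge e_{i_t}$ with $H_{i_1}\cap\cdots\cap H_{i_t}=\emptyset$; one has $A_1=E_1$. For an $E$-module $M$, an element $x\in V=E_1$ is singular on $M$ if $\{m\in M: xm=0\}\neq xM$; the set of singular elements is the singular variety of $M$. *)

theory Defs
  imports "Jordan_Normal_Form.VS_Connect" "HOL-Algebra.QuotRing"
begin

section \<open>Arrangements\<close>

text \<open>\<open>\<complex>\<^sup>l\<close> is \<^term>\<open>carrier_vec l :: complex vec set\<close>; \<open>l = 0\<close> is allowed and yields only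
  the empty arrangement.\<close>

definition hyperplane :: "nat \<Rightarrow> complex vec set \<Rightarrow> bool" where
  "hyperplane l H \<longleftrightarrow>
     (\<exists>a\<in>carrier_vec l. \<exists>c. a \<noteq> 0\<^sub>v l \<and> H = {v \<in> carrier_vec l. a \<bullet> v = c})"

definition intersection :: "nat \<Rightarrow> complex vec set set \<Rightarrow> complex vec set" where
  "intersection l S = {v \<in> carrier_vec l. \<forall>H\<in>S. v \<in> H}"

text \<open>The direction space of an affine subspace \<open>X\<close> is the set of differences of points of \<open>X\<close>.
  The codimension is only meaningful for nonempty \<open>X\<close>.\<close>

definition aff_dim :: "nat \<Rightarrow> complex vec set \<Rightarrow> nat" where
  "aff_dim l X = vectorspace.dim class_ring
     (module_vec TYPE(complex) l\<lparr>carrier := {u - v | u v. u \<in> X \<and> v \<in> X}\<rparr>)"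

definition aff_codim :: "nat \<Rightarrow> complex vec set \<Rightarrow> nat" where
  "aff_codim l X = l - aff_dim l X"

definition intersection_poset :: "nat \<Rightarrow> complex vec set set \<Rightarrow> complex vec set set" where
  "intersection_poset l A = {intersection l S | S. S \<subseteq> A \<and> intersection l S \<noteq> {}}"

text \<open>The rank function of the intersection poset (ordered by reverse inclusion) is the
  codimension, so the rank of the poset is the largest codimension that occurs.\<close>

definition arr_rank :: "nat \<Rightarrow> complex vec set set \<Rightarrow> nat" where
  "arr_rank l A = Max (aff_codim l ` intersection_poset l A)"

definition arrangement :: "nat \<Rightarrow> complex vec set set \<Rightarrow> bool" where
  "arrangement l A \<longleftrightarrow> finite A \<and> (\<forall>H\<in>A. hyperplane l H) \<and> arr_rank l A = l"

definition central :: "nat \<Rightarrow> complex vec set set \<Rightarrow> bool" where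
  "central l A \<longleftrightarrow> intersection l A \<noteq> {}"


section \<open>Products and irreducibility\<close>

definition vprod :: "complex vec set \<Rightarrow> complex vec set \<Rightarrow> complex vec set" where
  "vprod X Y = {u @\<^sub>v v | u v. u \<in> X \<and> v \<in> Y}"

definition arr_prod ::
  "nat \<Rightarrow> complex vec set set \<Rightarrow> nat \<Rightarrow> complex vec set set \<Rightarrow> complex vec set set" where
  "arr_prod l1 A1 l2 A2 =
     (\<lambda>H. vprod H (carrier_vec l2)) ` A1 \<union> (\<lambda>H. vprod (carrier_vec l1) H) ` A2"

definition affine_change :: "nat \<Rightarrow> (complex vec \<Rightarrow> complex vec) \<Rightarrow> bool" where
  "affine_change l \<phi> \<longleftrightarrow>
     (\<exists>P\<in>carrier_mat l l. \<exists>b\<in>carrier_vec l. invertible_mat P \<and>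
        (\<forall>v\<in>carrier_vec l. \<phi> v = P *\<^sub>v v + b))"

text \<open>An irreducible arrangement lives in positive dimension, so the empty arrangement in
  \<open>\<complex>\<^sup>0\<close> is the product of no factors and not itself irreducible (it is the unit for products,
  and counting it as a factor would spoil uniqueness of decompositions).\<close>

definition irreducible_arr :: "nat \<Rightarrow> complex vec set set \<Rightarrow> bool" where
  "irreducible_arr l A \<longleftrightarrow> arrangement l A \<and> l > 0 \<and>
     \<not> (\<exists>l1 l2 A1 A2 \<phi>. l1 > 0 \<and> l2 > 0 \<and> l = l1 + l2 \<and> arrangement l1 A1 \<and> arrangement l2 A2 \<and>
          affine_change l \<phi> \<and> (`) \<phi> ` A = arr_prod l1 A1 l2 A2)"

text \<open>A family of arrangements is a list of pairs of a dimension and an arrangement in that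
  dimension.\<close>

type_synonym arr_family = "(nat \<times> complex vec set set) list"

definition total_dim :: "arr_family \<Rightarrow> nat" where
  "total_dim Fs = sum_list (map fst Fs)"

fun family_prod :: "arr_family \<Rightarrow> complex vec set set" where
  "family_prod [] = {}"
| "family_prod ((l, B) # Fs) = arr_prod l B (total_dim Fs) (family_prod Fs)"

text \<open>The \<open>j\<close>-th entry is the set of those hyperplanes of the product that come from the \<open>j\<close>-th
  factor.\<close>

fun factor_images :: "arr_family \<Rightarrow> complex vec set set list" where
  "factor_images [] = []"
| "factor_images ((l, B) # Fs) =
     (\<lambda>H. vprod H (carrier_vec (total_dim Fs))) ` B #
     map ((`) (\<lambda>H. vprod (carrier_vec l) H)) (factor_images Fs)"

lemma length_factor_images [simp]: "length (factor_images Fs) = length Fs"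
  by (induction Fs rule: factor_images.induct) auto

lemma family_prod_eq_Union: "family_prod Fs = \<Union> (set (factor_images Fs))"
  by (induction Fs rule: factor_images.induct) (auto simp: arr_prod_def)

definition irreducible_decomposition ::
  "nat \<Rightarrow> complex vec set set \<Rightarrow> arr_family \<Rightarrow> (complex vec \<Rightarrow> complex vec) \<Rightarrow> bool" where
  "irreducible_decomposition l A Fs \<phi> \<longleftrightarrow>
     (\<forall>(m, B) \<in> set Fs. irreducible_arr m B) \<and> l = total_dim Fs \<and>
     affine_change l \<phi> \<and> (`) \<phi> ` A = family_prod Fs"

definition factor_of ::
  "complex vec set set \<Rightarrow> arr_family \<Rightarrow> (complex vec \<Rightarrow> complex vec) \<Rightarrow> nat \<Rightarrow> complex vec set set" where
  "factor_of A Fs \<phi> j = {H \<in> A. \<phi> ` H \<in> factor_images Fs ! j}"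

definition central_factors :: "arr_family \<Rightarrow> nat set" where
  "central_factors Fs = {j. j < length Fs \<and> central (fst (Fs ! j)) (snd (Fs ! j))}"


section \<open>The exterior algebra\<close>

text \<open>The exterior algebra on \<open>e\<^sub>0, \<dots>, e\<^sub>n\<^sub>-\<^sub>1\<close> has as basis the monomials
  \<open>e\<^sub>S = e\<^bsub>i\<^sub>1\<^esub> \<and> \<dots> \<and> e\<^bsub>i\<^sub>t\<^esub>\<close> for \<open>S = {i\<^sub>1 < \<dots> < i\<^sub>t} \<subseteq> {..<n}\<close>. An element is represented by its
  coefficient function \<open>S \<mapsto> x S\<close>. For disjoint \<open>S\<close> and \<open>T\<close> we have \<open>e\<^sub>S \<and> e\<^sub>T = \<plusminus> e\<^bsub>S \<union> T\<^esub>\<close>, where the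
  sign is determined by the number of inversions.\<close>

definition wedge_sign :: "nat set \<Rightarrow> nat set \<Rightarrow> 'k::field" where
  "wedge_sign S T = (-1) ^ card {(i, j). i \<in> S \<and> j \<in> T \<and> j < i}"

definition wedge :: "(nat set \<Rightarrow> 'k::field) \<Rightarrow> (nat set \<Rightarrow> 'k) \<Rightarrow> nat set \<Rightarrow> 'k" where
  "wedge x y = (\<lambda>U. \<Sum>S\<in>Pow U. wedge_sign S (U - S) * x S * y (U - S))"

definition mono_elt :: "nat set \<Rightarrow> nat set \<Rightarrow> 'k::field" where
  "mono_elt S = (\<lambda>T. if T = S then 1 else 0)"

text \<open>The ring record of the exterior algebra also carries scalar multiplication by \<open>K\<close>.\<close>

definition ext_alg :: "nat \<Rightarrow> ('k::field, nat set \<Rightarrow> 'k) module" where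
  "ext_alg n =
     \<lparr>carrier = {x. \<forall>S. x S \<noteq> 0 \<longrightarrow> S \<subseteq> {..<n}},
      mult = wedge,
      one = mono_elt {},
      zero = (\<lambda>S. 0),
      add = (\<lambda>x y S. x S + y S),
      smult = (\<lambda>c x S. c * x S)\<rparr>"

definition ext_grade :: "nat \<Rightarrow> nat \<Rightarrow> (nat set \<Rightarrow> 'k::field) set" where
  "ext_grade n d = {x \<in> carrier (ext_alg n). \<forall>S. x S \<noteq> 0 \<longrightarrow> card S = d}"

lemma wedge_sign_empty [simp]: "wedge_sign {} T = 1" "wedge_sign S {} = 1"
  by (simp_all add: wedge_sign_def)

lemma wedge_sign_Un_left:
  assumes "finite P" "finite Q" "finite R" "P \<inter> Q = {}"
  shows "wedge_sign (P \<union> Q) R = (wedge_sign P R * wedge_sign Q R :: 'k::field)"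
proof -
  have "{(i, j). i \<in> P \<union> Q \<and> j \<in> R \<and> j < i} =
        {(i, j). i \<in> P \<and> j \<in> R \<and> j < i} \<union> {(i, j). i \<in> Q \<and> j \<in> R \<and> j < i}" by auto
  moreover have "finite {(i, j). i \<in> P \<and> j \<in> R \<and> j < i}"
    by (rule finite_subset[of _ "P \<times> R"]) (use assms in auto)
  moreover have "finite {(i, j). i \<in> Q \<and> j \<in> R \<and> j < i}"
    by (rule finite_subset[of _ "Q \<times> R"]) (use assms in auto)
  moreover have "{(i, j). i \<in> P \<and> j \<in> R \<and> j < i} \<inter> {(i, j). i \<in> Q \<and> j \<in> R \<and> j < i} = {}"
    using assms by auto
  ultimately show ?thesis
    unfolding wedge_sign_def by (simp add: card_Un_disjoint power_add)
qed

lemma wedge_sign_Un_right: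
  assumes "finite P" "finite Q" "finite R" "Q \<inter> R = {}"
  shows "wedge_sign P (Q \<union> R) = (wedge_sign P Q * wedge_sign P R :: 'k::field)"
proof -
  have "{(i, j). i \<in> P \<and> j \<in> Q \<union> R \<and> j < i} =
        {(i, j). i \<in> P \<and> j \<in> Q \<and> j < i} \<union> {(i, j). i \<in> P \<and> j \<in> R \<and> j < i}" by auto
  moreover have "finite {(i, j). i \<in> P \<and> j \<in> Q \<and> j < i}"
    by (rule finite_subset[of _ "P \<times> Q"]) (use assms in auto)
  moreover have "finite {(i, j). i \<in> P \<and> j \<in> R \<and> j < i}"
    by (rule finite_subset[of _ "P \<times> R"]) (use assms in auto)
  moreover have "{(i, j). i \<in> P \<and> j \<in> Q \<and> j < i} \<inter> {(i, j). i \<in> P \<and> j \<in> R \<and> j < i} = {}"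
    using assms by auto
  ultimately show ?thesis
    unfolding wedge_sign_def by (simp add: card_Un_disjoint power_add)
qed

lemma wedge_assoc: "wedge (wedge x y) z = wedge x (wedge y z)"
proof
  fix U :: "nat set"
  show "wedge (wedge x y) z U = wedge x (wedge y z) U"
  proof (cases "finite U")
    case False
    then show ?thesis by (simp add: wedge_def)
  next
    case True
    let ?f = "\<lambda>S P. wedge_sign S (U - S) *
        (wedge_sign P (S - P) * x P * y (S - P)) * z (U - S)"
    let ?g = "\<lambda>P Q. wedge_sign P (U - P) * x P *
        (wedge_sign Q (U - P - Q) * y Q * z (U - P - Q))"
    have "wedge (wedge x y) z U = (\<Sum>S\<in>Pow U. \<Sum>P\<in>Pow S. ?f S P)"
      by (simp add: wedge_def sum_distrib_left sum_distrib_right)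
    also have "\<dots> = (\<Sum>(S, P)\<in>(SIGMA S:Pow U. Pow S). ?f S P)"
      using True by (intro sum.Sigma) (auto intro: finite_subset)
    also have "\<dots> = (\<Sum>(P, Q)\<in>(SIGMA P:Pow U. Pow (U - P)). ?g P Q)"
    proof (rule sum.reindex_bij_witness[where i = "\<lambda>(P, Q). (P \<union> Q, P)"
          and j = "\<lambda>(S, P). (P, S - P)"], goal_cases)
      case (5 a)
      then obtain S P where a: "a = (S, P)" "P \<subseteq> S" "S \<subseteq> U" by auto
      have fin: "finite P" "finite (S - P)" "finite (U - S)"
        using a True by (auto intro: finite_subset)
      have S: "S = P \<union> (S - P)" and UP: "U - P = (S - P) \<union> (U - S)" and UPS: "U - P - (S - P) = U - S"
        using a by auto
      have "wedge_sign S (U - S) = (wedge_sign P (U - S) * wedge_sign (S - P) (U - S) :: 'a)"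
        by (subst S, rule wedge_sign_Un_left) (use fin in auto)
      moreover have "wedge_sign P (U - P) = (wedge_sign P (S - P) * wedge_sign P (U - S) :: 'a)"
        by (subst UP, rule wedge_sign_Un_right) (use fin in auto)
      ultimately show ?case by (simp add: a UPS)
    qed auto
    also have "\<dots> = (\<Sum>P\<in>Pow U. \<Sum>Q\<in>Pow (U - P). ?g P Q)"
      using True by (intro sum.Sigma[symmetric]) (auto intro: finite_subset)
    also have "\<dots> = wedge x (wedge y z) U"
      by (simp add: wedge_def sum_distrib_left)
    finally show ?thesis .
  qed
qed

lemma wedge_mono_elt:
  assumes "finite S" "finite T"
  shows "wedge (mono_elt S) (mono_elt T) =
    (if S \<inter> T = {} then (\<lambda>U. wedge_sign S T * mono_elt (S \<union> T) U) else (\<lambda>U. 0 :: 'k::field))"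
proof
  fix U :: "nat set"
  have "wedge (mono_elt S) (mono_elt T) U =
      (\<Sum>P\<in>Pow U. if P = S then (if U - S = T then wedge_sign S T else 0) else (0 :: 'k))"
    unfolding wedge_def mono_elt_def by (rule sum.cong) auto
  also have "\<dots> = (if finite U \<and> S \<subseteq> U \<and> U - S = T then wedge_sign S T else 0)"
    by (cases "finite U") (auto simp: sum.delta)
  also have "(finite U \<and> S \<subseteq> U \<and> U - S = T) \<longleftrightarrow> (S \<inter> T = {} \<and> U = S \<union> T)"
    using assms by auto
  finally have "wedge (mono_elt S) (mono_elt T) U =
      (if S \<inter> T = {} \<and> U = S \<union> T then wedge_sign S T else (0 :: 'k))" .
  then show "wedge (mono_elt S) (mono_elt T) U =
      (if S \<inter> T = {} then (\<lambda>U. wedge_sign S T * mono_elt (S \<union> T) U) else (\<lambda>U. 0 :: 'k)) U"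
    by (simp add: mono_elt_def[of "S \<union> T"])
qed

lemma ring_ext_alg: "ring (ext_alg n :: ('k::field, nat set \<Rightarrow> 'k) module)"
proof (rule ringI)
  show "abelian_group (ext_alg n :: ('k, nat set \<Rightarrow> 'k) module)"
  proof (rule abelian_groupI)
    fix x :: "nat set \<Rightarrow> 'k" assume "x \<in> carrier (ext_alg n)"
    then show "\<exists>y\<in>carrier (ext_alg n). y \<oplus>\<^bsub>ext_alg n\<^esub> x = \<zero>\<^bsub>ext_alg n\<^esub>"
      by (intro bexI[of _ "\<lambda>S. - x S"]) (auto simp: ext_alg_def)
  next
    fix x y :: "nat set \<Rightarrow> 'k"
    assume xy: "x \<in> carrier (ext_alg n)" "y \<in> carrier (ext_alg n)"
    have "S \<subseteq> {..<n}" if "x S + y S \<noteq> 0" for S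
    proof -
      have "x S \<noteq> 0 \<or> y S \<noteq> 0" using that by auto
      then show ?thesis using xy unfolding ext_alg_def by (simp, blast)
    qed
    then show "x \<oplus>\<^bsub>ext_alg n\<^esub> y \<in> carrier (ext_alg n)" by (simp add: ext_alg_def)
  qed (auto simp: ext_alg_def algebra_simps)
  show "Group.monoid (ext_alg n :: ('k, nat set \<Rightarrow> 'k) module)"
  proof (rule Group.monoidI)
    fix x y :: "nat set \<Rightarrow> 'k"
    assume xy: "x \<in> carrier (ext_alg n)" "y \<in> carrier (ext_alg n)"
    have "S \<subseteq> {..<n}" if nz: "wedge x y S \<noteq> 0" for S
    proof -
      obtain P where P: "P \<in> Pow S" "wedge_sign P (S - P) * x P * y (S - P) \<noteq> 0"
        using sum.not_neutral_contains_not_neutral[OF nz[unfolded wedge_def]] by blast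
      then have "x P \<noteq> 0" "y (S - P) \<noteq> 0" by simp_all
      then have "P \<subseteq> {..<n}" "S - P \<subseteq> {..<n}" using xy by (simp_all add: ext_alg_def)
      then show ?thesis by blast
    qed
    then show "x \<otimes>\<^bsub>ext_alg n\<^esub> y \<in> carrier (ext_alg n)" by (simp add: ext_alg_def)
  next
    fix x :: "nat set \<Rightarrow> 'k" assume "x \<in> carrier (ext_alg n)"
    then have "x U \<noteq> 0 \<Longrightarrow> U \<subseteq> {..<n}" for U by (simp add: ext_alg_def)
    then have inf: "x U = 0" if "infinite U" for U
      using that by (meson finite_lessThan finite_subset)
    have "wedge (mono_elt {}) x U = x U" for U
    proof -
      have "wedge (mono_elt {}) x U = (\<Sum>P\<in>Pow U. if P = {} then x U else 0)"
        unfolding wedge_def mono_elt_def by (rule sum.cong) auto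
      then show ?thesis using inf by (cases "finite U") (auto simp: sum.delta)
    qed
    then show "\<one>\<^bsub>ext_alg n\<^esub> \<otimes>\<^bsub>ext_alg n\<^esub> x = x" by (auto simp: ext_alg_def)
    have "wedge x (mono_elt {}) U = x U" for U
    proof -
      have "wedge x (mono_elt {}) U = (\<Sum>P\<in>Pow U. if P = U then x U else 0)"
        unfolding wedge_def mono_elt_def by (rule sum.cong) auto
      then show ?thesis using inf by (cases "finite U") (auto simp: sum.delta)
    qed
    then show "x \<otimes>\<^bsub>ext_alg n\<^esub> \<one>\<^bsub>ext_alg n\<^esub> = x" by (auto simp: ext_alg_def)
  qed (auto simp: ext_alg_def mono_elt_def wedge_assoc)
next
  fix x y z :: "nat set \<Rightarrow> 'k"
  show "(x \<oplus>\<^bsub>ext_alg n\<^esub> y) \<otimes>\<^bsub>ext_alg n\<^esub> z =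
      x \<otimes>\<^bsub>ext_alg n\<^esub> z \<oplus>\<^bsub>ext_alg n\<^esub> y \<otimes>\<^bsub>ext_alg n\<^esub> z"
    by (simp add: ext_alg_def wedge_def distrib_left distrib_right sum.distrib)
  show "z \<otimes>\<^bsub>ext_alg n\<^esub> (x \<oplus>\<^bsub>ext_alg n\<^esub> y) =
      z \<otimes>\<^bsub>ext_alg n\<^esub> x \<oplus>\<^bsub>ext_alg n\<^esub> z \<otimes>\<^bsub>ext_alg n\<^esub> y"
    by (simp add: ext_alg_def wedge_def distrib_left distrib_right sum.distrib)
qed


section \<open>The Orlik--Solomon algebra\<close>

text \<open>An arrangement is ordered by listing its hyperplanes in \<open>Hs\<close>; \<open>e\<^sub>i\<close> is the generator
  belonging to \<open>Hs ! i\<close>.\<close>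

definition hyps :: "complex vec set list \<Rightarrow> nat set \<Rightarrow> complex vec set set" where
  "hyps Hs S = (!) Hs ` S"

definition dependent :: "nat \<Rightarrow> complex vec set set \<Rightarrow> bool" where
  "dependent l S \<longleftrightarrow> intersection l S \<noteq> {} \<and> aff_codim l (intersection l S) < card S"

definition minimal_dependent :: "nat \<Rightarrow> complex vec set set \<Rightarrow> bool" where
  "minimal_dependent l S \<longleftrightarrow> dependent l S \<and> (\<forall>T. T \<subset> S \<longrightarrow> \<not> dependent l T)"

text \<open>\<open>bd_mono S\<close> is \<open>\<partial>e\<^sub>S\<close>. The exponent is the (1-based) position of \<open>i\<close> in \<open>S\<close>.\<close>

definition bd_mono :: "nat set \<Rightarrow> nat set \<Rightarrow> 'k::field" where
  "bd_mono S = (\<lambda>T. \<Sum>i\<in>S. (-1) ^ card {j \<in> S. j \<le> i} * mono_elt (S - {i}) T)"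

definition os_relations :: "nat \<Rightarrow> complex vec set list \<Rightarrow> (nat set \<Rightarrow> 'k::field) set" where
  "os_relations l Hs =
     {bd_mono S | S. S \<subseteq> {..<length Hs} \<and> minimal_dependent l (hyps Hs S)} \<union>
     {mono_elt S | S. S \<subseteq> {..<length Hs} \<and> intersection l (hyps Hs S) = {}}"

definition os_ideal :: "nat \<Rightarrow> complex vec set list \<Rightarrow> (nat set \<Rightarrow> 'k::field) set" where
  "os_ideal l Hs = Idl\<^bsub>ext_alg (length Hs)\<^esub> (os_relations l Hs)"

text \<open>The quotient ring, together with its structure of a left module over the exterior algebra.\<close>

definition os_algebra ::
  "nat \<Rightarrow> complex vec set list \<Rightarrow> (nat set \<Rightarrow> 'k::field, (nat set \<Rightarrow> 'k) set) module" where
  "os_algebra l Hs =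
     (let E = ext_alg (length Hs); I = os_ideal l Hs; Q = E Quot I
      in ring.extend Q (module.fields (\<lambda>x a. (I +>\<^bsub>E\<^esub> x) \<otimes>\<^bsub>Q\<^esub> a)))"


section \<open>Singular varieties\<close>

definition singular_on :: "('r, 'm, 'z) module_scheme \<Rightarrow> 'r \<Rightarrow> bool" where
  "singular_on M x \<longleftrightarrow>
     {m \<in> carrier M. x \<odot>\<^bsub>M\<^esub> m = \<zero>\<^bsub>M\<^esub>} \<noteq> (\<lambda>m. x \<odot>\<^bsub>M\<^esub> m) ` carrier M"

definition singular_variety ::
  "nat \<Rightarrow> (nat set \<Rightarrow> 'k::field, 'm, 'z) module_scheme \<Rightarrow> (nat set \<Rightarrow> 'k) set" where
  "singular_variety n M = {x \<in> ext_grade n 1. singular_on M x}"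

text \<open>The coordinate dual to the generator \<open>e\<^sub>i\<close>.\<close>

definition coord :: "nat \<Rightarrow> (nat set \<Rightarrow> 'k::field) \<Rightarrow> 'k" where
  "coord i x = x {i}"

definition ext_subspace :: "nat \<Rightarrow> (nat set \<Rightarrow> 'k::field) set \<Rightarrow> ('k, nat set \<Rightarrow> 'k) module" where
  "ext_subspace n W = ext_alg n\<lparr>carrier := W\<rparr>"

end

theory Submission
  imports Defs
begin

text \<open>
  An element \<open>x\<close> of degree one squares to zero, so it is nonsingular on \<open>A = E / I\<close> exactly when
  multiplication by \<open>x\<close> on \<open>A\<close> is exact. The hyperplanes fall into blocks, one for each irreducible
  factor. The claim is that multiplication by \<open>x\<close> is exact if and only if the coordinates of \<open>x\<close> have
  nonzero sum over the block of some central factor.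

  For a block \<open>Y\<close>, let \<open>D\<close> be the derivation of \<open>E\<close> of degree minus one that sends \<open>e\<^sub>i\<close> to 1 for
  \<open>i \<in> Y\<close> and to 0 otherwise (\<open>contr Y\<close>); it satisfies
  \<open>D (x \<and> a) = s a - x \<and> D a\<close>, where \<open>s\<close> is the sum of the coordinates of \<open>x\<close> over \<open>Y\<close>. If the factor is
  central, then \<open>D\<close> maps \<open>I\<close> to itself (\<open>contr_block_I\<close>): a circuit lies in a single block, and \<open>D\<close>
  kills its boundary; a set with empty intersection has empty intersection inside some noncentral block
  already, so it keeps this property when an element of \<open>Y\<close> is removed. Hence, if \<open>s \<noteq> 0\<close>, then \<open>D / s\<close> is
  a contracting homotopy (\<open>exact_of_nonzero_weight\<close>).

  Conversely, suppose that all these sums vanish and that multiplication by \<open>x\<close> is exact. Let \<open>e\<close> be the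
  generator of the least index in a central block. The map \<open>a \<mapsto> D (e \<and> a)\<close> is a projection with kernel
  the multiples of \<open>e\<close>, and it commutes with multiplication by \<open>x\<close>; so exactness survives when \<open>e\<close> is added to
  the ideal, for all central blocks in turn (\<open>admissible_insert\<close>). The resulting quotient has as
  basis the monomials without broken circuits that avoid the least indices of the central blocks. An exact
  differential of odd degree on a finite-dimensional space forces the number of basis
  elements of even degree to equal the number of those of odd degree
  (\<open>exact_mod_imp_alt_count_zero\<close>), so the alternating count of these monomials is zero.

  But this count is a product over all factors (\<open>alt_count_reduced\<close>), and each factor contributes, up to
  sign, Crapo's beta invariant of a matroid: of the arrangement itself if the factor is central, and of its
  cone if it is not. By deletion and contraction, the beta invariant of a connected matroid is positive
  (\<open>alt_count_reduced_nbc\<close>), because a connected matroid with at least two elements stays connected under the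
  deletion or under the contraction of any given element (\<open>connected_delete_or_contract\<close>). Irreducible
  arrangements have connected matroids, because a separation of the matroid gives coordinates in
  which the arrangement is a product (\<open>splitting_reducible\<close>). So the count is nonzero, a contradiction.

  That the monomials without broken circuits form a basis of \<open>A\<close> over every field is proved by rewriting
  with boundaries of dependent sets (\<open>nbc_spans\<close>) and by iterated residues along flags of
  intersections, which are functionals that vanish on \<open>I\<close> and are triangular on these monomials
  (\<open>nbc_independent\<close>). The codimension is the rank of the map that sends \<open>x\<close> to its sums over
  the central blocks (\<open>dim_weightless\<close>).
\<close>

section \<open>Matroids given by a rank function\<close>

text \<open>Rank functions are characterized by unit increase and the exchange condition that an element which
  does not raise the rank of a set does not raise the rank of a larger set either. Only values on subsets of the
  ground set matter, so restriction to a smaller ground set leaves \<open>r\<close> unchanged.\<close>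

definition matroid_rank :: "'a set \<Rightarrow> ('a set \<Rightarrow> nat) \<Rightarrow> bool" where
  "matroid_rank E r \<longleftrightarrow> r {} = 0 \<and>
     (\<forall>S e. S \<subseteq> E \<and> e \<in> E \<longrightarrow> r S \<le> r (insert e S) \<and> r (insert e S) \<le> r S + 1) \<and>
     (\<forall>S T e. S \<subseteq> T \<and> T \<subseteq> E \<and> e \<in> E \<and> r (insert e S) = r S \<longrightarrow> r (insert e T) = r T)"

lemma matroid_rankD:
  assumes "matroid_rank E r"
  shows "r {} = 0"
    and "S \<subseteq> E \<Longrightarrow> e \<in> E \<Longrightarrow> r S \<le> r (insert e S)"
    and "S \<subseteq> E \<Longrightarrow> e \<in> E \<Longrightarrow> r (insert e S) \<le> r S + 1"
    and "S \<subseteq> T \<Longrightarrow> T \<subseteq> E \<Longrightarrow> e \<in> E \<Longrightarrow> r (insert e S) = r S \<Longrightarrow> r (insert e T) = r T"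
  using assms unfolding matroid_rank_def by blast+

lemma matroid_rank_subset: "matroid_rank E r \<Longrightarrow> F \<subseteq> E \<Longrightarrow> matroid_rank F r"
  unfolding matroid_rank_def by (meson subset_trans subsetD)

lemma matroid_rank_mono:
  assumes "matroid_rank E r" "finite T" "S \<subseteq> T" "T \<subseteq> E"
  shows "r S \<le> r T"
proof -
  have "r S \<le> r (S \<union> D)" if "finite D" "D \<subseteq> E" for D
    using that
  proof (induction D rule: finite_induct)
    case (insert d D)
    then have "r (S \<union> D) \<le> r (insert d (S \<union> D))"
      using assms by (intro matroid_rankD(2)[OF assms(1)]) auto
    then show ?case using insert by simp
  qed simp
  from this[of T] assms show ?thesis by (simp add: Un_absorb1)
qed

text \<open>The elements of \<open>B - A\<close> are added one at a time to \<open>A \<inter> B\<close> and to \<open>A\<close>; whenever the latter rank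
  goes up, so does the former.\<close>

lemma matroid_rank_submodular:
  assumes "matroid_rank E r" "finite E" "A \<subseteq> E" "B \<subseteq> E"
  shows "r (A \<union> B) + r (A \<inter> B) \<le> r A + r B"
proof -
  have "r (A \<union> D) + r (A \<inter> B) \<le> r A + r ((A \<inter> B) \<union> D)" if "finite D" "D \<subseteq> E" for D
    using that
  proof (induction D rule: finite_induct)
    case (insert d D)
    let ?X = "A \<union> D" and ?Y = "(A \<inter> B) \<union> D"
    have sub: "?Y \<subseteq> ?X" "?X \<subseteq> E" "?Y \<subseteq> E" "d \<in> E" using insert assms by auto
    have "r (insert d ?X) \<le> r ?X + 1" by (rule matroid_rankD(3)[OF assms(1) sub(2,4)])
    moreover have "r ?Y \<le> r (insert d ?Y)" by (rule matroid_rankD(2)[OF assms(1) sub(3,4)])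
    moreover have "r (insert d ?Y) = r ?Y \<Longrightarrow> r (insert d ?X) = r ?X"
      by (rule matroid_rankD(4)[OF assms(1) sub(1,2,4)])
    ultimately have "r (insert d ?X) + r ?Y \<le> r ?X + r (insert d ?Y)" by linarith
    then show ?case using insert by simp
  qed simp
  from this[of "B - A"] have "r (A \<union> (B - A)) + r (A \<inter> B) \<le> r A + r (A \<inter> B \<union> (B - A))"
    using assms finite_subset[of B E] by auto
  moreover have "A \<union> (B - A) = A \<union> B" "A \<inter> B \<union> (B - A) = B" by auto
  ultimately show ?thesis by simp
qed

definition contract :: "'a \<Rightarrow> ('a set \<Rightarrow> nat) \<Rightarrow> 'a set \<Rightarrow> nat" where
  "contract e r S = r (insert e S) - r {e}"

lemma contract_rank:
  assumes "matroid_rank E r" "finite S" "S \<subseteq> E" "e \<in> E"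
  shows "r (insert e S) = contract e r S + r {e}"
  using matroid_rank_mono[OF assms(1), of "insert e S" "{e}"] assms unfolding contract_def by simp

lemma matroid_rank_contract:
  assumes "matroid_rank E r" "finite E" "e \<in> E"
  shows "matroid_rank (E - {e}) (contract e r)"
proof -
  have r: "r (insert e S) = contract e r S + r {e}" if "S \<subseteq> E" for S
    using contract_rank[OF assms(1) _ that assms(3)] finite_subset[OF that assms(2)] by simp
  note D = matroid_rankD[OF assms(1)]
  have A: "contract e r S \<le> contract e r (insert f S) \<and> contract e r (insert f S) \<le> contract e r S + 1"
    if "S \<subseteq> E - {e}" "f \<in> E - {e}" for S f
    using D(2,3)[of "insert e S" f] r[of S] r[of "insert f S"] that assms(3)
    by (auto simp: insert_commute[of e f])
  have B: "contract e r (insert f T) = contract e r T"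
    if "S \<subseteq> T" "T \<subseteq> E - {e}" "f \<in> E - {e}" "contract e r (insert f S) = contract e r S" for S T f
  proof -
    have "S \<subseteq> E" "T \<subseteq> E" "insert f S \<subseteq> E" "insert f T \<subseteq> E" using that by auto
    then have "r (insert f (insert e S)) = r (insert e S)"
      using r[of S] r[of "insert f S"] that(4) by (simp add: insert_commute[of e f])
    then have "r (insert f (insert e T)) = r (insert e T)"
      using D(4)[of "insert e S" "insert e T" f] that assms(3) by auto
    then show ?thesis
      using r[OF \<open>T \<subseteq> E\<close>] r[OF \<open>insert f T \<subseteq> E\<close>] by (simp add: insert_commute[of e f])
  qed
  show ?thesis unfolding matroid_rank_def
    using A B by (auto simp: contract_def)
qed

definition connected_matroid :: "'a set \<Rightarrow> ('a set \<Rightarrow> nat) \<Rightarrow> bool" where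
  "connected_matroid E r \<longleftrightarrow> r E > 0 \<and>
     (\<forall>P Q. P \<union> Q = E \<and> P \<inter> Q = {} \<and> P \<noteq> {} \<and> Q \<noteq> {} \<longrightarrow> r P + r Q \<noteq> r E)"

lemma connected_matroid_gt:
  assumes "matroid_rank E r" "finite E" "connected_matroid E r"
    "P \<union> Q = E" "P \<inter> Q = {}" "P \<noteq> {}" "Q \<noteq> {}"
  shows "r E < r P + r Q"
proof -
  have "r E \<le> r P + r Q"
    using matroid_rank_submodular[OF assms(1,2), of P Q] assms by auto
  moreover have "r P + r Q \<noteq> r E" using assms unfolding connected_matroid_def by blast
  ultimately show ?thesis by linarith
qed

lemma connected_matroid_loopless:
  assumes "matroid_rank E r" "finite E" "connected_matroid E r" "e \<in> E"
  shows "r {e} = 1"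
proof -
  have "r {e} \<noteq> 0"
  proof (cases "E = {e}")
    case False
    then have "r E < r {e} + r (E - {e})"
      by (intro connected_matroid_gt[OF assms(1-3)]) (use assms in auto)
    moreover have "r (E - {e}) \<le> r E" by (rule matroid_rank_mono) (use assms in auto)
    ultimately show ?thesis by linarith
  qed (use assms in \<open>simp add: connected_matroid_def\<close>)
  then show ?thesis using matroid_rankD(1)[OF assms(1)] matroid_rankD(3)[OF assms(1), of "{}" e] assms by simp
qed

text \<open>If both the deletion and the contraction of \<open>e\<close> are separable, by \<open>A, B\<close> and by \<open>C, D\<close>,
  then adding the two equations of ranks and uncrossing with submodularity produces a separation of the whole
  matroid, as soon as two opposite cells among \<open>A \<inter> C\<close>, \<open>A \<inter> D\<close>, \<open>B \<inter> C\<close>, \<open>B \<inter> D\<close> are nonempty.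
  As all four sets are nonempty, this holds for one of the two opposite pairs.\<close>

lemma connected_delete_or_contract:
  assumes M: "matroid_rank E r" "finite E" "connected_matroid E r" and e: "e \<in> E" "E - {e} \<noteq> {}"
  shows "connected_matroid (E - {e}) r \<or> connected_matroid (E - {e}) (contract e r)"
proof (rule ccontr)
  assume neg: "\<not> ?thesis"
  let ?E = "E - {e}"
  note gt = connected_matroid_gt[OF M]
  have mono: "r S \<le> r T" if "S \<subseteq> T" "T \<subseteq> E" for S T
    using matroid_rank_mono[OF M(1) _ that] finite_subset[OF that(2) M(2)] by simp
  have sm: "r (S \<union> T) + r (S \<inter> T) \<le> r S + r T" if "S \<subseteq> E" "T \<subseteq> E" for S T
    by (rule matroid_rank_submodular[OF M(1,2) that])
  have le: "r {e} = 1" by (rule connected_matroid_loopless[OF M e(1)])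
  have "r E < r {e} + r ?E" by (rule gt) (use e in auto)
  with le mono[of ?E E] have rE: "r ?E = r E" by auto
  have pos: "r E > 0" using M(3) unfolding connected_matroid_def by simp
  from neg rE pos obtain A B where AB: "A \<union> B = ?E" "A \<inter> B = {}" "A \<noteq> {}" "B \<noteq> {}" "r A + r B = r E"
    unfolding connected_matroid_def by auto
  have nl: "r S \<ge> 1" if "S \<subseteq> E" "S \<noteq> {}" for S
  proof -
    from that obtain s where "s \<in> S" by auto
    then show ?thesis using mono[of "{s}" S] connected_matroid_loopless[OF M, of s] that by auto
  qed
  have "r A \<ge> 1" "r B \<ge> 1" by (rule nl; use AB in auto)+
  with AB(5) have "r E \<ge> 2" by linarith
  have c: "r (insert e S) = contract e r S + 1" if "S \<subseteq> E" for S
    using contract_rank[OF M(1) _ that e(1)] finite_subset[OF that M(2)] le by simp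
  have "contract e r ?E + 1 = r E" using c[of ?E] e by (simp add: insert_absorb)
  then have "contract e r ?E > 0" using \<open>r E \<ge> 2\<close> by linarith
  with neg obtain C D where CD: "C \<union> D = ?E" "C \<inter> D = {}" "C \<noteq> {}" "D \<noteq> {}"
      "contract e r C + contract e r D = contract e r ?E"
    unfolding connected_matroid_def by auto
  then have CD5: "r (insert e C) + r (insert e D) = r E + 1"
    using c[of C] c[of D] \<open>contract e r ?E + 1 = r E\<close> by fastforce
  \<comment> \<open>Uncrossing: a separation of the deletion and one of the contraction yield separations of the matroid.\<close>
  have key: "A' \<inter> C' = {} \<or> B' \<inter> D' = {}"
    if h: "A' \<union> B' = ?E" "A' \<inter> B' = {}" "r A' + r B' = r E"
      "C' \<union> D' = ?E" "C' \<inter> D' = {}" "r (insert e C') + r (insert e D') = r E + 1" for A' B' C' D'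
  proof (rule ccontr)
    assume ne: "\<not> ?thesis"
    have "r E < r (A' \<inter> C') + r (insert e (B' \<union> D'))" by (rule gt) (use h ne e in auto)
    moreover have "r E < r (B' \<inter> D') + r (insert e (A' \<union> C'))" by (rule gt) (use h ne e in auto)
    moreover have "r (insert e (A' \<union> C')) + r (A' \<inter> C') \<le> r A' + r (insert e C')"
    proof -
      have "A' \<union> insert e C' = insert e (A' \<union> C')" "A' \<inter> insert e C' = A' \<inter> C'" using h by auto
      then show ?thesis using sm[of A' "insert e C'"] h e by auto
    qed
    moreover have "r (insert e (B' \<union> D')) + r (B' \<inter> D') \<le> r B' + r (insert e D')"
    proof -
      have "B' \<union> insert e D' = insert e (B' \<union> D')" "B' \<inter> insert e D' = B' \<inter> D'" using h by auto
      then show ?thesis using sm[of B' "insert e D'"] h e by auto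
    qed
    ultimately show False using h by linarith
  qed
  have "A \<inter> C = {} \<or> B \<inter> D = {}" by (rule key) (use AB CD CD5 in auto)
  moreover have "A \<inter> D = {} \<or> B \<inter> C = {}" by (rule key) (use AB CD CD5 in auto)
  moreover have "\<not> (A \<inter> C = {} \<and> A \<inter> D = {})" "\<not> (B \<inter> D = {} \<and> B \<inter> C = {})"
    "\<not> (A \<inter> C = {} \<and> B \<inter> C = {})" "\<not> (B \<inter> D = {} \<and> A \<inter> D = {})"
    using AB(1,3,4) CD(1,3,4) by auto
  ultimately show False by argo
qed

text \<open>The condition says that \<open>e\<close> is not in the span of the elements of \<open>S\<close> above \<open>e\<close>. For an element
  \<open>e\<close> of \<open>S\<close> it excludes a circuit in \<open>S\<close>, and for other elements a broken circuit \<open>C - {Min C}\<close> in \<open>S\<close>.\<close>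

definition rank_nbc :: "'a::linorder set \<Rightarrow> ('a set \<Rightarrow> nat) \<Rightarrow> 'a set \<Rightarrow> bool" where
  "rank_nbc E r S \<longleftrightarrow> (\<forall>e\<in>E. r (insert e {s \<in> S. e < s}) \<noteq> r {s \<in> S. e < s})"

definition reduced_nbc :: "'a::linorder set \<Rightarrow> ('a set \<Rightarrow> nat) \<Rightarrow> 'a set set" where
  "reduced_nbc E r = {S. S \<subseteq> E - {Min E} \<and> rank_nbc E r S}"

definition alt_count :: "'a set set \<Rightarrow> int" where
  "alt_count \<N> = (\<Sum>S\<in>\<N>. (-1) ^ card S)"

lemma finite_reduced_nbc: "finite E \<Longrightarrow> finite (reduced_nbc E r)"
  by (rule finite_subset[of _ "Pow E"]) (auto simp: reduced_nbc_def)

text \<open>Since \<open>e\<close> is the largest element, the sets without broken circuits that avoid \<open>e\<close> are those of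
  the deletion, and those that contain \<open>e\<close> are the sets of the contraction with \<open>e\<close> added.\<close>

lemma alt_count_deletion_contraction:
  fixes E :: "'a::linorder set"
  assumes M: "matroid_rank E r" "finite E" and e: "e = Max E" "E - {e} \<noteq> {}" and nl: "r {e} \<noteq> 0"
  shows "alt_count (reduced_nbc E r) =
    alt_count (reduced_nbc (E - {e}) r) - alt_count (reduced_nbc (E - {e}) (contract e r))"
proof -
  let ?E = "E - {e}"
  have eE: "e \<in> E" using e M by (metis Diff_empty Diff_eq_empty_iff Max_in empty_subsetI subset_antisym)
  have lt: "f < e" if "f \<in> ?E" for f using that M e Max_ge[of E f] by (metis Diff_iff insertI1 order_less_le)
  have "Min E = Min (insert e ?E)" using eE by (simp add: insert_absorb)
  also have "\<dots> = min e (Min ?E)" by (rule Min_insert) (use M e in auto)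
  also have "\<dots> = Min ?E"
  proof -
    have "Min ?E \<in> ?E" using M(2) e(2) by (intro Min_in) auto
    from lt[OF this] show ?thesis by simp
  qed
  finally have min: "Min E = Min ?E" .
  have Min_ne: "Min E \<noteq> e" using min lt[of "Min ?E"] Min_in[of ?E] M e by auto
  have c: "r (insert e S) = contract e r S + r {e}" if "S \<subseteq> E" for S
    using contract_rank[OF M(1) _ that eE] finite_subset[OF that M(2)] by simp
  have split: "rank_nbc E r S \<longleftrightarrow> (\<forall>f\<in>?E. r (insert f {s \<in> S. f < s}) \<noteq> r {s \<in> S. f < s})" if "S \<subseteq> E" for S
  proof -
    have *: "{s \<in> S. e < s} = {}" using that M e by (auto simp: not_less)
    have "r (insert e {s \<in> S. e < s}) \<noteq> r {s \<in> S. e < s}"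
      unfolding * using nl matroid_rankD(1)[OF M(1)] by simp
    then show ?thesis unfolding rank_nbc_def by blast
  qed
  have A: "{S \<in> reduced_nbc E r. e \<notin> S} = reduced_nbc ?E r"
    unfolding reduced_nbc_def min[symmetric] using split
    by (auto simp: rank_nbc_def)
  have B: "rank_nbc E r (insert e S) \<longleftrightarrow> rank_nbc ?E (contract e r) S" if "S \<subseteq> ?E" for S
  proof -
    have "r (insert f {s \<in> insert e S. f < s}) \<noteq> r {s \<in> insert e S. f < s} \<longleftrightarrow>
        contract e r (insert f {s \<in> S. f < s}) \<noteq> contract e r {s \<in> S. f < s}" if f: "f \<in> ?E" for f
    proof -
      have *: "{s \<in> insert e S. f < s} = insert e {s \<in> S. f < s}" using lt[OF f] by auto
      moreover have "r (insert e {s \<in> S. f < s}) = contract e r {s \<in> S. f < s} + r {e}"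
        by (rule c) (use \<open>S \<subseteq> ?E\<close> in auto)
      moreover have "r (insert e (insert f {s \<in> S. f < s})) = contract e r (insert f {s \<in> S. f < s}) + r {e}"
        by (rule c) (use \<open>S \<subseteq> ?E\<close> f in auto)
      ultimately show ?thesis using * by (simp add: insert_commute[of f e])
    qed
    moreover have "insert e S \<subseteq> E" using that eE by auto
    ultimately show ?thesis unfolding split[OF \<open>insert e S \<subseteq> E\<close>] by (simp add: rank_nbc_def)
  qed
  have C: "{S \<in> reduced_nbc E r. e \<in> S} = insert e ` reduced_nbc ?E (contract e r)"
  proof (intro Set.set_eqI iffI)
    fix S assume "S \<in> {S \<in> reduced_nbc E r. e \<in> S}"
    then have S: "S \<subseteq> E - {Min E}" "rank_nbc E r S" "e \<in> S" by (auto simp: reduced_nbc_def)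
    then have "S - {e} \<in> reduced_nbc ?E (contract e r)"
      using B[of "S - {e}"] min by (auto simp: reduced_nbc_def insert_absorb)
    then show "S \<in> insert e ` reduced_nbc ?E (contract e r)" using S(3) by (metis image_eqI insert_Diff)
  next
    fix S assume "S \<in> insert e ` reduced_nbc ?E (contract e r)"
    then obtain S' where "S = insert e S'" "S' \<subseteq> ?E - {Min ?E}" "rank_nbc ?E (contract e r) S'"
      by (auto simp: reduced_nbc_def)
    then show "S \<in> {S \<in> reduced_nbc E r. e \<in> S}"
      using B[of S'] min Min_ne eE by (auto simp: reduced_nbc_def)
  qed
  have fin: "finite (reduced_nbc E r)" by (rule finite_reduced_nbc[OF M(2)])
  have "alt_count (reduced_nbc E r) = (\<Sum>S\<in>{S \<in> reduced_nbc E r. e \<notin> S} \<union> {S \<in> reduced_nbc E r. e \<in> S}. (-1) ^ card S)"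
    unfolding alt_count_def by (rule sum.cong) auto
  also have "\<dots> = alt_count {S \<in> reduced_nbc E r. e \<notin> S} + alt_count {S \<in> reduced_nbc E r. e \<in> S}"
    unfolding alt_count_def using fin by (intro sum.union_disjoint) auto
  also have "alt_count {S \<in> reduced_nbc E r. e \<in> S} = - alt_count (reduced_nbc ?E (contract e r))"
  proof -
    have "inj_on (insert e) (reduced_nbc ?E (contract e r))"
      by (auto simp: inj_on_def reduced_nbc_def)
    moreover have "card (insert e S) = Suc (card S)" if "S \<in> reduced_nbc ?E (contract e r)" for S
      using that M finite_subset[of S E] by (subst card_insert_disjoint) (auto simp: reduced_nbc_def)
    ultimately show ?thesis unfolding C alt_count_def by (simp add: sum.reindex sum_negf)
  qed
  finally show ?thesis using A by simp
qed

text \<open>Up to sign, the alternating count is the beta invariant. It vanishes in the presence of a loop. It also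
  vanishes for a coloop \<open>e\<close> of a larger matroid, where deletion and contraction agree. Otherwise both terms of the
  recursion have the same sign, and if the matroid is connected, then one of them is nonzero.\<close>

theorem alt_count_reduced_nbc:
  fixes E :: "'a::linorder set"
  assumes "matroid_rank E r" "finite E" "E \<noteq> {}"
  shows "0 \<le> (-1) ^ (r E + 1) * alt_count (reduced_nbc E r)"
    and "connected_matroid E r \<Longrightarrow> 0 < (-1) ^ (r E + 1) * alt_count (reduced_nbc E r)"
proof -
  have "0 \<le> (-1) ^ (r E + 1) * alt_count (reduced_nbc E r) \<and>
    (connected_matroid E r \<longrightarrow> 0 < (-1) ^ (r E + 1) * alt_count (reduced_nbc E r))"
    using assms
  proof (induction "card E" arbitrary: E r)
    case 0
    then show ?case by simp
  next
    case (Suc k)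
    define e where "e = Max E"
    have eE: "e \<in> E" using Suc.prems by (simp add: e_def)
    let ?E = "E - {e}"
    note M = Suc.prems(1)
    have r1: "r {e} \<le> 1" using matroid_rankD(1)[OF M] matroid_rankD(3)[OF M, of "{}" e] eE by simp
    show ?case
    proof (cases "r {e} = 0")
      case True
      have loop: "{s \<in> S. e < s} = {}" if "S \<subseteq> E" for S
        using that Suc.prems by (auto simp: e_def not_less)
      have "\<not> rank_nbc E r S" if "S \<subseteq> E" for S
        using loop[OF that] eE True matroid_rankD(1)[OF M] unfolding rank_nbc_def
        by (metis (no_types, lifting))
      then have "reduced_nbc E r = {}" unfolding reduced_nbc_def by blast
      then show ?thesis
        using True connected_matroid_loopless[OF M Suc.prems(2) _ eE] by (auto simp: alt_count_def)
    next
      case nl: False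
      show ?thesis
      proof (cases "?E = {}")
        case True
        then have E: "E = {e}" using eE by auto
        have "reduced_nbc E r = {{}}"
          using nl matroid_rankD(1)[OF M] unfolding E by (auto simp: reduced_nbc_def rank_nbc_def)
        then show ?thesis using nl r1 by (simp add: alt_count_def E le_Suc_eq)
      next
        case False
        have rec: "alt_count (reduced_nbc E r) =
            alt_count (reduced_nbc ?E r) - alt_count (reduced_nbc ?E (contract e r))"
          by (rule alt_count_deletion_contraction[OF M Suc.prems(2) e_def False nl])
        have cd: "card ?E = k" using Suc.hyps(2) Suc.prems eE by simp
        have fE: "finite ?E" using Suc.prems by simp
        have Md: "matroid_rank ?E r" by (rule matroid_rank_subset[OF M]) auto
        have Mc: "matroid_rank ?E (contract e r)" by (rule matroid_rank_contract[OF M Suc.prems(2) eE])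
        note IHd = Suc.hyps(1)[OF cd[symmetric] Md fE False]
        note IHc = Suc.hyps(1)[OF cd[symmetric] Mc fE False]
        have rc: "r E = contract e r ?E + 1"
          using contract_rank[OF M fE _ eE] nl r1 eE by (simp add: insert_absorb)
        show ?thesis
        proof (cases "r ?E = r E")
          case True
          have "(-1) ^ (r E + 1) * alt_count (reduced_nbc E r) =
              (-1) ^ (r ?E + 1) * alt_count (reduced_nbc ?E r) +
              (-1) ^ (contract e r ?E + 1) * alt_count (reduced_nbc ?E (contract e r))"
            unfolding rec True[symmetric] by (simp add: True rc algebra_simps)
          then show ?thesis
            using IHd IHc connected_delete_or_contract[OF M Suc.prems(2) _ eE False] by linarith
        next
          case co: False
          \<comment> \<open>A coloop: deletion and contraction are the same matroid.\<close>
          have "contract e r S = r S" if "S \<subseteq> ?E" for S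
          proof -
            have "r (insert e S) \<noteq> r S"
            proof
              assume "r (insert e S) = r S"
              then have "r (insert e ?E) = r ?E" using matroid_rankD(4)[OF M that _ eE] by auto
              then show False using co eE by (simp add: insert_absorb)
            qed
            then have "r (insert e S) = r S + 1"
              using matroid_rankD(2,3)[OF M, of S e] that eE by fastforce
            moreover have "r (insert e S) = contract e r S + r {e}"
              using that by (intro contract_rank[OF M _ _ eE] finite_subset[OF that fE]) auto
            ultimately show ?thesis using nl r1 by linarith
          qed
          then have "rank_nbc ?E (contract e r) S = rank_nbc ?E r S" if "S \<subseteq> ?E" for S
            unfolding rank_nbc_def
            using that by (intro ball_cong refl) (simp add: subset_iff)
          then have "reduced_nbc ?E (contract e r) = reduced_nbc ?E r"
            unfolding reduced_nbc_def by auto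
          then have "alt_count (reduced_nbc E r) = 0" unfolding rec by (simp only: diff_self)
          moreover have "\<not> connected_matroid E r"
          proof
            assume "connected_matroid E r"
            then have "r E < r {e} + r ?E"
              by (intro connected_matroid_gt[OF M Suc.prems(2)]) (use eE False in auto)
            moreover have "r ?E \<le> r E" by (rule matroid_rank_mono[OF M]) (use Suc.prems in auto)
            ultimately show False using co r1 by linarith
          qed
          ultimately show ?thesis by simp
        qed
      qed
    qed
  qed
  then show "0 \<le> (-1) ^ (r E + 1) * alt_count (reduced_nbc E r)"
    and "connected_matroid E r \<Longrightarrow> 0 < (-1) ^ (r E + 1) * alt_count (reduced_nbc E r)" by blast+
qed

section \<open>The exterior algebra\<close>

lemma wedge_infinite: "infinite U \<Longrightarrow> wedge x y U = 0"
  by (simp add: wedge_def)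

lemma wedge_add_left: "wedge (\<lambda>S. x S + y S) z = (\<lambda>U. wedge x z U + wedge y z U)"
  and wedge_add_right: "wedge z (\<lambda>S. x S + y S) = (\<lambda>U. wedge z x U + wedge z y U)"
  and wedge_diff_right: "wedge z (\<lambda>S. x S - y S) = (\<lambda>U. wedge z x U - wedge z y U)"
  and wedge_smult_left: "wedge (\<lambda>S. c * x S) z = (\<lambda>U. c * wedge x z U)"
  and wedge_smult_right: "wedge z (\<lambda>S. c * x S) = (\<lambda>U. c * wedge z x U)"
  and wedge_uminus_left: "wedge (\<lambda>S. - x S) z = (\<lambda>U. - wedge x z U)"
  and wedge_uminus_right: "wedge z (\<lambda>S. - x S) = (\<lambda>U. - wedge z x U)"
  and wedge_zero_left: "wedge (\<lambda>S. 0) z = (\<lambda>U. 0)"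
  and wedge_zero_right: "wedge z (\<lambda>S. 0) = (\<lambda>U. 0)"
  by (rule ext; simp add: wedge_def algebra_simps sum.distrib sum_distrib_left sum_subtractf sum_negf)+

lemma wedge_sum_left: "wedge (\<lambda>S. \<Sum>i\<in>I. f i S) z = (\<lambda>U. \<Sum>i\<in>I. wedge (f i) z U)"
proof
  fix U
  have "wedge (\<lambda>S. \<Sum>i\<in>I. f i S) z U = (\<Sum>S\<in>Pow U. \<Sum>i\<in>I. wedge_sign S (U - S) * f i S * z (U - S))"
    by (simp add: wedge_def sum_distrib_left sum_distrib_right)
  also have "\<dots> = (\<Sum>i\<in>I. wedge (f i) z U)" unfolding wedge_def by (rule sum.swap)
  finally show "wedge (\<lambda>S. \<Sum>i\<in>I. f i S) z U = (\<Sum>i\<in>I. wedge (f i) z U)" .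
qed

lemma wedge_sum_right: "wedge z (\<lambda>S. \<Sum>i\<in>I. f i S) = (\<lambda>U. \<Sum>i\<in>I. wedge z (f i) U)"
proof
  fix U
  have "wedge z (\<lambda>S. \<Sum>i\<in>I. f i S) U = (\<Sum>S\<in>Pow U. \<Sum>i\<in>I. wedge_sign S (U - S) * z S * f i (U - S))"
    by (simp add: wedge_def sum_distrib_left)
  also have "\<dots> = (\<Sum>i\<in>I. wedge z (f i) U)" unfolding wedge_def by (rule sum.swap)
  finally show "wedge z (\<lambda>S. \<Sum>i\<in>I. f i S) U = (\<Sum>i\<in>I. wedge z (f i) U)" .
qed

lemma wedge_nonzero:
  assumes "wedge x y U \<noteq> 0"
  obtains S where "S \<subseteq> U" "x S \<noteq> 0" "y (U - S) \<noteq> 0"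
proof -
  obtain P where P: "P \<in> Pow U" "wedge_sign P (U - P) * x P * y (U - P) \<noteq> 0"
    using sum.not_neutral_contains_not_neutral[OF assms[unfolded wedge_def]] by blast
  then show thesis using that[of P] by auto
qed

lemma carrier_ext_alg: "carrier (ext_alg n) = {x. \<forall>S. x S \<noteq> 0 \<longrightarrow> S \<subseteq> {..<n}}"
  by (simp add: ext_alg_def)

lemma wedge_closed: "x \<in> carrier (ext_alg n) \<Longrightarrow> y \<in> carrier (ext_alg n) \<Longrightarrow> wedge x y \<in> carrier (ext_alg n)"
  using ring.ring_simprules(5)[OF ring_ext_alg, of x n y] by (simp add: ext_alg_def)

lemma mono_elt_closed: "S \<subseteq> {..<n} \<Longrightarrow> mono_elt S \<in> carrier (ext_alg n)"
  by (auto simp: carrier_ext_alg mono_elt_def)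

lemma wedge_one_left: "x \<in> carrier (ext_alg n) \<Longrightarrow> wedge (mono_elt {}) x = x"
  using ring.ring_simprules(12)[OF ring_ext_alg, of x n] by (simp add: ext_alg_def)

lemma wedge_one_right: "x \<in> carrier (ext_alg n) \<Longrightarrow> wedge x (mono_elt {}) = x"
  using ring.is_monoid[OF ring_ext_alg, of n] monoid.r_one[of "ext_alg n" x] by (simp add: ext_alg_def)

lemma sum_closed:
  "(\<And>i. i \<in> I \<Longrightarrow> f i \<in> carrier (ext_alg n)) \<Longrightarrow> (\<lambda>S. \<Sum>i\<in>I. f i S) \<in> carrier (ext_alg n)"
  unfolding carrier_ext_alg by (auto, metis (mono_tags, lifting) subsetD lessThan_iff sum.neutral)

lemma wedge_mono_elt_left:
  assumes "finite U"
  shows "wedge (mono_elt R) u U = (if R \<subseteq> U then wedge_sign R (U - R) * u (U - R) else 0)"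
proof -
  have "wedge (mono_elt R) u U = (\<Sum>S\<in>Pow U. if S = R then wedge_sign R (U - R) * u (U - R) else 0)"
    unfolding wedge_def mono_elt_def by (rule sum.cong) auto
  also have "\<dots> = (if R \<subseteq> U then wedge_sign R (U - R) * u (U - R) else 0)"
    using assms by (subst sum.delta) auto
  finally show ?thesis .
qed

subsection \<open>Signs\<close>

lemma wedge_sign_singleton_left: "wedge_sign {i} T = (-1) ^ card {t \<in> T. t < i}"
proof -
  have "{(a, b). a \<in> {i} \<and> b \<in> T \<and> b < a} = Pair i ` {t \<in> T. t < i}" by auto
  then show ?thesis unfolding wedge_sign_def by (simp add: card_image inj_on_def)
qed

lemma wedge_sign_singleton_right: "wedge_sign S {i} = (-1) ^ card {s \<in> S. i < s}"
proof -
  have "{(a, b). a \<in> S \<and> b \<in> {i} \<and> b < a} = (\<lambda>s. (s, i)) ` {s \<in> S. i < s}" by auto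
  then show ?thesis unfolding wedge_sign_def by (simp add: card_image inj_on_def)
qed

lemma wedge_sign_square: "wedge_sign S T * wedge_sign S T = (1 :: 'k::field)"
  by (simp add: wedge_sign_def power_mult_distrib[symmetric])

lemma wedge_sign_nonzero [simp]: "wedge_sign S T \<noteq> (0 :: 'k::field)"
  by (simp add: wedge_sign_def)

lemma wedge_sign_swap:
  assumes "finite S" "i \<notin> S"
  shows "wedge_sign S {i} = ((-1) ^ card S * wedge_sign {i} S :: 'k::field)"
proof -
  have "S = {s \<in> S. i < s} \<union> {s \<in> S. s < i}" using assms(2) by (auto, metis linorder_neqE_nat)
  then have "card S = card ({s \<in> S. i < s} \<union> {s \<in> S. s < i})" by simp
  also have "\<dots> = card {s \<in> S. i < s} + card {s \<in> S. s < i}"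
    using assms(1) by (intro card_Un_disjoint) auto
  finally show ?thesis
    by (simp add: wedge_sign_singleton_left wedge_sign_singleton_right power_add mult.assoc
        power_mult_distrib[symmetric])
qed

lemma wedge_sign_two: "i \<noteq> j \<Longrightarrow> wedge_sign {i} {j} = - (wedge_sign {j} {i} :: 'k::field)"
proof -
  assume ij: "i \<noteq> j"
  have "{t. t = j \<and> t < i} = (if j < i then {j} else {})"
    "{t. t = i \<and> t < j} = (if i < j then {i} else {})" by auto
  then show ?thesis unfolding wedge_sign_singleton_left using ij by auto
qed

subsection \<open>The grade involution and parity\<close>

text \<open>The grade involution enters the Leibniz rule of a derivation of odd degree; the parts of even and of odd
  degree are needed to compare dimensions.\<close>

definition invol :: "(nat set \<Rightarrow> 'k::field) \<Rightarrow> nat set \<Rightarrow> 'k" where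
  "invol a = (\<lambda>T. (-1) ^ card T * a T)"

definition parity_part :: "bool \<Rightarrow> (nat set \<Rightarrow> 'k::field) \<Rightarrow> nat set \<Rightarrow> 'k" where
  "parity_part p a = (\<lambda>T. if even (card T) = p then a T else 0)"

lemma invol_closed: "x \<in> carrier (ext_alg n) \<Longrightarrow> invol x \<in> carrier (ext_alg n)"
  and parity_part_closed: "x \<in> carrier (ext_alg n) \<Longrightarrow> parity_part p x \<in> carrier (ext_alg n)"
  by (auto simp: carrier_ext_alg invol_def parity_part_def)

lemma invol_invol [simp]: "invol (invol a) = a"
  by (simp add: invol_def mult.assoc[symmetric] power_mult_distrib[symmetric])

lemma invol_eq_parity: "invol a = (\<lambda>T. parity_part True a T - parity_part False a T)"
  by (auto simp: invol_def parity_part_def)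

lemma card_Diff_add: "finite U \<Longrightarrow> S \<subseteq> U \<Longrightarrow> card U = card S + card (U - S)"
  by (simp add: card_Diff_subset card_mono finite_subset)

lemma invol_wedge: "invol (wedge x y) = wedge (invol x) (invol y)"
proof
  fix U
  show "invol (wedge x y) U = wedge (invol x) (invol y) U"
  proof (cases "finite U")
    case True
    then show ?thesis unfolding invol_def wedge_def sum_distrib_left
      by (intro sum.cong refl) (auto simp: card_Diff_add[OF True] power_add)
  qed (simp add: invol_def wedge_infinite)
qed

lemma parity_part_wedge:
  "parity_part p (wedge x y) =
    (\<lambda>U. wedge (parity_part True x) (parity_part p y) U + wedge (parity_part False x) (parity_part (\<not> p) y) U)"
proof
  fix U
  show "parity_part p (wedge x y) U =
    wedge (parity_part True x) (parity_part p y) U + wedge (parity_part False x) (parity_part (\<not> p) y) U"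
  proof (cases "finite U")
    case True
    have "parity_part p (wedge x y) U = (\<Sum>S\<in>Pow U. if even (card U) = p then wedge_sign S (U - S) * x S * y (U - S) else 0)"
      by (simp add: parity_part_def wedge_def)
    also have "\<dots> = (\<Sum>S\<in>Pow U. wedge_sign S (U - S) * parity_part True x S * parity_part p y (U - S) +
         wedge_sign S (U - S) * parity_part False x S * parity_part (\<not> p) y (U - S))"
      by (intro sum.cong refl) (auto simp: card_Diff_add[OF True] parity_part_def)
    finally show ?thesis by (simp add: wedge_def sum.distrib)
  qed (simp add: parity_part_def wedge_infinite)
qed

subsection \<open>Contraction\<close>

text \<open>Contraction with the \<open>i\<close>-th coordinate functional: \<open>e\<^sub>i \<and> e\<^sub>T\<close> is sent to \<open>e\<^sub>T\<close> if \<open>i \<notin> T\<close>. The sum over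
  \<open>i \<in> Y\<close> is contraction with the functional that is 1 on \<open>Y\<close> and 0 elsewhere.\<close>

definition contr1 :: "nat \<Rightarrow> (nat set \<Rightarrow> 'k::field) \<Rightarrow> nat set \<Rightarrow> 'k" where
  "contr1 i a = (\<lambda>T. if i \<in> T then 0 else wedge_sign {i} T * a (insert i T))"

definition contr :: "nat set \<Rightarrow> (nat set \<Rightarrow> 'k::field) \<Rightarrow> nat set \<Rightarrow> 'k" where
  "contr Y a = (\<lambda>T. \<Sum>i\<in>Y. contr1 i a T)"

text \<open>Contraction is an antiderivation. If \<open>i \<notin> T\<close>, the subsets \<open>S\<close> of \<open>T\<close> and \<open>insert i S\<close> of
  \<open>insert i T\<close> give the two terms of the rule; if \<open>i \<in> T\<close>, the terms on the right-hand side cancel in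
  pairs.\<close>

lemma contr1_wedge:
  "contr1 i (wedge x y) = (\<lambda>T. wedge (contr1 i x) y T + wedge (invol x) (contr1 i y) T)"
proof
  fix T :: "nat set"
  show "contr1 i (wedge x y) T = wedge (contr1 i x) y T + wedge (invol x) (contr1 i y) T"
  proof (cases "finite T")
    case False
    then show ?thesis by (simp add: contr1_def wedge_infinite)
  next
    case fin: True
    show ?thesis
    proof (cases "i \<in> T")
      case False
      have inj: "inj_on (insert i) (Pow T)" using False by (auto simp: inj_on_def)
      have "wedge x y (insert i T) =
          (\<Sum>S\<in>Pow T. wedge_sign S (insert i T - S) * x S * y (insert i T - S)) +
          (\<Sum>S\<in>insert i ` Pow T. wedge_sign S (insert i T - S) * x S * y (insert i T - S))"
        unfolding wedge_def Pow_insert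
        by (rule sum.union_disjoint) (use False fin in auto)
      also have "\<dots> = (\<Sum>S\<in>Pow T. wedge_sign S (insert i T - S) * x S * y (insert i T - S) +
          wedge_sign (insert i S) (insert i T - insert i S) * x (insert i S) * y (insert i T - insert i S))"
        by (simp add: sum.reindex[OF inj] sum.distrib)
      finally have "contr1 i (wedge x y) T = (\<Sum>S\<in>Pow T. wedge_sign {i} T *
         (wedge_sign S (insert i T - S) * x S * y (insert i T - S) +
          wedge_sign (insert i S) (insert i T - insert i S) * x (insert i S) * y (insert i T - insert i S)))"
        using False by (simp only: contr1_def if_False sum_distrib_left)
      also have "\<dots> = (\<Sum>S\<in>Pow T. wedge_sign S (T - S) * contr1 i x S * y (T - S) +
          wedge_sign S (T - S) * invol x S * contr1 i y (T - S))"
      proof (rule sum.cong[OF refl])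
        fix S assume "S \<in> Pow T"
        then have S: "S \<subseteq> T" "finite S" "finite (T - S)" "i \<notin> S" "i \<notin> T - S"
          using False fin finite_subset by auto
        have T: "wedge_sign {i} T = (wedge_sign {i} S * wedge_sign {i} (T - S) :: 'a)"
          using wedge_sign_Un_right[of "{i}" S "T - S"] S by (simp add: Un_absorb1)
        have 1: "wedge_sign S (insert i (T - S)) = (wedge_sign S {i} * wedge_sign S (T - S) :: 'a)"
          using wedge_sign_Un_right[of S "{i}" "T - S"] S by simp
        have 2: "wedge_sign (insert i S) (T - S) = (wedge_sign {i} (T - S) * wedge_sign S (T - S) :: 'a)"
          using wedge_sign_Un_left[of "{i}" S "T - S"] S by simp
        have sets: "insert i T - S = insert i (T - S)" "insert i T - insert i S = T - S" using S by auto
        let ?a = "wedge_sign {i} S :: 'a" and ?b = "wedge_sign {i} (T - S) :: 'a" and ?c = "wedge_sign S (T - S) :: 'a"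
        have sq: "?a * ?a = 1" "?b * ?b = 1" by (rule wedge_sign_square)+
        have "wedge_sign {i} T * (wedge_sign S (insert i T - S) * x S * y (insert i T - S) +
           wedge_sign (insert i S) (insert i T - insert i S) * x (insert i S) * y (insert i T - insert i S)) =
           (?a * ?a) * (?b * ?c * ((-1) ^ card S * x S) * y (insert i (T - S))) + (?b * ?b) * (?a * ?c * x (insert i S) * y (T - S))"
          unfolding sets 1 2 T wedge_sign_swap[OF S(2,4)] by (simp add: algebra_simps)
        then show "wedge_sign {i} T * (wedge_sign S (insert i T - S) * x S * y (insert i T - S) +
           wedge_sign (insert i S) (insert i T - insert i S) * x (insert i S) * y (insert i T - insert i S)) =
           wedge_sign S (T - S) * contr1 i x S * y (T - S) + wedge_sign S (T - S) * invol x S * contr1 i y (T - S)"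
          unfolding sq using S by (simp add: contr1_def invol_def algebra_simps)
      qed
      finally show ?thesis by (simp add: wedge_def sum.distrib)
    next
      case True
      define T' where "T' = T - {i}"
      have T': "T = insert i T'" "i \<notin> T'" "finite T'" using True fin by (auto simp: T'_def)
      have inj: "inj_on (insert i) (Pow T')" using T' by (auto simp: inj_on_def)
      let ?f = "\<lambda>S. wedge_sign S (T - S) * contr1 i x S * y (T - S) + wedge_sign S (T - S) * invol x S * contr1 i y (T - S)"
      have "wedge (contr1 i x) y T + wedge (invol x) (contr1 i y) T = sum ?f (Pow T)"
        by (simp add: wedge_def sum.distrib)
      also have "\<dots> = sum ?f (Pow T') + sum ?f (insert i ` Pow T')"
        unfolding T'(1) Pow_insert by (rule sum.union_disjoint) (use T' in auto)
      also have "\<dots> = (\<Sum>S\<in>Pow T'. ?f S + ?f (insert i S))"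
        by (simp add: sum.reindex[OF inj] sum.distrib)
      also have "\<dots> = 0"
      proof (rule sum.neutral, rule)
        fix S assume "S \<in> Pow T'"
        then have S: "S \<subseteq> T'" "finite S" "finite (T' - S)" "i \<notin> S" "i \<notin> T' - S"
          using T' finite_subset by auto
        have sets: "T - S = insert i (T' - S)" "T - insert i S = T' - S" using S T' by auto
        have 1: "wedge_sign S (insert i (T' - S)) = (wedge_sign S {i} * wedge_sign S (T' - S) :: 'a)"
          using wedge_sign_Un_right[of S "{i}" "T' - S"] S by simp
        have 2: "wedge_sign (insert i S) (T' - S) = (wedge_sign {i} (T' - S) * wedge_sign S (T' - S) :: 'a)"
          using wedge_sign_Un_left[of "{i}" S "T' - S"] S by simp
        let ?a = "wedge_sign {i} S :: 'a" and ?b = "wedge_sign {i} (T' - S) :: 'a" and ?c = "wedge_sign S (T' - S) :: 'a"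
        have sq: "?a * ?a = 1" "?b * ?b = 1" by (rule wedge_sign_square)+
        have "?f S + ?f (insert i S) = (?a * ?a) * ((-1) ^ card S * ?c * x (insert i S) * y (insert i (T' - S)))
           - (?b * ?b) * ((-1) ^ card S * ?c * x (insert i S) * y (insert i (T' - S)))"
          unfolding sets 1 2 wedge_sign_swap[OF S(2,4)] using S
          by (simp add: contr1_def invol_def insert_absorb algebra_simps)
        then show "?f S + ?f (insert i S) = 0" unfolding sq by simp
      qed
      finally show ?thesis using True by (simp add: contr1_def)
    qed
  qed
qed

lemma contr_wedge:
  "contr Y (wedge x y) = (\<lambda>T. wedge (contr Y x) y T + wedge (invol x) (contr Y y) T)"
  unfolding contr_def contr1_wedge wedge_sum_left wedge_sum_right by (simp add: sum.distrib)

lemma contr1_linear: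
  "contr1 i (\<lambda>S. a S + b S) = (\<lambda>T. contr1 i a T + contr1 i b T)"
  "contr1 i (\<lambda>S. a S - b S) = (\<lambda>T. contr1 i a T - contr1 i b T)"
  "contr1 i (\<lambda>S. - a S) = (\<lambda>T. - contr1 i a T)"
  "contr1 i (\<lambda>S. \<Sum>k\<in>I. f k S) = (\<lambda>T. \<Sum>k\<in>I. contr1 i (f k) T)"
  by (rule ext; simp add: contr1_def algebra_simps sum_distrib_left)+

lemma contr_linear:
  "contr Y (\<lambda>S. a S + b S) = (\<lambda>T. contr Y a T + contr Y b T)"
  "contr Y (\<lambda>S. a S - b S) = (\<lambda>T. contr Y a T - contr Y b T)"
  "contr Y (\<lambda>S. - a S) = (\<lambda>T. - contr Y a T)"
  by (rule ext; simp add: contr_def contr1_linear sum.distrib sum_subtractf sum_negf)+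

lemma wedge_sign_singleton_insert:
  assumes "j \<notin> T"
  shows "wedge_sign {i} (insert j T) = (wedge_sign {i} {j} * wedge_sign {i} T :: 'k::field)"
proof -
  have fin: "finite {t \<in> T. t < i}" by (rule finite_subset[of _ "{..<i}"]) auto
  have "{t \<in> insert j T. t < i} = (if j < i then insert j {t \<in> T. t < i} else {t \<in> T. t < i})"
    "{t \<in> {j}. t < i} = (if j < i then {j} else {})" by auto
  then show ?thesis unfolding wedge_sign_singleton_left using assms fin by simp
qed

lemma contr_smult: "contr Y (\<lambda>S. c * a S) = (\<lambda>T. c * contr Y a T)"
  by (auto simp: contr_def contr1_def sum_distrib_left intro!: sum.cong ext)

lemma contr1_anticommute: "contr1 i (contr1 j a) = (\<lambda>T. - contr1 j (contr1 i a) T)"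
proof
  fix T :: "nat set"
  show "contr1 i (contr1 j a) T = - contr1 j (contr1 i a) T"
  proof (cases "i = j \<or> i \<in> T \<or> j \<in> T")
    case False
    then show ?thesis
      using wedge_sign_two[of i j, where 'k='a]
        wedge_sign_singleton_insert[of j T i, where 'k='a] wedge_sign_singleton_insert[of i T j, where 'k='a]
      by (simp add: contr1_def insert_commute[of i j])
  qed (auto simp: contr1_def)
qed

lemma contr1_contr1: "contr1 i (contr1 i a) = (\<lambda>T. 0)"
  by (rule ext) (simp add: contr1_def)

lemma contr1_contr: "contr1 i (contr Y a) = (\<lambda>T. - contr Y (contr1 i a) T)"
proof -
  have "contr1 i (contr Y a) = (\<lambda>T. \<Sum>k\<in>Y. contr1 i (contr1 k a) T)"
    unfolding contr_def by (rule contr1_linear(4))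
  also have "\<dots> = (\<lambda>T. - contr Y (contr1 i a) T)"
    unfolding contr_def sum_negf[symmetric] by (subst contr1_anticommute) (rule refl)
  finally show ?thesis .
qed

lemma contr_anticommute: "contr X (contr Y a) = (\<lambda>T. - contr Y (contr X a) T)"
proof
  fix T
  have "contr X (contr Y a) T = (\<Sum>i\<in>X. contr1 i (contr Y a) T)" by (simp add: contr_def)
  also have "\<dots> = - (\<Sum>i\<in>X. contr Y (contr1 i a) T)" by (simp add: contr1_contr sum_negf)
  also have "(\<Sum>i\<in>X. contr Y (contr1 i a) T) = (\<Sum>k\<in>Y. \<Sum>i\<in>X. contr1 k (contr1 i a) T)"
    unfolding contr_def by (rule sum.swap)
  also have "\<dots> = contr Y (contr X a) T"
    unfolding contr_def contr1_linear(4) ..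
  finally show "contr X (contr Y a) T = - contr Y (contr X a) T" .
qed

lemma contr_insert:
  "finite Y \<Longrightarrow> i \<notin> Y \<Longrightarrow> contr (insert i Y) a = (\<lambda>T. contr1 i a T + contr Y a T)"
  by (simp add: contr_def)

lemma contr_Un: "finite X \<Longrightarrow> finite Y \<Longrightarrow> X \<inter> Y = {} \<Longrightarrow> contr (X \<union> Y) a = (\<lambda>T. contr X a T + contr Y a T)"
  by (simp add: contr_def sum.union_disjoint)

text \<open>Each \<open>contr1 i\<close> squares to zero, and the mixed terms cancel. In characteristic two, anticommutation
  alone would not give this.\<close>

lemma contr_contr: "contr Y (contr Y a) = (\<lambda>T. 0)"
proof (induction Y rule: infinite_finite_induct)
  case (insert i Y)
  have "contr (insert i Y) (contr (insert i Y) a) =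
    (\<lambda>T. contr1 i (contr1 i a) T + contr Y (contr1 i a) T + (contr1 i (contr Y a) T + contr Y (contr Y a) T))"
    using insert.hyps by (simp add: contr_insert contr_linear contr1_linear)
  then show ?case by (simp add: contr1_contr1 contr1_contr insert.IH)
qed (simp_all add: contr_def)

lemma contr1_closed:
  assumes "a \<in> carrier (ext_alg n)"
  shows "contr1 i a \<in> carrier (ext_alg n)"
  using assms unfolding carrier_ext_alg contr1_def by auto

lemma contr_closed: "a \<in> carrier (ext_alg n) \<Longrightarrow> contr Y a \<in> carrier (ext_alg n)"
  unfolding contr_def by (rule sum_closed, rule contr1_closed)

lemma contr_nonzero:
  assumes "contr Y a T \<noteq> 0"
  obtains i where "i \<in> Y" "i \<notin> T" "a (insert i T) \<noteq> 0"
proof -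
  from assms have "(\<Sum>i\<in>Y. contr1 i a T) \<noteq> 0" by (simp add: contr_def)
  then obtain i where i: "i \<in> Y" "contr1 i a T \<noteq> 0"
    by (meson sum.not_neutral_contains_not_neutral)
  then show thesis using that[of i] by (auto simp: contr1_def split: if_splits)
qed

lemma contr1_mono_elt:
  "contr1 i (mono_elt C) = (\<lambda>T. if i \<in> C then wedge_sign {i} (C - {i}) * mono_elt (C - {i}) T else 0)"
  by (rule ext) (auto simp: contr1_def mono_elt_def)

lemma contr_mono_elt:
  assumes "finite Y"
  shows "contr Y (mono_elt C) = (\<lambda>T. \<Sum>i\<in>Y \<inter> C. wedge_sign {i} (C - {i}) * mono_elt (C - {i}) T)"
  using assms by (simp add: contr_def contr1_mono_elt sum.inter_restrict)

text \<open>The boundary of a monomial is its contraction with the functional 1 on all its indices. The sign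
  arises because \<open>bd_mono\<close> counts positions from 1.\<close>

lemma bd_mono_eq_contr:
  assumes "finite Y" "C \<subseteq> Y"
  shows "bd_mono C = (\<lambda>T. - contr Y (mono_elt C) T)"
proof -
  have "(-1) ^ card {j \<in> C. j \<le> i} = - (wedge_sign {i} (C - {i}) :: 'a)" if "i \<in> C" for i
  proof -
    have "{j \<in> C. j \<le> i} = insert i {j \<in> C - {i}. j < i}" using that by auto
    then have "card {j \<in> C. j \<le> i} = Suc (card {j \<in> C - {i}. j < i})" by simp
    then show ?thesis by (simp add: wedge_sign_singleton_left)
  qed
  moreover have "Y \<inter> C = C" using assms by auto
  ultimately show ?thesis
    unfolding bd_mono_def contr_mono_elt[OF assms(1)] by (simp add: sum_negf[symmetric])
qed

lemma bd_mono_nonzero: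
  assumes "bd_mono C S \<noteq> (0 :: 'k::field)"
  obtains i where "i \<in> C" "S = C - {i}"
proof -
  have "\<exists>i\<in>C. S = C - {i}"
  proof (rule ccontr)
    assume "\<not> ?thesis"
    then have "bd_mono C S = (0 :: 'k)" unfolding bd_mono_def mono_elt_def by (intro sum.neutral) simp
    with assms show False by simp
  qed
  then show thesis using that by blast
qed

subsection \<open>Elements of degree one\<close>

lemma ext_grade_1_iff:
  "x \<in> ext_grade n 1 \<longleftrightarrow> (\<forall>S. x S \<noteq> 0 \<longrightarrow> (\<exists>i<n. S = {i}))"
  unfolding ext_grade_def carrier_ext_alg by (auto simp: card_1_singleton_iff) blast+

lemma ext_grade_1_cases:
  assumes "x \<in> ext_grade n 1" obtains i where "i < n" "S = {i}" | "x S = 0"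
  using assms unfolding ext_grade_1_iff by blast

lemma ext_grade_closed: "x \<in> ext_grade n d \<Longrightarrow> x \<in> carrier (ext_alg n)"
  by (simp add: ext_grade_def)

lemma mono_elt_grade_1: "i < n \<Longrightarrow> mono_elt {i} \<in> ext_grade n 1"
  unfolding ext_grade_1_iff mono_elt_def by auto

lemma wedge_grade_1_commute:
  assumes "x \<in> ext_grade n 1"
  shows "wedge x y = wedge (invol y) x"
proof
  fix U
  show "wedge x y U = wedge (invol y) x U"
  proof (cases "finite U")
    case True
    have "wedge (invol y) x U = (\<Sum>S\<in>Pow U. wedge_sign (U - S) S * invol y (U - S) * x S)"
      unfolding wedge_def
      by (rule sum.reindex_bij_witness[where i = "\<lambda>S. U - S" and j = "\<lambda>S. U - S"]) (auto simp: double_diff)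
    also have "\<dots> = wedge x y U" unfolding wedge_def
    proof (rule sum.cong[OF refl])
      fix S assume "S \<in> Pow U"
      show "wedge_sign (U - S) S * invol y (U - S) * x S = wedge_sign S (U - S) * x S * y (U - S)"
      proof (cases "x S = 0")
        case False
        then obtain i where S: "S = {i}" using ext_grade_1_cases[OF assms, of S] by blast
        have "wedge_sign (U - {i}) {i} = ((-1) ^ card (U - {i}) * wedge_sign {i} (U - {i}) :: 'a)"
          by (rule wedge_sign_swap) (use True in auto)
        then show ?thesis unfolding S by (simp add: invol_def power_mult_distrib[symmetric])
      qed simp
    qed
    finally show ?thesis by simp
  qed (simp add: wedge_infinite)
qed

lemma invol_grade_1: "x \<in> ext_grade n 1 \<Longrightarrow> invol x = (\<lambda>S. - x S)"
proof
  fix S :: "nat set" assume x: "x \<in> ext_grade n 1"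
  show "invol x S = - x S" by (rule ext_grade_1_cases[OF x, of S]) (auto simp: invol_def)
qed

lemma contr_grade_1:
  assumes "x \<in> ext_grade n 1"
  shows "contr Y x = (\<lambda>T. (\<Sum>i\<in>Y. x {i}) * mono_elt {} T)"
proof
  fix T
  have "contr1 i x T = x {i} * mono_elt {} T" for i
  proof (cases "T = {}")
    case False
    then have "i \<in> T \<or> (\<nexists>j. insert i T = {j})" by auto
    then have "i \<in> T \<or> x (insert i T) = 0" using ext_grade_1_cases[OF assms, of "insert i T"] by blast
    then show ?thesis using False by (auto simp: contr1_def mono_elt_def)
  qed (simp add: contr1_def mono_elt_def)
  then show "contr Y x T = (\<Sum>i\<in>Y. x {i}) * mono_elt {} T"
    by (simp add: contr_def sum_distrib_right)
qed

lemma wedge_grade_1_self: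
  assumes "x \<in> ext_grade n 1"
  shows "wedge x x = (\<lambda>U. 0)"
proof
  fix U
  show "wedge x x U = 0"
  proof (rule ccontr)
    assume nz: "wedge x x U \<noteq> 0"
    then obtain S where S: "S \<subseteq> U" "x S \<noteq> 0" "x (U - S) \<noteq> 0" by (rule wedge_nonzero)
    obtain i where i: "S = {i}" using S(2) ext_grade_1_cases[OF assms, of S] by blast
    obtain j where j: "U - S = {j}" using S(3) ext_grade_1_cases[OF assms, of "U - S"] by blast
    have U: "U = {i, j}" and ij: "i \<noteq> j" using i j S(1) by auto
    have "x {} = 0" using ext_grade_1_cases[OF assms, of "{}"] by blast
    moreover have "Pow U = {{}, {i}, {j}, {i, j}}" unfolding U by auto
    moreover have "{i, j} - {i} = {j}" "{i, j} - {j} = {i}" using ij by auto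
    ultimately have "wedge x x U = wedge_sign {i} {j} * x {i} * x {j} + wedge_sign {j} {i} * x {j} * x {i}"
      unfolding wedge_def U using ij by (simp add: doubleton_eq_iff)
    also have "\<dots> = 0" using wedge_sign_two[OF ij, where 'k='a] by simp
    finally show False using nz by simp
  qed
qed

lemma parity_part_wedge_grade_1:
  assumes "x \<in> ext_grade n 1"
  shows "parity_part p (wedge x y) = wedge x (parity_part (\<not> p) y)"
proof -
  have "parity_part True x = (\<lambda>S. 0)" "parity_part False x = x"
  proof (rule_tac [!] ext)
    fix S :: "nat set"
    show "parity_part True x S = 0"
      by (rule ext_grade_1_cases[OF assms, of S]) (auto simp: parity_part_def)
    show "parity_part False x S = x S"
      by (rule ext_grade_1_cases[OF assms, of S]) (auto simp: parity_part_def)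
  qed
  then show ?thesis by (simp add: parity_part_wedge wedge_zero_left)
qed

section \<open>Spaces of functions on monomials\<close>

text \<open>Subspaces of the space of coefficient functions, without reference to the record that carries
  the vector space structure.\<close>

definition linear_subset :: "(nat set \<Rightarrow> 'k::field) set \<Rightarrow> bool" where
  "linear_subset W \<longleftrightarrow> (\<lambda>S. 0) \<in> W \<and> (\<forall>u\<in>W. \<forall>v\<in>W. (\<lambda>S. u S + v S) \<in> W) \<and>
     (\<forall>c. \<forall>u\<in>W. (\<lambda>S. c * u S) \<in> W)"

lemma ext_subspace_simps:
  "carrier (ext_subspace n W) = W"
  "u \<oplus>\<^bsub>ext_subspace n W\<^esub> v = (\<lambda>S. u S + v S)"
  "\<zero>\<^bsub>ext_subspace n W\<^esub> = (\<lambda>S. 0)"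
  "c \<odot>\<^bsub>ext_subspace n W\<^esub> u = (\<lambda>S. c * u S)"
  by (simp_all add: ext_subspace_def ext_alg_def)

lemma vectorspace_ext_subspace:
  assumes "linear_subset W"
  shows "vectorspace class_ring (ext_subspace n W)"
proof (rule vs_criteria)
  show "\<forall>v\<in>carrier (ext_subspace n W). \<exists>neg_v\<in>carrier (ext_subspace n W).
     v \<oplus>\<^bsub>ext_subspace n W\<^esub> neg_v = \<zero>\<^bsub>ext_subspace n W\<^esub>"
  proof
    fix v assume "v \<in> carrier (ext_subspace n W)"
    then have "(\<lambda>S. -1 * v S) \<in> W" using assms unfolding linear_subset_def ext_subspace_simps by blast
    then show "\<exists>neg_v\<in>carrier (ext_subspace n W). v \<oplus>\<^bsub>ext_subspace n W\<^esub> neg_v = \<zero>\<^bsub>ext_subspace n W\<^esub>"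
      by (intro bexI[of _ "\<lambda>S. -1 * v S"]) (auto simp: ext_subspace_simps)
  qed
qed (use assms class_field in \<open>auto simp: linear_subset_def ext_subspace_simps algebra_simps\<close>)

lemma subspace_ext_subspace:
  assumes "linear_subset W" "linear_subset W'" "W \<subseteq> W'"
  shows "VectorSpace.subspace class_ring W (ext_subspace n W')"
proof -
  interpret V: vectorspace class_ring "ext_subspace n W'" by (rule vectorspace_ext_subspace[OF assms(2)])
  show ?thesis
  proof (intro VectorSpace.subspace.intro submodule.intro)
    show "vectorspace class_ring (ext_subspace n W')" by (rule vectorspace_ext_subspace[OF assms(2)])
    show "Module.module class_ring (ext_subspace n W')" by (rule V.module_axioms)
  qed (use assms in \<open>auto simp: linear_subset_def ext_subspace_simps\<close>)
qed

lemma linear_map_ext_subspace: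
  assumes "linear_subset V" "linear_subset W"
    and "\<And>u. u \<in> V \<Longrightarrow> f u \<in> W"
    and "\<And>u v. u \<in> V \<Longrightarrow> v \<in> V \<Longrightarrow> f (\<lambda>S. u S + v S) = (\<lambda>S. f u S + f v S)"
    and "\<And>c u. u \<in> V \<Longrightarrow> f (\<lambda>S. c * u S) = (\<lambda>S. c * f u S)"
  shows "linear_map class_ring (ext_subspace n V) (ext_subspace n W) f"
proof -
  interpret V: vectorspace class_ring "ext_subspace n V" by (rule vectorspace_ext_subspace[OF assms(1)])
  interpret W: vectorspace class_ring "ext_subspace n W" by (rule vectorspace_ext_subspace[OF assms(2)])
  have "f \<in> LinearCombinations.module_hom class_ring (ext_subspace n V) (ext_subspace n W)"
    unfolding LinearCombinations.module_hom_def ext_subspace_simps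
  proof (intro CollectI conjI allI impI)
    show "f \<in> V \<rightarrow> W" using assms(3) by blast
    show "f (\<lambda>S. m1 S + m2 S) = (\<lambda>S. f m1 S + f m2 S)" if "m1 \<in> V \<and> m2 \<in> V" for m1 m2
      using that by (intro assms(4)) blast+
    show "f (\<lambda>S. c * m S) = (\<lambda>S. c * f m S)" if "c \<in> carrier class_ring \<and> m \<in> V" for c m
      using that by (intro assms(5)) blast
  qed
  then show ?thesis by unfold_locales
qed

lemma finsum_ext_subspace:
  assumes W: "linear_subset W" and "finite A" "f \<in> A \<rightarrow> W"
  shows "finsum (ext_subspace n W) f A = (\<lambda>S. \<Sum>a\<in>A. f a S)"
proof -
  interpret V: vectorspace class_ring "ext_subspace n W" by (rule vectorspace_ext_subspace[OF W])
  show ?thesis using assms(2,3)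
  proof (induction A rule: finite_induct)
    case empty
    show ?case by (simp add: ext_subspace_simps)
  next
    case (insert a A)
    have "finsum (ext_subspace n W) f (insert a A) = f a \<oplus>\<^bsub>ext_subspace n W\<^esub> finsum (ext_subspace n W) f A"
      using insert by (intro V.finsum_insert) (auto simp: ext_subspace_simps)
    then show ?case using insert by (simp add: ext_subspace_simps)
  qed
qed

definition supported_on :: "nat set set \<Rightarrow> (nat set \<Rightarrow> 'k::field) set" where
  "supported_on N = {u. \<forall>S. u S \<noteq> 0 \<longrightarrow> S \<in> N}"

lemma linear_subset_supported_on: "linear_subset (supported_on N)"
  unfolding linear_subset_def supported_on_def by auto (metis add.right_neutral)

text \<open>The monomials indexed by \<open>N\<close> form a basis.\<close>

lemma dim_supported_on:
  assumes "finite N"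
  shows "vectorspace.fin_dim class_ring (ext_subspace n (supported_on N :: (nat set \<Rightarrow> 'k::field) set))"
    and "vectorspace.dim class_ring (ext_subspace n (supported_on N :: (nat set \<Rightarrow> 'k) set)) = card N"
proof -
  let ?W = "supported_on N :: (nat set \<Rightarrow> 'k) set"
  interpret V: vectorspace class_ring "ext_subspace n ?W"
    by (rule vectorspace_ext_subspace[OF linear_subset_supported_on])
  let ?B = "mono_elt ` N :: (nat set \<Rightarrow> 'k) set"
  have inj: "inj_on (mono_elt :: nat set \<Rightarrow> nat set \<Rightarrow> 'k) N"
    by (rule inj_onI) (metis mono_elt_def zero_neq_one)
  have B: "finite ?B" "?B \<subseteq> carrier (ext_subspace n ?W)"
    using assms by (auto simp: supported_on_def ext_subspace_simps mono_elt_def split: if_splits)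
  have lin: "V.lincomb a ?B = (\<lambda>S. if S \<in> N then a (mono_elt S) else 0)" for a
  proof
    fix S
    have "V.lincomb a ?B = (\<lambda>S. \<Sum>b\<in>?B. a b * b S)"
    proof -
      have "(\<lambda>b S. a b * b S) \<in> ?B \<rightarrow> ?W" by (auto simp: supported_on_def mono_elt_def split: if_splits)
      from finsum_ext_subspace[OF linear_subset_supported_on B(1) this, of n]
      show ?thesis unfolding V.lincomb_def by (simp add: ext_subspace_simps)
    qed
    then have "V.lincomb a ?B S = (\<Sum>T\<in>N. a (mono_elt T) * mono_elt T S)" by (simp add: sum.reindex[OF inj])
    also have "\<dots> = (\<Sum>T\<in>N. if S = T then a (mono_elt T) else 0)" by (rule sum.cong) (auto simp: mono_elt_def)
    also have "\<dots> = (if S \<in> N then a (mono_elt S) else 0)" using assms by (subst sum.delta') auto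
    finally show "V.lincomb a ?B S = (if S \<in> N then a (mono_elt S) else 0)" .
  qed
  have "V.lin_indpt ?B"
  proof (rule V.finite_lin_indpt2[OF B])
    fix a :: "(nat set \<Rightarrow> 'k) \<Rightarrow> 'k"
    assume "V.lincomb a ?B = \<zero>\<^bsub>ext_subspace n ?W\<^esub>"
    then have "(if S \<in> N then a (mono_elt S) else 0) = 0" for S
      unfolding lin by (simp add: ext_subspace_simps) meson
    then have "a (mono_elt S) = 0" if "S \<in> N" for S using that by metis
    then show "\<forall>v\<in>?B. a v = \<zero>\<^bsub>class_ring\<^esub>" by auto
  qed
  moreover have "V.span ?B = carrier (ext_subspace n ?W)"
  proof
    show "V.span ?B \<subseteq> carrier (ext_subspace n ?W)" by (rule V.span_is_subset2[OF B(2)])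
    show "carrier (ext_subspace n ?W) \<subseteq> V.span ?B"
    proof
      fix u :: "nat set \<Rightarrow> 'k" assume "u \<in> carrier (ext_subspace n ?W)"
      then have "u = (\<lambda>S. if S \<in> N then u (the_inv_into N mono_elt (mono_elt S :: nat set \<Rightarrow> 'k)) else 0)"
        by (intro ext) (auto simp: ext_subspace_simps supported_on_def the_inv_into_f_f[OF inj])
      then have "u = V.lincomb (\<lambda>b. u (the_inv_into N mono_elt b)) ?B" unfolding lin .
      then show "u \<in> V.span ?B" unfolding V.finite_span[OF B] by auto
    qed
  qed
  ultimately have "V.basis ?B" using B unfolding V.basis_def by simp
  then show "V.dim = card N" using V.dim_basis[OF B(1)] card_image[OF inj] by simp
  show "V.fin_dim" unfolding V.fin_dim_def using B \<open>V.span ?B = _\<close> by blast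
qed

lemma rank_nullity_ext_subspace:
  assumes "linear_map class_ring (ext_subspace n (supported_on N)) (ext_subspace n W) f" "finite N"
  shows "vectorspace.dim class_ring (ext_subspace n (f ` supported_on N)) +
    vectorspace.dim class_ring (ext_subspace n {u \<in> supported_on N. f u = (\<lambda>S. 0)}) = card N"
proof -
  interpret linear_map class_ring "ext_subspace n (supported_on N)" "ext_subspace n W" f by (rule assms(1))
  have 1: "imT = f ` supported_on N" unfolding im_def by (simp add: ext_subspace_simps)
  have 2: "kerT = {u \<in> supported_on N. f u = (\<lambda>S. 0)}" unfolding ker_def by (simp add: ext_subspace_simps)
  have 3: "ext_subspace n W\<lparr>carrier := X\<rparr> = ext_subspace n X"
    "ext_subspace n (supported_on N)\<lparr>carrier := X\<rparr> = ext_subspace n X" for X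
    by (simp_all add: ext_subspace_def)
  show ?thesis using rank_nullity[OF dim_supported_on(1)[OF assms(2)]]
    unfolding 1 2 3 dim_supported_on(2)[OF assms(2)] .
qed

text \<open>Rank and nullity of the two maps exchange their roles, so both dimensions are the sum of the two
  ranks.\<close>

lemma card_eq_of_exact:
  fixes f g :: "(nat set \<Rightarrow> 'k::field) \<Rightarrow> nat set \<Rightarrow> 'k"
  assumes "finite M" "finite N"
    and f: "linear_map class_ring (ext_subspace n (supported_on M)) (ext_subspace n (supported_on N)) f"
    and g: "linear_map class_ring (ext_subspace n (supported_on N)) (ext_subspace n (supported_on M)) g"
    and "g ` supported_on N = {u \<in> supported_on M. f u = (\<lambda>S. 0)}"
    and "f ` supported_on M = {u \<in> supported_on N. g u = (\<lambda>S. 0)}"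
  shows "card M = card N"
  using rank_nullity_ext_subspace[OF f assms(1)] rank_nullity_ext_subspace[OF g assms(2)] assms(5,6)
  by simp

section \<open>Exactness and the Euler characteristic\<close>

text \<open>Exactness of multiplication by \<open>x\<close> on the quotient by \<open>J\<close>, stated for representatives. This also makes
  sense when \<open>J\<close> is merely a subspace.\<close>

definition exact_mod :: "nat \<Rightarrow> (nat set \<Rightarrow> 'k::field) set \<Rightarrow> (nat set \<Rightarrow> 'k) \<Rightarrow> bool" where
  "exact_mod n J x \<longleftrightarrow> (\<forall>a\<in>carrier (ext_alg n). wedge x a \<in> J \<longrightarrow>
     (\<exists>b\<in>carrier (ext_alg n). (\<lambda>S. a S - wedge x b S) \<in> J))"

text \<open>Every element has a unique representative modulo \<open>J\<close> supported on \<open>N\<close>, its normal form. Multiplication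
  by \<open>x\<close> followed by taking normal forms maps the even part of the span of \<open>N\<close> to the odd part and
  conversely; exactness makes the kernel of each of these maps the image of the other.\<close>

lemma exact_mod_imp_alt_count_zero:
  fixes J :: "(nat set \<Rightarrow> 'k::field) set"
  assumes x: "x \<in> ext_grade n 1"
    and J: "linear_subset J" "\<And>p a. a \<in> J \<Longrightarrow> parity_part p a \<in> J" "\<And>a. a \<in> J \<Longrightarrow> wedge x a \<in> J"
    and N: "N \<subseteq> Pow {..<n}"
    and span: "\<And>a. a \<in> carrier (ext_alg n) \<Longrightarrow> \<exists>u\<in>supported_on N. (\<lambda>S. a S - u S) \<in> J"
    and indep: "\<And>u. u \<in> supported_on N \<Longrightarrow> u \<in> J \<Longrightarrow> u = (\<lambda>S. 0)"
    and exact: "exact_mod n J x"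
  shows "alt_count N = 0"
proof -
  have J_zero: "(\<lambda>S. 0) \<in> J" and J_add: "\<And>a b. a \<in> J \<Longrightarrow> b \<in> J \<Longrightarrow> (\<lambda>S. a S + b S) \<in> J"
    and J_smult: "\<And>a c. a \<in> J \<Longrightarrow> (\<lambda>S. c * a S) \<in> J"
    using J(1) unfolding linear_subset_def by blast+
  have J_uminus: "(\<lambda>S. - a S) \<in> J" if "a \<in> J" for a using J_smult[OF that, of "-1"] by simp
  have J_diff: "(\<lambda>S. a S - b S) \<in> J" if "a \<in> J" "b \<in> J" for a b
    using J_add[OF that(1) J_uminus[OF that(2)]] by simp
  have xE: "x \<in> carrier (ext_alg n)" using x by (rule ext_grade_closed)
  have supE: "u \<in> carrier (ext_alg n)" if "u \<in> supported_on N" for u :: "nat set \<Rightarrow> 'k"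
    using that N unfolding supported_on_def carrier_ext_alg by blast
  have sup_add: "(\<lambda>S. u S + v S) \<in> supported_on N" if "u \<in> supported_on N" "v \<in> supported_on N"
    for u v :: "nat set \<Rightarrow> 'k"
    using linear_subset_supported_on[of N] that unfolding linear_subset_def by blast
  have sup_smult: "(\<lambda>S. c * u S) \<in> supported_on N" if "u \<in> supported_on N" for u :: "nat set \<Rightarrow> 'k" and c
    using linear_subset_supported_on[of N] that unfolding linear_subset_def by blast
  have uniq: "u = v" if "u \<in> supported_on N" "v \<in> supported_on N" "(\<lambda>S. a S - u S) \<in> J" "(\<lambda>S. a S - v S) \<in> J"
    for u v a :: "nat set \<Rightarrow> 'k"
  proof -
    have "(\<lambda>S. v S - u S) \<in> J" using J_diff[OF that(3,4)] by simp
    moreover have "(\<lambda>S. v S - u S) \<in> supported_on N" using sup_add[OF that(2) sup_smult[OF that(1), of "-1"]] by simp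
    ultimately have "(\<lambda>S. v S - u S) = (\<lambda>S. 0)" by (intro indep)
    then show ?thesis by (metis eq_iff_diff_eq_0 ext)
  qed
  define nf where "nf a = (THE u. u \<in> supported_on N \<and> (\<lambda>S. a S - u S) \<in> J)" for a
  have nf: "nf a \<in> supported_on N" "(\<lambda>S. a S - nf a S) \<in> J" if "a \<in> carrier (ext_alg n)" for a
  proof -
    have "\<exists>!u. u \<in> supported_on N \<and> (\<lambda>S. a S - u S) \<in> J" using span[OF that] uniq by blast
    from theI'[OF this] show "nf a \<in> supported_on N" "(\<lambda>S. a S - nf a S) \<in> J" unfolding nf_def by blast+
  qed
  have nf_eq: "nf a = u" if "a \<in> carrier (ext_alg n)" "u \<in> supported_on N" "(\<lambda>S. a S - u S) \<in> J" for a u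
    using uniq nf that by blast
  define d where "d u = nf (wedge x u)" for u
  have xu: "wedge x u \<in> carrier (ext_alg n)" if "u \<in> supported_on N" for u
    by (intro wedge_closed xE supE that)
  let ?N = "\<lambda>p. {S \<in> N. even (card S) = p}"
  let ?U = "\<lambda>p. supported_on (?N p) :: (nat set \<Rightarrow> 'k) set"
  have U: "u \<in> ?U p \<longleftrightarrow> u \<in> supported_on N \<and> parity_part p u = u" for p and u :: "nat set \<Rightarrow> 'k"
    unfolding supported_on_def parity_part_def fun_eq_iff by auto
  have parity_sup: "parity_part p u \<in> ?U p" if "u \<in> supported_on N" for p and u :: "nat set \<Rightarrow> 'k"
    using that unfolding supported_on_def parity_part_def by auto
  have parity_x: "parity_part (\<not> p) (wedge x u) = wedge x u" if "u \<in> ?U p" for p u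
    using that U parity_part_wedge_grade_1[OF x, of "\<not> p" u] by simp
  have d_closed: "d u \<in> ?U (\<not> p)" if u: "u \<in> ?U p" for p u
  proof -
    have uN: "u \<in> supported_on N" using u U by blast
    note v = nf[OF xu[OF uN]]
    have "parity_part (\<not> p) (\<lambda>S. wedge x u S - d u S) \<in> J" unfolding d_def by (rule J(2)[OF v(2)])
    moreover have "parity_part (\<not> p) (\<lambda>S. wedge x u S - d u S) =
       (\<lambda>S. parity_part (\<not> p) (wedge x u) S - parity_part (\<not> p) (d u) S)" by (auto simp: parity_part_def)
    ultimately have "(\<lambda>S. wedge x u S - parity_part (\<not> p) (d u) S) \<in> J" using parity_x[OF u] by simp
    then have "d u = parity_part (\<not> p) (d u)"
      unfolding d_def using parity_sup[OF v(1)] U by (intro nf_eq[OF xu[OF uN]]) blast+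
    then show ?thesis using parity_sup[OF v(1), of "\<not> p"] unfolding d_def by simp
  qed
  have lin: "linear_map class_ring (ext_subspace n (?U p)) (ext_subspace n (?U q)) d" if "q = (\<not> p)" for p q
  proof (rule linear_map_ext_subspace[OF linear_subset_supported_on linear_subset_supported_on])
    show "d u \<in> ?U q" if "u \<in> ?U p" for u using d_closed[OF that] \<open>q = (\<not> p)\<close> by simp
    show "d (\<lambda>S. u S + v S) = (\<lambda>S. d u S + d v S)" if "u \<in> ?U p" "v \<in> ?U p" for u v
    proof -
      have uv: "u \<in> supported_on N" "v \<in> supported_on N" using that U by blast+
      note nu = nf[OF xu[OF uv(1)]] and nv = nf[OF xu[OF uv(2)]]
      have "(\<lambda>S. wedge x (\<lambda>S. u S + v S) S - (d u S + d v S)) \<in> J"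
        using J_add[OF nu(2) nv(2)] by (simp add: d_def wedge_add_right algebra_simps)
      then show ?thesis
        unfolding d_def by (intro nf_eq xu sup_add uv nu nv)
    qed
    show "d (\<lambda>S. c * u S) = (\<lambda>S. c * d u S)" if "u \<in> ?U p" for c u
    proof -
      have u: "u \<in> supported_on N" using that U by blast
      note nu = nf[OF xu[OF u]]
      have "(\<lambda>S. wedge x (\<lambda>S. c * u S) S - c * d u S) \<in> J"
        using J_smult[OF nu(2), of c] by (simp add: d_def wedge_smult_right algebra_simps)
      then show ?thesis
        unfolding d_def by (intro nf_eq xu sup_smult u nu)
    qed
  qed
  have ex: "d ` ?U q = {u \<in> ?U p. d u = (\<lambda>S. 0)}" if q: "q = (\<not> p)" for p q
  proof (intro equalityI subsetI)
    fix u assume "u \<in> d ` ?U q"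
    then obtain w where w: "w \<in> ?U q" "u = d w" by blast
    then have wN: "w \<in> supported_on N" using U by blast
    have u: "u \<in> ?U p" using d_closed[OF w(1)] w(2) q by simp
    then have uN: "u \<in> supported_on N" using U by blast
    have "wedge x (\<lambda>S. wedge x w S - u S) \<in> J" unfolding w(2) d_def by (rule J(3)[OF nf(2)[OF xu[OF wN]]])
    moreover have "wedge x (\<lambda>S. wedge x w S - u S) = (\<lambda>S. - wedge x u S)"
      unfolding wedge_diff_right wedge_assoc[symmetric] wedge_grade_1_self[OF x] wedge_zero_left by simp
    ultimately have "(\<lambda>S. wedge x u S - 0) \<in> J" using J_uminus by fastforce
    then have "d u = (\<lambda>S. 0)"
      unfolding d_def by (intro nf_eq[OF xu[OF uN]]) (auto simp: supported_on_def)
    with u show "u \<in> {u \<in> ?U p. d u = (\<lambda>S. 0)}" by blast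
  next
    fix u assume "u \<in> {u \<in> ?U p. d u = (\<lambda>S. 0)}"
    then have u: "u \<in> ?U p" "d u = (\<lambda>S. 0)" by blast+
    then have uN: "u \<in> supported_on N" "parity_part p u = u" using U by blast+
    have "wedge x u \<in> J" using nf(2)[OF xu[OF uN(1)]] u(2) by (simp add: d_def)
    then obtain b where b: "b \<in> carrier (ext_alg n)" "(\<lambda>S. u S - wedge x b S) \<in> J"
      using exact supE[OF uN(1)] unfolding exact_mod_def by blast
    note nb = nf[OF b(1)]
    let ?w = "parity_part q (nf b)"
    have w: "?w \<in> ?U q" by (rule parity_sup[OF nb(1)])
    have "(\<lambda>S. wedge x b S - wedge x (nf b) S) \<in> J" using J(3)[OF nb(2)] by (simp add: wedge_diff_right)
    from J_add[OF b(2) this] have "(\<lambda>S. u S - wedge x (nf b) S) \<in> J" by simp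
    from J(2)[OF this, of p] have "(\<lambda>S. parity_part p u S - parity_part p (wedge x (nf b)) S) \<in> J"
      by (simp add: parity_part_def if_distrib cong: if_cong)
    then have "(\<lambda>S. u S - wedge x ?w S) \<in> J" unfolding uN(2) parity_part_wedge_grade_1[OF x] q .
    from J_uminus[OF this] have "(\<lambda>S. wedge x ?w S - u S) \<in> J" by simp
    then have "d ?w = u" unfolding d_def using w U uN(1) by (intro nf_eq xu) blast+
    then show "u \<in> d ` ?U q" using w by blast
  qed
  have fin: "finite N" using finite_subset[OF N] by simp
  have "card (?N True) = card (?N False)"
    by (rule card_eq_of_exact[OF _ _ lin lin ex ex]) (use fin in auto)
  moreover have "alt_count N = int (card (?N True)) - int (card (?N False))"
  proof -
    have "N = ?N True \<union> ?N False" by auto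
    then have "alt_count N = (\<Sum>S\<in>?N True \<union> ?N False. (-1) ^ card S)" unfolding alt_count_def by simp
    also have "\<dots> = (\<Sum>S\<in>?N True. (-1) ^ card S) + (\<Sum>S\<in>?N False. (-1) ^ card S)"
      using fin by (intro sum.union_disjoint) auto
    finally show ?thesis by simp
  qed
  ultimately show ?thesis by simp
qed

text \<open>A set that is subject to independent conditions on disjoint blocks is a choice of one set in each block,
  and its sign is the product of the signs of these.\<close>

lemma alt_count_product:
  fixes m :: nat
  assumes "\<And>j. j < m \<Longrightarrow> finite (B j)" "\<And>i j. i < m \<Longrightarrow> j < m \<Longrightarrow> i \<noteq> j \<Longrightarrow> B i \<inter> B j = {}"
  shows "alt_count {S. S \<subseteq> (\<Union>j<m. B j) \<and> (\<forall>j<m. P j (S \<inter> B j))} = (\<Prod>j<m. alt_count {S. S \<subseteq> B j \<and> P j S})"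
  using assms
proof (induction m)
  case 0
  have "{S :: 'a set. S \<subseteq> (\<Union>j<0. B j) \<and> (\<forall>j<0. P j (S \<inter> B j))} = {{}}" by auto
  then show ?case by (simp add: alt_count_def)
next
  case (Suc m)
  let ?N = "\<lambda>m. {S. S \<subseteq> (\<Union>j<m. B j) \<and> (\<forall>j<m. P j (S \<inter> B j))}" and ?M = "{S. S \<subseteq> B m \<and> P m S}"
  let ?U = "\<Union>j<m. B j"
  have disj': "B m \<inter> B j = {}" if "j < m" for j using Suc.prems(2)[of m j] that by auto
  then have disj: "?U \<inter> B m = {}" by blast
  have fin: "finite ?U" "finite (B m)" using Suc.prems(1) by auto
  have "alt_count (?N m) * alt_count ?M = (\<Sum>(S, T)\<in>?N m \<times> ?M. (-1) ^ card S * (-1) ^ card T)"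
    unfolding alt_count_def sum_product sum.cartesian_product ..
  also have "\<dots> = (\<Sum>S\<in>?N (Suc m). (-1) ^ card S)"
  proof (rule sum.reindex_bij_witness[where i = "\<lambda>S. (S \<inter> ?U, S \<inter> B m)" and j = "\<lambda>(S, T). S \<union> T"])
    fix p assume "p \<in> ?N m \<times> ?M"
    then obtain S T where p: "p = (S, T)" "S \<subseteq> ?U" "\<forall>j<m. P j (S \<inter> B j)" "T \<subseteq> B m" "P m T" by auto
    have *: "(S \<union> T) \<inter> ?U = S" "(S \<union> T) \<inter> B m = T" "S \<inter> T = {}" using p disj by auto
    show "(case case p of (S, T) \<Rightarrow> S \<union> T of S \<Rightarrow> (S \<inter> ?U, S \<inter> B m)) = p" using * p by simp
    have "(S \<union> T) \<inter> B j = S \<inter> B j" if "j < m" for j using p(4) disj'[OF that] by auto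
    then show "(case p of (S, T) \<Rightarrow> S \<union> T) \<in> ?N (Suc m)"
      using p * by (auto simp: less_Suc_eq lessThan_Suc)
    have "card (S \<union> T) = card S + card T"
      using *(3) finite_subset[OF p(2) fin(1)] finite_subset[OF p(4) fin(2)] by (rule_tac card_Un_disjoint)
    then show "(-1) ^ card (case p of (S, T) \<Rightarrow> S \<union> T) = (case p of (S, T) \<Rightarrow> ((-1) ^ card S * (-1) ^ card T :: int))"
      by (simp add: p(1) power_add)
  next
    fix S assume S: "S \<in> ?N (Suc m)"
    then show "(case (S \<inter> ?U, S \<inter> B m) of (S, T) \<Rightarrow> S \<union> T) = S" by (auto simp: lessThan_Suc)
    have "S \<inter> ?U \<inter> B j = S \<inter> B j" if "j < m" for j using that by auto
    then show "(S \<inter> ?U, S \<inter> B m) \<in> ?N m \<times> ?M" using S by auto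
  qed
  finally show ?case using Suc by (simp add: alt_count_def)
qed


section \<open>The ideal of a combinatorial hyperplane arrangement\<close>

text \<open>The data of an arrangement on which the Orlik--Solomon ideal depends. For a set \<open>S\<close> of
  hyperplanes, \<open>Cp S\<close> says that the intersection of \<open>S\<close> is nonempty, \<open>Cl S\<close> is the set of
  hyperplanes that contain this intersection, and \<open>Dep S\<close> says that \<open>S\<close> is dependent.\<close>

locale hyperplane_closure =
  fixes n :: nat and Cp :: "nat set \<Rightarrow> bool" and Cl :: "nat set \<Rightarrow> nat set" and Dep :: "nat set \<Rightarrow> bool"
  assumes Cp_subset: "Cp T \<Longrightarrow> S \<subseteq> T \<Longrightarrow> Cp S"
    and Cl_ground: "Cl S \<subseteq> {..<n}"
    and Cl_empty: "Cl {} = {}"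
    and Cl_extensive: "S \<subseteq> {..<n} \<Longrightarrow> S \<subseteq> Cl S"
    and Cl_trans: "T \<subseteq> Cl S \<Longrightarrow> Cl T \<subseteq> Cl S"
    and Cp_Cl: "S \<subseteq> {..<n} \<Longrightarrow> Cp S \<Longrightarrow> Cp (Cl S)"
    and Dep_iff: "S \<subseteq> {..<n} \<Longrightarrow> Dep S \<longleftrightarrow> Cp S \<and> (\<exists>e\<in>S. e \<in> Cl (S - {e}))"
    and indep_insert: "insert i T \<subseteq> {..<n} \<Longrightarrow> Cp (insert i T) \<Longrightarrow> \<not> Dep T \<Longrightarrow> i \<notin> Cl T \<Longrightarrow> \<not> Dep (insert i T)"
begin

lemma Cl_mono: "S \<subseteq> T \<Longrightarrow> T \<subseteq> {..<n} \<Longrightarrow> Cl S \<subseteq> Cl T"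
  using Cl_trans Cl_extensive by blast

lemma finite_Cl: "finite (Cl S)"
  using Cl_ground finite_subset by blast

lemma Dep_superset:
  assumes "Dep C" "C \<subseteq> U" "Cp U" "U \<subseteq> {..<n}"
  shows "Dep U"
proof -
  obtain e where e: "e \<in> C" "e \<in> Cl (C - {e})" using Dep_iff[of C] assms by blast
  have "Cl (C - {e}) \<subseteq> Cl (U - {e})" by (rule Cl_mono) (use assms in auto)
  then show ?thesis using Dep_iff[of U] e assms by blast
qed

definition circuit :: "nat set \<Rightarrow> bool" where
  "circuit C \<longleftrightarrow> C \<subseteq> {..<n} \<and> Dep C \<and> (\<forall>T. T \<subset> C \<longrightarrow> \<not> Dep T)"

lemma circuitD: "circuit C \<Longrightarrow> C \<subseteq> {..<n}" "circuit C \<Longrightarrow> Dep C" "circuit C \<Longrightarrow> T \<subset> C \<Longrightarrow> \<not> Dep T"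
  "circuit C \<Longrightarrow> finite C" "circuit C \<Longrightarrow> Cp C"
  using Dep_iff finite_subset unfolding circuit_def by blast+

lemma circuit_exists:
  assumes "Dep S" "S \<subseteq> {..<n}"
  obtains C where "C \<subseteq> S" "circuit C"
proof -
  have "finite {C. C \<subseteq> S \<and> Dep C}" using assms(2) finite_subset[of S "{..<n}"] by simp
  moreover have "S \<in> {C. C \<subseteq> S \<and> Dep C}" using assms by simp
  ultimately obtain C where C: "C \<subseteq> S" "Dep C" "\<And>T. T \<subseteq> S \<Longrightarrow> Dep T \<Longrightarrow> T \<subseteq> C \<Longrightarrow> C = T"
    using finite_has_minimal[of "{C. C \<subseteq> S \<and> Dep C}"] by (metis (mono_tags, lifting) emptyE mem_Collect_eq)
  then have "circuit C" using assms(2) unfolding circuit_def by blast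
  with C(1) show thesis by (rule that)
qed

text \<open>An element of a circuit contains the intersection of the others; otherwise adding it to
  the independent set of the others would leave an independent set.\<close>

lemma circuit_closure:
  assumes "circuit C" "i \<in> C"
  shows "i \<in> Cl (C - {i})"
proof (rule ccontr)
  assume "i \<notin> Cl (C - {i})"
  moreover have "\<not> Dep (C - {i})" using circuitD(3)[OF assms(1), of "C - {i}"] assms(2) by blast
  moreover have "insert i (C - {i}) = C" using assms(2) by auto
  ultimately show False using indep_insert[of i "C - {i}"] circuitD[OF assms(1)] by simp
qed

end

text \<open>The type argument fixes the field of coefficients.\<close>

locale os_ideal_context = hyperplane_closure n Cp Cl Dep
  for n Cp Cl Dep + fixes field_ty :: "'k::field itself"
begin

definition relations :: "(nat set \<Rightarrow> 'k) set" where
  "relations = {bd_mono C | C. circuit C} \<union> {mono_elt S | S. S \<subseteq> {..<n} \<and> \<not> Cp S}"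

definition I :: "(nat set \<Rightarrow> 'k) set" where
  "I = Idl\<^bsub>ext_alg n\<^esub> relations"

lemma bd_mono_closed:
  assumes "C \<subseteq> {..<n}" shows "(bd_mono C :: nat set \<Rightarrow> 'k) \<in> carrier (ext_alg n)"
proof -
  have "(contr C (mono_elt C) :: nat set \<Rightarrow> 'k) \<in> carrier (ext_alg n)"
    by (intro contr_closed mono_elt_closed assms)
  moreover have "finite C" using finite_subset[OF assms] by simp
  ultimately show ?thesis
    using bd_mono_eq_contr[of C C, where 'a='k] by (simp add: carrier_ext_alg)
qed

lemma relations_carrier: "relations \<subseteq> carrier (ext_alg n)"
  using bd_mono_closed mono_elt_closed circuitD(1) unfolding relations_def by auto

lemma ideal_I: "ideal I (ext_alg n)"
  unfolding I_def by (rule ring.genideal_ideal[OF ring_ext_alg relations_carrier])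

lemma I_carrier: "a \<in> I \<Longrightarrow> a \<in> carrier (ext_alg n)"
  using ideal.Icarr[OF ideal_I] by blast

lemma I_add: "a \<in> I \<Longrightarrow> b \<in> I \<Longrightarrow> (\<lambda>S. a S + b S) \<in> I"
  using additive_subgroup.a_closed[OF ideal.axioms(1)[OF ideal_I], of a b] by (simp add: ext_alg_def)

lemma I_wedge_left: "a \<in> I \<Longrightarrow> w \<in> carrier (ext_alg n) \<Longrightarrow> wedge w a \<in> I"
  using ideal.I_l_closed[OF ideal_I, of a w] by (simp add: ext_alg_def)

lemma I_wedge_right: "a \<in> I \<Longrightarrow> w \<in> carrier (ext_alg n) \<Longrightarrow> wedge a w \<in> I"
  using ideal.I_r_closed[OF ideal_I, of a w] by (simp add: ext_alg_def)

lemma I_zero: "(\<lambda>S. 0) \<in> I"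
  using additive_subgroup.zero_closed[OF ideal.axioms(1)[OF ideal_I]] by (simp add: ext_alg_def)

lemma I_smult: assumes "a \<in> I" shows "(\<lambda>S. c * a S) \<in> I"
proof -
  have "(\<lambda>S. c * mono_elt {} S) \<in> carrier (ext_alg n)" by (auto simp: carrier_ext_alg mono_elt_def)
  then have "wedge (\<lambda>S. c * mono_elt {} S) a \<in> I" using assms by (intro I_wedge_left)
  then show ?thesis using I_carrier[OF assms] by (simp add: wedge_smult_left wedge_one_left)
qed

lemma I_uminus: "a \<in> I \<Longrightarrow> (\<lambda>S. - a S) \<in> I"
  using I_smult[of a "-1"] by simp

lemma I_diff: "a \<in> I \<Longrightarrow> b \<in> I \<Longrightarrow> (\<lambda>S. a S - b S) \<in> I"
  using I_add[of a "\<lambda>S. - b S"] I_uminus[of b] by simp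

text \<open>Induction over the ideal: a property of its elements needs to be checked only for the generators and for
  closure under addition and multiplication.\<close>

lemma I_minimal:
  assumes "Z \<subseteq> carrier (ext_alg n)" "(\<lambda>S. 0) \<in> Z"
    and "\<And>a b. a \<in> Z \<Longrightarrow> b \<in> Z \<Longrightarrow> (\<lambda>S. a S + b S) \<in> Z"
    and "\<And>a w. a \<in> Z \<Longrightarrow> w \<in> carrier (ext_alg n) \<Longrightarrow> wedge w a \<in> Z"
    and "\<And>a w. a \<in> Z \<Longrightarrow> w \<in> carrier (ext_alg n) \<Longrightarrow> wedge a w \<in> Z"
    and "relations \<subseteq> Z"
  shows "I \<subseteq> Z"
proof -
  let ?E = "ext_alg n :: ('k, nat set \<Rightarrow> 'k) module"
  interpret R: ring ?E by (rule ring_ext_alg)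
  have ainv: "\<ominus>\<^bsub>?E\<^esub> a \<in> Z" if "a \<in> Z" for a
  proof -
    have aE: "a \<in> carrier ?E" using that assms(1) by blast
    have "\<ominus>\<^bsub>?E\<^esub> a = (\<ominus>\<^bsub>?E\<^esub> \<one>\<^bsub>?E\<^esub>) \<otimes>\<^bsub>?E\<^esub> a" using aE by (simp add: R.l_minus)
    also have "\<dots> = wedge (\<ominus>\<^bsub>?E\<^esub> \<one>\<^bsub>?E\<^esub>) a" by (simp add: ext_alg_def)
    also have "\<dots> \<in> Z" by (rule assms(4)[OF that R.a_inv_closed[OF R.one_closed]])
    finally show ?thesis .
  qed
  have "subgroup Z (add_monoid ?E)"
  proof (rule R.add.subgroupI)
    show "Z \<subseteq> carrier ?E" "Z \<noteq> {}" using assms(1,2) by auto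
    show "a \<oplus>\<^bsub>?E\<^esub> b \<in> Z" if "a \<in> Z" "b \<in> Z" for a b
      using assms(3)[OF that] by (simp add: ext_alg_def)
    show "\<ominus>\<^bsub>?E\<^esub> a \<in> Z" if "a \<in> Z" for a by (rule ainv[OF that])
  qed
  then have "ideal Z ?E"
    by (rule idealI[OF ring_ext_alg]) (use assms(4,5) in \<open>simp_all add: ext_alg_def\<close>)
  then show ?thesis unfolding I_def using assms(6) by (rule R.genideal_minimal)
qed

lemma mono_elt_in_I: "S \<subseteq> {..<n} \<Longrightarrow> \<not> Cp S \<Longrightarrow> mono_elt S \<in> I"
  and bd_circuit_in_I: "circuit C \<Longrightarrow> bd_mono C \<in> I"
proof -
  have "relations \<subseteq> I" unfolding I_def by (rule ring.genideal_self[OF ring_ext_alg relations_carrier])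
  then show "S \<subseteq> {..<n} \<Longrightarrow> \<not> Cp S \<Longrightarrow> mono_elt S \<in> I" "circuit C \<Longrightarrow> bd_mono C \<in> I"
    unfolding relations_def by blast+
qed

text \<open>The generators are homogeneous, hence so is the ideal; only the parity of the degree is used.\<close>

lemma parity_part_I:
  assumes "a \<in> I" shows "parity_part p a \<in> I"
proof -
  let ?Z = "{a \<in> carrier (ext_alg n). \<forall>p. parity_part p a \<in> I}"
  have hom: "r \<in> ?Z" if "r \<in> I" "\<And>S. r S \<noteq> 0 \<Longrightarrow> card S = d" for r :: "nat set \<Rightarrow> 'k" and d
  proof -
    have "parity_part p r = (if even d = p then r else (\<lambda>S. 0))" for p
    proof
      fix T show "parity_part p r T = (if even d = p then r else (\<lambda>S. 0)) T"
        using that(2)[of T] by (cases "r T = 0") (auto simp: parity_part_def)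
    qed
    then show ?thesis using that(1) I_carrier I_zero by auto
  qed
  have "I \<subseteq> ?Z"
  proof (rule I_minimal)
    show "(\<lambda>S. 0) \<in> ?Z" using I_zero by (simp add: parity_part_def carrier_ext_alg)
    show "(\<lambda>S. a S + b S) \<in> ?Z" if "a \<in> ?Z" "b \<in> ?Z" for a b :: "nat set \<Rightarrow> 'k"
    proof -
      have "parity_part p (\<lambda>S. a S + b S) = (\<lambda>S. parity_part p a S + parity_part p b S)" for p
        by (auto simp: parity_part_def)
      moreover have "(\<lambda>S. a S + b S) \<in> carrier (ext_alg n)"
        using that by (auto simp: carrier_ext_alg) (metis add.right_neutral lessThan_iff subsetD)
      ultimately show ?thesis using that I_add by simp
    qed
    fix a w :: "nat set \<Rightarrow> 'k" assume aw: "a \<in> ?Z" "w \<in> carrier (ext_alg n)"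
    then have "wedge (parity_part p w) (parity_part q a) \<in> I" "wedge (parity_part q a) (parity_part p w) \<in> I" for p q
      by (simp_all add: I_wedge_left I_wedge_right parity_part_closed)
    then show "wedge w a \<in> ?Z" "wedge a w \<in> ?Z"
      using aw by (simp_all add: parity_part_wedge wedge_closed I_add)
  next
    show "relations \<subseteq> ?Z"
    proof
      fix r :: "nat set \<Rightarrow> 'k" assume "r \<in> relations"
      then consider C where "r = bd_mono C" "circuit C" | S where "r = mono_elt S" "S \<subseteq> {..<n}" "\<not> Cp S"
        unfolding relations_def by blast
      then show "r \<in> ?Z"
      proof cases
        case (1 C)
        have "card S = card C - 1" if nz: "r S \<noteq> 0" for S
        proof -
          from nz obtain i where "i \<in> C" "S = C - {i}" unfolding 1(1) by (rule bd_mono_nonzero)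
          then show ?thesis using circuitD(4)[OF 1(2)] by simp
        qed
        then show ?thesis using 1 bd_circuit_in_I by (intro hom) auto
      next
        case (2 S)
        then show ?thesis using mono_elt_in_I
          by (intro hom[of _ "card S"]) (auto simp: mono_elt_def split: if_splits)
      qed
    qed
  qed auto
  with assms show ?thesis by blast
qed

lemma invol_I: "a \<in> I \<Longrightarrow> invol a \<in> I"
  unfolding invol_eq_parity by (intro I_diff parity_part_I)

text \<open>By the Leibniz rule, a derivation preserves the ideal as soon as it maps the generators into it.\<close>

lemma contr_I:
  assumes rel: "\<And>r :: nat set \<Rightarrow> 'k. r \<in> relations \<Longrightarrow> contr Y r \<in> I"
    and a: "a \<in> I"
  shows "contr Y a \<in> I"
proof -
  let ?Z = "{a \<in> I. contr Y a \<in> I}"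
  have "I \<subseteq> ?Z"
  proof (rule I_minimal)
    show "(\<lambda>S. 0) \<in> ?Z" using I_zero by (simp add: contr_def contr1_def)
    fix a w :: "nat set \<Rightarrow> 'k" assume aw: "a \<in> ?Z" "w \<in> carrier (ext_alg n)"
    then have a: "a \<in> I" "contr Y a \<in> I" by auto
    have "wedge (contr Y w) a \<in> I" "wedge (invol w) (contr Y a) \<in> I"
      "wedge (contr Y a) w \<in> I" "wedge (invol a) (contr Y w) \<in> I"
      by (intro I_wedge_left I_wedge_right a aw(2) contr_closed invol_closed invol_I)+
    then show "wedge w a \<in> ?Z" "wedge a w \<in> ?Z"
      using a aw(2) by (simp_all add: contr_wedge I_add I_wedge_left I_wedge_right)
  next
    show "relations \<subseteq> ?Z"
      using rel bd_circuit_in_I mono_elt_in_I unfolding relations_def by blast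
  qed (auto simp: contr_linear intro: I_add I_carrier)
  with a show ?thesis by blast
qed

subsection \<open>No-broken-circuit monomials span\<close>

lemma wedge_mono_bd:
  "wedge (mono_elt W) (bd_mono C) =
    (\<lambda>U. \<Sum>i\<in>C. (-1) ^ card {j \<in> C. j \<le> i} * wedge (mono_elt W) (mono_elt (C - {i})) U)"
  unfolding bd_mono_def wedge_sum_right by (simp add: wedge_smult_right)

lemma mono_elt_split:
  assumes "finite T" "C \<subseteq> T"
  shows "mono_elt T = (\<lambda>U. wedge_sign C (T - C) * wedge (mono_elt C) (mono_elt (T - C)) U)"
proof -
  have "finite C" "finite (T - C)" "C \<union> (T - C) = T" using assms finite_subset by auto
  then show ?thesis by (simp add: wedge_mono_elt mult.assoc[symmetric] wedge_sign_square)
qed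

lemma mono_elt_superset_I:
  assumes "mono_elt C \<in> I" "C \<subseteq> T" "T \<subseteq> {..<n}"
  shows "mono_elt T \<in> I"
proof -
  have "finite T" using assms(3) finite_subset by blast
  then have "mono_elt T = (\<lambda>U. wedge_sign C (T - C) * (wedge (mono_elt C) (mono_elt (T - C)) U :: 'k))"
    using assms(2) by (rule mono_elt_split)
  also have "\<dots> \<in> I" by (intro I_smult I_wedge_right mono_elt_closed assms(1)) (use assms(3) in auto)
  finally show ?thesis .
qed

text \<open>A monomial is, up to sign, the product of any one of its generators with its boundary: in
  \<open>e\<^sub>i \<and> \<partial> e\<^sub>C\<close> only the term of \<open>C - {i}\<close> survives.\<close>

lemma circuit_in_I:
  assumes "circuit C" shows "mono_elt C \<in> I"
proof -
  obtain i where i: "i \<in> C" using circuitD(2,1)[OF assms] Dep_iff[of C] by blast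
  have "wedge (mono_elt {i}) (bd_mono C) =
      (\<lambda>U. \<Sum>j\<in>C. if j = i then (-1) ^ card {k \<in> C. k \<le> i} * wedge_sign {i} (C - {i}) * mono_elt C U else (0 :: 'k))"
    unfolding wedge_mono_bd
  proof (rule ext, rule sum.cong[OF refl])
    fix U :: "nat set" and j assume "j \<in> C"
    have "insert i (C - {i}) = C" using i by auto
    then show "(-1) ^ card {k \<in> C. k \<le> j} * wedge (mono_elt {i}) (mono_elt (C - {j})) U =
      (if j = i then (-1) ^ card {k \<in> C. k \<le> i} * wedge_sign {i} (C - {i}) * mono_elt C U else (0 :: 'k))"
      using i circuitD(4)[OF assms] by (auto simp: wedge_mono_elt)
  qed
  also have "\<dots> = (\<lambda>U. (-1) ^ card {k \<in> C. k \<le> i} * wedge_sign {i} (C - {i}) * mono_elt C U)"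
    using i circuitD(4)[OF assms] by (simp add: sum.delta)
  finally have eq: "wedge (mono_elt {i}) (bd_mono C) = (\<lambda>U. (-1) ^ card {k \<in> C. k \<le> i} * wedge_sign {i} (C - {i}) * mono_elt C U :: 'k)" .
  let ?c = "(-1) ^ card {k \<in> C. k \<le> i} * wedge_sign {i} (C - {i}) :: 'k"
  have "(\<lambda>U. ?c * mono_elt C U) \<in> I"
    unfolding eq[symmetric] using circuitD(1)[OF assms] i
    by (intro I_wedge_left bd_circuit_in_I[OF assms] mono_elt_closed) auto
  then have "(\<lambda>U. ?c * (?c * mono_elt C U)) \<in> I" by (rule I_smult)
  moreover have "?c * ?c = 1"
    by (simp add: wedge_sign_def power_mult_distrib[symmetric] mult.assoc mult.left_commute)
  ultimately show ?thesis by (simp add: mult.assoc[symmetric])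
qed

lemma Dep_in_I:
  assumes "Dep S" "S \<subseteq> {..<n}" shows "mono_elt S \<in> I"
proof -
  obtain C where "C \<subseteq> S" "circuit C" using circuit_exists[OF assms] .
  then show ?thesis using mono_elt_superset_I[OF circuit_in_I _ assms(2)] by blast
qed

text \<open>The boundary is a derivation, and a dependent set \<open>S\<close> contains a circuit \<open>C\<close>. By the Leibniz rule,
  the boundary of \<open>e\<^sub>C \<and> e\<^bsub>S - C\<^esub>\<close> is a combination of multiples of the boundary of \<open>e\<^sub>C\<close> and of \<open>e\<^sub>C\<close> itself.\<close>

lemma bd_Dep_in_I:
  assumes "Dep S" "S \<subseteq> {..<n}" shows "bd_mono S \<in> I"
proof -
  obtain C where C: "C \<subseteq> S" "circuit C" using circuit_exists[OF assms] .
  have fin: "finite S" using assms(2) finite_subset by blast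
  have "contr S (mono_elt C) = (\<lambda>T. - bd_mono C T :: 'k)"
    unfolding bd_mono_eq_contr[OF fin C(1)] by simp
  then have "contr S (mono_elt C) \<in> I" using I_uminus[OF bd_circuit_in_I[OF C(2)]] by simp
  moreover have "contr S (mono_elt S) =
    (\<lambda>T. wedge_sign C (S - C) * contr S (wedge (mono_elt C) (mono_elt (S - C))) T :: 'k)"
    by (subst mono_elt_split[OF fin C(1)]) (rule contr_smult)
  moreover have "(mono_elt (S - C) :: nat set \<Rightarrow> 'k) \<in> carrier (ext_alg n)" using assms by (intro mono_elt_closed) auto
  ultimately have "contr S (mono_elt S) \<in> I"
    using circuit_in_I[OF C(2)] by (simp add: contr_wedge I_smult I_add I_wedge_right invol_I contr_closed)
  then show ?thesis using I_uminus bd_mono_eq_contr[OF fin subset_refl, where 'a='k] by metis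
qed

text \<open>No broken circuits: \<open>e\<close> does not contain the intersection of the members of \<open>S\<close> above \<open>e\<close>. As
  in the case of rank functions, the condition for \<open>e \<in> S\<close> makes \<open>S\<close> independent.\<close>

definition nbc :: "nat set \<Rightarrow> bool" where
  "nbc S \<longleftrightarrow> S \<subseteq> {..<n} \<and> Cp S \<and> (\<forall>e<n. e \<notin> Cl {s \<in> S. e < s})"

definition span_mod :: "nat set set \<Rightarrow> (nat set \<Rightarrow> 'k) set \<Rightarrow> (nat set \<Rightarrow> 'k) set" where
  "span_mod N J = {a. \<exists>u. (\<forall>S. u S \<noteq> 0 \<longrightarrow> S \<in> N) \<and> (\<lambda>S. a S - u S) \<in> J}"

lemma span_mod_I_I: "a \<in> I \<Longrightarrow> a \<in> span_mod N I"
  unfolding span_mod_def by (rule CollectI, rule exI[of _ "\<lambda>S. 0"]) simp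

lemma span_mod_mono: "S \<in> N \<Longrightarrow> mono_elt S \<in> span_mod N I"
  unfolding span_mod_def using I_zero by (intro CollectI exI[of _ "mono_elt S"]) (auto simp: mono_elt_def)

lemma span_mod_I_add:
  assumes "a \<in> span_mod N I" "b \<in> span_mod N I" shows "(\<lambda>S. a S + b S) \<in> span_mod N I"
proof -
  obtain u v where "\<And>S. u S \<noteq> 0 \<Longrightarrow> S \<in> N" "(\<lambda>S. a S - u S) \<in> I"
    "\<And>S. v S \<noteq> 0 \<Longrightarrow> S \<in> N" "(\<lambda>S. b S - v S) \<in> I" using assms unfolding span_mod_def by blast
  then have "\<forall>S. u S + v S \<noteq> 0 \<longrightarrow> S \<in> N" "(\<lambda>S. (a S + b S) - (u S + v S)) \<in> I"
    using I_add[of "\<lambda>S. a S - u S" "\<lambda>S. b S - v S"] by (simp_all add: algebra_simps) (metis add.right_neutral)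
  then show ?thesis unfolding span_mod_def by (intro CollectI exI[of _ "\<lambda>S. u S + v S"] conjI)
qed

lemma span_mod_I_smult:
  assumes "a \<in> span_mod N I" shows "(\<lambda>S. c * a S) \<in> span_mod N I"
proof -
  obtain u where "\<And>S. u S \<noteq> 0 \<Longrightarrow> S \<in> N" "(\<lambda>S. a S - u S) \<in> I" using assms unfolding span_mod_def by blast
  then have "\<forall>S. c * u S \<noteq> 0 \<longrightarrow> S \<in> N" "(\<lambda>S. c * a S - c * u S) \<in> I"
    using I_smult[of "\<lambda>S. a S - u S" c] by (auto simp: right_diff_distrib)
  then show ?thesis unfolding span_mod_def by (intro CollectI exI[of _ "\<lambda>S. c * u S"] conjI)
qed

lemma span_mod_I_sum:
  "(\<And>i. i \<in> A \<Longrightarrow> f i \<in> span_mod N I) \<Longrightarrow> (\<lambda>S. \<Sum>i\<in>A. f i S) \<in> span_mod N I"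
proof (induction A rule: infinite_finite_induct)
  case (insert i A)
  then show ?case using span_mod_I_add[of "f i" N "\<lambda>S. \<Sum>i\<in>A. f i S"] by simp
qed (simp_all add: span_mod_I_I I_zero)

text \<open>If \<open>P\<close> is the part of \<open>T\<close> above \<open>e\<close>, then \<open>insert e P\<close> is dependent. Its boundary multiplied by the remaining
  part \<open>W\<close> of the monomial is a relation that expresses \<open>e\<^sub>T\<close> by monomials in which an element of \<open>P\<close> is
  replaced by the smaller element \<open>e\<close>.\<close>

lemma nbc_rewrite:
  assumes T: "T \<subseteq> {..<n}" "Cp T" and e: "e < n" "e \<in> Cl {t \<in> T. e < t}" "e \<notin> T"
    and smaller: "\<And>i. i \<in> T \<Longrightarrow> e < i \<Longrightarrow> mono_elt (insert e (T - {i})) \<in> span_mod N I"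
  shows "mono_elt T \<in> span_mod N I"
proof -
  define P where "P = {t \<in> T. e < t}"
  define W where "W = {t \<in> T. t < e}"
  have fin: "finite T" using T(1) finite_subset by blast
  have TWP: "T = W \<union> P" "W \<inter> insert e P = {}" "e \<notin> P" "finite W" "finite P"
    using e(3) fin unfolding P_def W_def by auto (metis linorder_neqE_nat)
  have P: "P \<subseteq> {..<n}" using T(1) by (auto simp: P_def)
  have "Cp P" using Cp_subset[OF T(2)] by (auto simp: P_def)
  then have "Cp (Cl P)" using Cp_Cl P by blast
  moreover have sub: "insert e P \<subseteq> Cl P" using e(2) Cl_extensive[OF P] by (auto simp: P_def)
  ultimately have "Cp (insert e P)" using Cp_subset by blast
  moreover have "e \<in> Cl (insert e P - {e})" using e(2) TWP(3) by (simp add: P_def)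
  ultimately have Dep: "Dep (insert e P)" using Dep_iff[of "insert e P"] P e(1) by blast
  let ?g = "\<lambda>i. (-1) ^ card {j \<in> insert e P. j \<le> i} * wedge_sign W (insert e P - {i}) :: 'k"
  have I: "wedge (mono_elt W) (bd_mono (insert e P)) \<in> (I :: (nat set \<Rightarrow> 'k) set)"
    by (intro I_wedge_left bd_Dep_in_I Dep mono_elt_closed) (use P e T in \<open>auto simp: W_def\<close>)
  have eq: "wedge (mono_elt W) (bd_mono (insert e P)) = (\<lambda>U. \<Sum>i\<in>insert e P. ?g i * mono_elt (W \<union> (insert e P - {i})) U)"
    unfolding wedge_mono_bd
  proof (intro ext sum.cong refl)
    fix U :: "nat set" and i assume "i \<in> insert e P"
    have "W \<inter> (insert e P - {i}) = {}" using TWP(2) by auto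
    then show "(-1) ^ card {j \<in> insert e P. j \<le> i} * wedge (mono_elt W) (mono_elt (insert e P - {i})) U =
        ?g i * mono_elt (W \<union> (insert e P - {i})) U"
      using TWP(4,5) by (subst wedge_mono_elt) auto
  qed
  have "W \<union> (insert e P - {e}) = T" using TWP by auto
  then have "(\<lambda>U. ?g e * mono_elt T U + (\<Sum>i\<in>P. ?g i * mono_elt (W \<union> (insert e P - {i})) U)) \<in> I"
    using I unfolding eq using TWP(3,5) by simp
  then have 1: "(\<lambda>U. ?g e * mono_elt T U + (\<Sum>i\<in>P. ?g i * mono_elt (W \<union> (insert e P - {i})) U)) \<in> span_mod N I"
    by (rule span_mod_I_I)
  have 2: "(\<lambda>U. -1 * (\<Sum>i\<in>P. ?g i * mono_elt (W \<union> (insert e P - {i})) U)) \<in> span_mod N I"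
  proof (intro span_mod_I_smult span_mod_I_sum)
    fix i assume i: "i \<in> P"
    then have "W \<union> (insert e P - {i}) = insert e (T - {i})" using TWP by auto
    then show "mono_elt (W \<union> (insert e P - {i})) \<in> span_mod N I"
      using smaller[of i] i unfolding P_def by simp
  qed
  have "(\<lambda>U. ?g e * mono_elt T U) \<in> span_mod N I"
    using span_mod_I_add[OF 1 2] by simp
  then have "(\<lambda>U. inverse (?g e) * (?g e * mono_elt T U)) \<in> span_mod N I" by (rule span_mod_I_smult)
  moreover have unit: "(\<lambda>U. inverse c * (c * mono_elt T U)) = mono_elt T" if "c \<noteq> 0" for c :: 'k
    using that by (simp add: mult.assoc[symmetric])
  have "?g e \<noteq> 0" by simp
  note unit[OF this]
  ultimately show ?thesis by (simp only:)
qed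

text \<open>Each rewriting step lowers the sum of the indices.\<close>

lemma mono_elt_span_nbc:
  assumes "T \<subseteq> {..<n}"
  shows "mono_elt T \<in> span_mod {S. nbc S} I"
  using assms
proof (induction "\<Sum>T" arbitrary: T rule: less_induct)
  case less
  have fin: "finite T" using less.prems finite_subset by blast
  show ?case
  proof (cases "nbc T \<or> \<not> Cp T")
    case True
    then show ?thesis using span_mod_mono mono_elt_in_I[OF less.prems] span_mod_I_I by blast
  next
    case False
    then obtain e where e: "e < n" "e \<in> Cl {s \<in> T. e < s}" and Cp: "Cp T"
      using less.prems unfolding nbc_def by blast
    show ?thesis
    proof (cases "e \<in> T")
      case True
      have "Cl {s \<in> T. e < s} \<subseteq> Cl (T - {e})" by (rule Cl_mono) (use less.prems in auto)
      then have "Dep T" using Dep_iff[OF less.prems] e Cp True by blast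
      then show ?thesis using Dep_in_I less.prems span_mod_I_I by blast
    next
      case eT: False
      show ?thesis
      proof (rule nbc_rewrite[OF less.prems Cp e eT])
        fix i assume i: "i \<in> T" "e < i"
        have "\<Sum>(insert e (T - {i})) = e + \<Sum>(T - {i})" using fin eT by (subst sum.insert) auto
        also have "\<dots> < i + \<Sum>(T - {i})" using i by simp
        also have "\<dots> = \<Sum>T" using fin i by (simp add: sum.remove)
        finally show "mono_elt (insert e (T - {i})) \<in> span_mod {S. nbc S} I"
          using less.prems e by (intro less.hyps) auto
      qed
    qed
  qed
qed

lemma ext_alg_decomp:
  assumes "a \<in> carrier (ext_alg n)"
  shows "a = (\<lambda>U. \<Sum>T\<in>Pow {..<n}. a T * mono_elt T U)"
proof
  fix U
  have "(\<Sum>T\<in>Pow {..<n}. a T * mono_elt T U) = (\<Sum>T\<in>Pow {..<n}. if U = T then a T else 0)"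
    by (rule sum.cong) (auto simp: mono_elt_def)
  also have "\<dots> = (if U \<in> Pow {..<n} then a U else 0)" by (subst sum.delta') auto
  also have "\<dots> = a U" using assms by (auto simp: carrier_ext_alg)
  finally show "a U = (\<Sum>T\<in>Pow {..<n}. a T * mono_elt T U)" by simp
qed

theorem nbc_spans: "a \<in> carrier (ext_alg n) \<Longrightarrow> a \<in> span_mod {S. nbc S} I"
proof -
  assume a: "a \<in> carrier (ext_alg n)"
  show ?thesis
    by (subst ext_alg_decomp[OF a], intro span_mod_I_sum span_mod_I_smult mono_elt_span_nbc) auto
qed

subsection \<open>No-broken-circuit monomials are independent\<close>

text \<open>A list of hyperplanes, read from its end, gives a flag of closures. Contracting
  successively with the differences of the flag, from the largest closure down, leaves a scalar: the iterated
  residue along the flag.\<close>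

fun flag_residue :: "nat list \<Rightarrow> (nat set \<Rightarrow> 'k::field) \<Rightarrow> 'k" where
  "flag_residue [] a = a {}"
| "flag_residue (s # L) a = flag_residue L (contr (Cl (set (s # L)) - Cl (set L)) a)"

lemma flag_residue_add: "flag_residue L (\<lambda>S. a S + b S) = flag_residue L a + flag_residue L b"
  by (induction L arbitrary: a b) (simp_all add: contr_linear)

lemma flag_residue_smult: "flag_residue L (\<lambda>S. c * a S) = c * flag_residue L a"
  by (induction L arbitrary: a) (simp_all add: contr_smult)

lemma flag_residue_uminus: "flag_residue L (\<lambda>S. - a S) = - flag_residue L a"
  using flag_residue_smult[of L "-1" a] by simp

text \<open>With \<open>X\<close> the largest and \<open>X'\<close> the next closure of the flag, contraction with \<open>X\<close> is the sum of those with
  \<open>X - X'\<close> and \<open>X'\<close>. The former is applied first in the residue and squares to zero; the latter anticommutes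
  with it and vanishes by induction.\<close>

lemma flag_residue_contr:
  assumes "set L \<subseteq> {..<n}"
  shows "flag_residue L (contr (Cl (set L)) a) = 0"
  using assms
proof (induction L arbitrary: a)
  case Nil
  then show ?case by (simp add: Cl_empty contr_def)
next
  case (Cons s L)
  let ?X = "Cl (set (s # L))" and ?X' = "Cl (set L)"
  have "?X' \<subseteq> ?X" by (rule Cl_mono) (use Cons.prems in auto)
  then have "?X = (?X - ?X') \<union> ?X'" by auto
  then have "contr ?X a = (\<lambda>T. contr (?X - ?X') a T + contr ?X' a T)"
    using contr_Un[of "?X - ?X'" "?X'" a] finite_Cl by (metis Diff_disjoint finite_Diff inf_commute)
  then have "contr (?X - ?X') (contr ?X a) = (\<lambda>T. contr (?X - ?X') (contr (?X - ?X') a) T + contr (?X - ?X') (contr ?X' a) T)"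
    by (simp only: contr_linear)
  also have "\<dots> = (\<lambda>T. - contr ?X' (contr (?X - ?X') a) T)"
    by (simp only: contr_contr contr_anticommute[of "?X - ?X'" ?X'] add_0)
  finally show ?case using Cons by (simp only: flag_residue.simps flag_residue_uminus) simp
qed

text \<open>Going back along the flag, each contraction adds to the support an element outside of the closure
  reached so far, which keeps the set independent.\<close>

lemma flag_residue_support:
  assumes "set L \<subseteq> {..<n}" "Cp (set L)" "flag_residue L a \<noteq> 0"
  obtains T where "a T \<noteq> 0" "T \<subseteq> Cl (set L)" "\<not> Dep T"
proof -
  have "\<exists>T. a T \<noteq> 0 \<and> T \<subseteq> Cl (set L) \<and> \<not> Dep T"
    using assms
  proof (induction L arbitrary: a)
    case Nil
    then show ?case using Dep_iff[of "{}"] by (intro exI[of _ "{}"]) auto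
  next
    case (Cons s L)
    let ?X = "Cl (set (s # L))" and ?X' = "Cl (set L)"
    have Cp': "Cp (set L)" using Cp_subset[OF Cons.prems(2)] by auto
    obtain T where T: "contr (?X - ?X') a T \<noteq> 0" "T \<subseteq> ?X'" "\<not> Dep T"
      using Cons.IH[of "contr (?X - ?X') a"] Cons.prems Cp' by auto
    then obtain i where i: "i \<in> ?X - ?X'" "i \<notin> T" "a (insert i T) \<noteq> 0" by (auto elim: contr_nonzero)
    have "?X' \<subseteq> ?X" by (rule Cl_mono) (use Cons.prems in auto)
    then have sub: "insert i T \<subseteq> ?X" using T i by auto
    have "Cp (insert i T)" using Cp_Cl[OF Cons.prems(1,2)] Cp_subset sub by blast
    moreover have "i \<notin> Cl T" using i Cl_trans[OF T(2)] by auto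
    moreover have "insert i T \<subseteq> {..<n}" using sub Cl_ground by blast
    ultimately have "\<not> Dep (insert i T)" using indep_insert T(3) by blast
    with i(3) sub show ?case by blast
  qed
  then show thesis using that by blast
qed

lemma flag_residue_superset:
  assumes L: "set L \<subseteq> {..<n}" "Cp (set L)"
    and C: "\<not> C \<subseteq> Cl (set L) \<or> Dep C"
    and a: "\<And>U. a U \<noteq> 0 \<Longrightarrow> C \<subseteq> U"
  shows "flag_residue L a = 0"
proof (rule ccontr)
  assume "flag_residue L a \<noteq> 0"
  then obtain T where T: "a T \<noteq> 0" "T \<subseteq> Cl (set L)" "\<not> Dep T" using flag_residue_support[OF L] by blast
  have "Cp T" "T \<subseteq> {..<n}" using Cp_Cl[OF L] Cp_subset T(2) Cl_ground by blast+
  then show False using T a[OF T(1)] C Dep_superset by blast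
qed

lemma wedge_superset_left: "(\<And>U. a U \<noteq> 0 \<Longrightarrow> C \<subseteq> U) \<Longrightarrow> wedge a z U \<noteq> 0 \<Longrightarrow> C \<subseteq> U"
  and wedge_superset_right: "(\<And>U. a U \<noteq> 0 \<Longrightarrow> C \<subseteq> U) \<Longrightarrow> wedge z a U \<noteq> 0 \<Longrightarrow> C \<subseteq> U"
  by (metis wedge_nonzero Diff_subset subset_trans)+

text \<open>If \<open>C\<close> lies in the top closure \<open>X\<close> of the flag, then the boundary of \<open>e\<^sub>C\<close> is a contraction with
  \<open>X\<close>. By the Leibniz rule, contracting \<open>w \<and> e\<^sub>C \<and> z\<close> with \<open>X\<close>, which gives residue zero, yields the
  required product up to multiples of \<open>e\<^sub>C\<close>; these have residue zero because \<open>C\<close> is dependent. If \<open>C\<close> does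
  not lie in \<open>X\<close>, then at least two of its elements are outside of \<open>X\<close>, and one of them remains in each
  term of the boundary.\<close>

lemma flag_residue_circuit:
  fixes w z :: "nat set \<Rightarrow> 'k"
  assumes L: "set L \<subseteq> {..<n}" "Cp (set L)" and C: "circuit C"
  shows "flag_residue L (wedge (wedge w (bd_mono C)) z) = 0"
proof (cases "C \<subseteq> Cl (set L)")
  case True
  let ?D = "contr (Cl (set L))" and ?c = "mono_elt C" and ?w = "invol w"
  let ?a1 = "wedge (wedge (?D ?w) ?c) z" and ?a2 = "wedge (wedge w (invol ?c)) (?D z)"
  have c: "?c U \<noteq> 0 \<Longrightarrow> C \<subseteq> U" "invol ?c U \<noteq> 0 \<Longrightarrow> C \<subseteq> U" for U
    by (auto simp: mono_elt_def invol_def split: if_splits)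
  have 1: "flag_residue L ?a1 = 0"
    by (rule flag_residue_superset[OF L, of C])
       (use circuitD(2)[OF C] wedge_superset_left[OF wedge_superset_right[of ?c C "?D ?w"]] c in blast)+
  have 2: "flag_residue L ?a2 = 0"
    by (rule flag_residue_superset[OF L, of C])
       (use circuitD(2)[OF C] wedge_superset_left[OF wedge_superset_right[of "invol ?c" C w]] c in blast)+
  have "?D (wedge (wedge ?w ?c) z) = (\<lambda>T. (?a1 T + wedge (wedge w (?D ?c)) z T) + ?a2 T)"
    by (simp add: contr_wedge invol_wedge wedge_add_left)
  then have "flag_residue L (\<lambda>T. (?a1 T + wedge (wedge w (?D ?c)) z T) + ?a2 T) = 0"
    using flag_residue_contr[OF L(1), of "wedge (wedge ?w ?c) z"] by simp
  then have "flag_residue L (wedge (wedge w (?D ?c)) z) = 0"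
    unfolding flag_residue_add 1 2 by simp
  then show ?thesis
    unfolding bd_mono_eq_contr[OF finite_Cl True]
    by (simp add: wedge_uminus_left wedge_uminus_right flag_residue_uminus)
next
  case False
  then obtain i where i: "i \<in> C" "i \<notin> Cl (set L)" by blast
  have "\<not> C - {i} \<subseteq> Cl (set L)" using circuit_closure[OF C i(1)] Cl_trans i(2) by blast
  then obtain j where j: "j \<in> C" "j \<noteq> i" "j \<notin> Cl (set L)" by blast
  show ?thesis
  proof (rule ccontr)
    assume "\<not> ?thesis"
    then obtain T where T: "wedge (wedge w (bd_mono C)) z T \<noteq> 0" "T \<subseteq> Cl (set L)"
      using flag_residue_support[OF L] by blast
    obtain P where P: "P \<subseteq> T" "wedge w (bd_mono C) P \<noteq> 0" "z (T - P) \<noteq> 0"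
      using T(1) by (rule wedge_nonzero)
    obtain Q where Q: "Q \<subseteq> P" "w Q \<noteq> 0" "bd_mono C (P - Q) \<noteq> (0 :: 'k)"
      using P(2) by (rule wedge_nonzero)
    obtain k where "k \<in> C" "P - Q = C - {k}" using Q(3) by (rule bd_mono_nonzero)
    then have "i \<in> T \<or> j \<in> T" using i j P(1) by auto
    then show False using i j T(2) by auto
  qed
qed

text \<open>The residue of a generator multiplied on both sides by arbitrary elements has to be considered,
  since a functional need not vanish on the ideal when it vanishes on generators.\<close>

lemma flag_residue_I:
  assumes L: "set L \<subseteq> {..<n}" "Cp (set L)" and a: "a \<in> (I :: (nat set \<Rightarrow> 'k) set)"
  shows "flag_residue L a = 0"
proof -
  let ?E = "carrier (ext_alg n :: ('k, nat set \<Rightarrow> 'k) module)"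
  let ?Z = "{a \<in> ?E. \<forall>w\<in>?E. \<forall>z\<in>?E. flag_residue L (wedge (wedge w a) z) = 0}"
  have "I \<subseteq> ?Z"
  proof (rule I_minimal)
    show "(\<lambda>S. 0) \<in> ?Z"
      using flag_residue_smult[of L 0] by (simp add: carrier_ext_alg wedge_zero_right wedge_zero_left)
    show "(\<lambda>S. a S + b S) \<in> ?Z" if "a \<in> ?Z" "b \<in> ?Z" for a b
    proof -
      have "(\<lambda>S. a S + b S) \<in> ?E"
        using that by (auto simp: carrier_ext_alg) (metis add.right_neutral lessThan_iff subsetD)
      then show ?thesis using that by (simp add: wedge_add_left wedge_add_right flag_residue_add)
    qed
    show "wedge v a \<in> ?Z" if "a \<in> ?Z" "v \<in> ?E" for a v
    proof -
      have "flag_residue L (wedge (wedge w (wedge v a)) z) = 0" if "w \<in> ?E" "z \<in> ?E" for w z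
        using \<open>a \<in> ?Z\<close> \<open>v \<in> ?E\<close> that wedge_closed[of w n v] by (simp add: wedge_assoc[of w v a, symmetric])
      then show ?thesis using that by (simp add: wedge_closed)
    qed
    show "wedge a v \<in> ?Z" if "a \<in> ?Z" "v \<in> ?E" for a v
    proof -
      have "flag_residue L (wedge (wedge w (wedge a v)) z) = 0" if "w \<in> ?E" "z \<in> ?E" for w z
        using \<open>a \<in> ?Z\<close> \<open>v \<in> ?E\<close> that wedge_closed[of v n z]
        by (simp add: wedge_assoc[of w a v, symmetric] wedge_assoc[of "wedge w a" v z])
      then show ?thesis using that by (simp add: wedge_closed)
    qed
    show "relations \<subseteq> ?Z"
    proof
      fix r :: "nat set \<Rightarrow> 'k" assume r: "r \<in> relations"
      have "flag_residue L (wedge (wedge w r) z) = 0" for w z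
      proof (cases "\<exists>C. r = bd_mono C \<and> circuit C")
        case True
        then show ?thesis using flag_residue_circuit[OF L] by blast
      next
        case False
        then obtain S where S: "r = mono_elt S" "S \<subseteq> {..<n}" "\<not> Cp S" using r unfolding relations_def by blast
        then have "\<not> S \<subseteq> Cl (set L)" using Cp_Cl[OF L] Cp_subset by blast
        then have ns: "\<not> S \<subseteq> Cl (set L) \<or> Dep S" by blast
        have "r U \<noteq> 0 \<Longrightarrow> S \<subseteq> U" for U by (auto simp: S mono_elt_def split: if_splits)
        then have "wedge w r U \<noteq> 0 \<Longrightarrow> S \<subseteq> U" for U by (rule wedge_superset_right)
        then have "wedge (wedge w r) z U \<noteq> 0 \<Longrightarrow> S \<subseteq> U" for U by (rule wedge_superset_left)
        then show ?thesis by (rule flag_residue_superset[OF L ns])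
      qed
      then show "r \<in> ?Z" using relations_carrier r by blast
    qed
  qed auto
  with a have "a \<in> ?Z" by blast
  moreover have one: "mono_elt {} \<in> ?E" by (rule mono_elt_closed) simp
  ultimately have "flag_residue L (wedge (wedge (mono_elt {}) a) (mono_elt {})) = 0" by blast
  then show ?thesis using I_carrier[OF a] by (simp add: wedge_one_left wedge_one_right)
qed

lemma nbc_subset: "nbc T \<Longrightarrow> S \<subseteq> T \<Longrightarrow> nbc S"
proof -
  assume T: "nbc T" and S: "S \<subseteq> T"
  have "Cl {s \<in> S. e < s} \<subseteq> Cl {s \<in> T. e < s}" for e
    by (rule Cl_mono) (use T S in \<open>auto simp: nbc_def\<close>)
  then show ?thesis using T S Cp_subset unfolding nbc_def by blast
qed

text \<open>If a list is sorted and has no broken circuits, then its first element is the least element of its closure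
  and is new at the last step of the flag.\<close>

lemma nbc_Cons:
  assumes "sorted_wrt (<) (s # L)" "nbc (set (s # L))"
  shows "nbc (set L)" and "e \<in> Cl (set (s # L)) \<Longrightarrow> s \<le> e" and "s \<notin> Cl (set L)" and "s \<in> Cl (set (s # L))"
proof -
  show "nbc (set L)" by (rule nbc_subset[OF assms(2)]) auto
  show "s \<le> e" if e: "e \<in> Cl (set (s # L))"
  proof (rule ccontr)
    assume "\<not> s \<le> e"
    then have "{t \<in> set (s # L). e < t} = set (s # L)" using assms(1) by auto
    moreover have "e < n" using e Cl_ground by blast
    ultimately show False using e assms(2) unfolding nbc_def by metis
  qed
  have "{t \<in> set (s # L). s < t} = set L" using assms(1) by auto
  then show "s \<notin> Cl (set L)" using assms(2) unfolding nbc_def by (metis insert_subset lessThan_iff list.simps(15))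
  show "s \<in> Cl (set (s # L))" using Cl_extensive[of "set (s # L)"] assms(2) by (auto simp: nbc_def)
qed

text \<open>At each step of the flag, the contraction removes an element which is at least the corresponding entry of \<open>L\<close>,
  since that entry is the least element of the closure.\<close>

lemma flag_residue_triangular:
  assumes "sorted_wrt (<) L" "nbc (set L)" "flag_residue L a \<noteq> 0"
  obtains T where "a T \<noteq> 0" "T = set L \<or> \<Sum>T > \<Sum>(set L)"
proof -
  have "\<exists>T. finite T \<and> a T \<noteq> 0 \<and> (T = set L \<or> \<Sum>T > \<Sum>(set L))"
    using assms
  proof (induction L arbitrary: a)
    case Nil
    then show ?case by (intro exI[of _ "{}"]) auto
  next
    case (Cons s L)
    let ?Y = "Cl (set (s # L)) - Cl (set L)"
    note n = nbc_Cons[OF Cons.prems(1,2)]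
    obtain T where T: "finite T" "contr ?Y a T \<noteq> 0" "T = set L \<or> \<Sum>T > \<Sum>(set L)"
      using Cons.IH[of "contr ?Y a"] Cons.prems n(1) by auto
    obtain i where i: "i \<in> ?Y" "i \<notin> T" "a (insert i T) \<noteq> 0" using T(2) by (rule contr_nonzero)
    have "s \<le> i" using i n(2) by blast
    moreover have "s \<notin> set L" using Cons.prems(1) by auto
    ultimately have "insert i T = set (s # L) \<or> \<Sum>(insert i T) > \<Sum>(set (s # L))"
      using T i(2) by auto
    then show ?case using i T(1) by blast
  qed
  then show thesis using that by blast
qed

lemma flag_residue_diagonal:
  assumes "sorted_wrt (<) L" "nbc (set L)"
  shows "flag_residue L (mono_elt (set L)) \<noteq> (0 :: 'k)"
  using assms
proof (induction L)
  case Nil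
  then show ?case by (simp add: mono_elt_def)
next
  case (Cons s L)
  let ?Y = "Cl (set (s # L)) - Cl (set L)"
  note n = nbc_Cons[OF Cons.prems]
  have "set L \<subseteq> Cl (set L)" using n(1) Cl_extensive by (auto simp: nbc_def)
  then have "?Y \<inter> set (s # L) = {s}" using n by auto
  moreover have "s \<notin> set L" using Cons.prems(1) by auto
  ultimately have "contr ?Y (mono_elt (set (s # L))) = (\<lambda>T. wedge_sign {s} (set L) * mono_elt (set L) T :: 'k)"
    using finite_Cl by (simp add: contr_mono_elt)
  then have "flag_residue (s # L) (mono_elt (set (s # L))) = wedge_sign {s} (set L) * flag_residue L (mono_elt (set L))"
    by (simp only: flag_residue.simps flag_residue_smult)
  then show ?case using Cons.IH Cons.prems n(1) by simp
qed

text \<open>In a combination that lies in the ideal, take a monomial \<open>e\<^sub>S\<close> whose sum of indices is maximal. The residue along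
  the flag of \<open>S\<close> vanishes on the ideal and on all other monomials that occur, but not on \<open>e\<^sub>S\<close>.\<close>

theorem nbc_independent:
  assumes "u \<in> I" "\<And>S. u S \<noteq> 0 \<Longrightarrow> nbc S"
  shows "u = (\<lambda>S. 0)"
proof (rule ccontr)
  assume nz: "u \<noteq> (\<lambda>S. 0)"
  let ?N = "{S. u S \<noteq> 0}"
  have "?N \<subseteq> Pow {..<n}" using assms(2) by (auto simp: nbc_def)
  then have "finite ?N" using finite_subset by blast
  moreover have "?N \<noteq> {}" using nz by auto
  ultimately have fin: "finite (Sum ` ?N)" "Sum ` ?N \<noteq> {}" by auto
  obtain S where "S \<in> ?N" "Max (Sum ` ?N) = \<Sum>S" using Max_in[OF fin] by (rule imageE)
  then have S: "u S \<noteq> 0" "\<Sum>S = Max (Sum ` ?N)" by simp_all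
  have max: "\<Sum>T \<le> \<Sum>S" if "u T \<noteq> 0" for T
    unfolding S(2) by (rule Max_ge[OF fin(1)]) (use that in auto)
  have nbc: "nbc S" using assms(2) S(1) .
  define L where "L = sorted_list_of_set S"
  have finS: "finite S" using nbc finite_subset by (auto simp: nbc_def)
  then have L: "set L = S" "sorted_wrt (<) L" by (auto simp: L_def)
  have nbcL: "nbc (set L)" using nbc L(1) by simp
  let ?rest = "\<lambda>T. if T = S then 0 else u T"
  have "flag_residue L ?rest = 0"
  proof (rule ccontr)
    assume "flag_residue L ?rest \<noteq> 0"
    then obtain T where "?rest T \<noteq> 0" "T = set L \<or> \<Sum>T > \<Sum>(set L)"
      by (rule flag_residue_triangular[OF L(2) nbcL])
    then show False using max[of T] L(1) by (auto split: if_splits)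
  qed
  moreover have "flag_residue L u = u S * flag_residue L (mono_elt S) + flag_residue L ?rest"
  proof -
    have "u = (\<lambda>T. u S * mono_elt S T + ?rest T)" by (auto simp: mono_elt_def)
    then have "flag_residue L u = flag_residue L (\<lambda>T. u S * mono_elt S T + ?rest T)" by (rule arg_cong)
    then show ?thesis by (simp only: flag_residue_add flag_residue_smult)
  qed
  moreover have "flag_residue L u = 0"
    using nbc L(1) by (intro flag_residue_I assms(1)) (auto simp: nbc_def)
  moreover have "flag_residue L (mono_elt S) \<noteq> (0 :: 'k)" using flag_residue_diagonal[OF L(2) nbcL] L(1) by simp
  ultimately show False using S(1) by simp
qed

end

section \<open>Arrangements split into blocks\<close>

context os_ideal_context
begin

lemma I_sum: "(\<And>i. i \<in> A \<Longrightarrow> f i \<in> I) \<Longrightarrow> (\<lambda>S. \<Sum>i\<in>A. f i S) \<in> I"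
proof (induction A rule: infinite_finite_induct)
  case (insert i A)
  then show ?case using I_add[of "f i" "\<lambda>S. \<Sum>i\<in>A. f i S"] by simp
qed (simp_all add: I_zero)

text \<open>A derivation that preserves the ideal and has the nonzero value \<open>c\<close> on \<open>x\<close> gives a contracting homotopy:
  if \<open>x \<and> a\<close> lies in the ideal, then applying it shows that \<open>c a\<close> is congruent to \<open>x \<and> contr Y a\<close>.\<close>

lemma exact_of_nonzero_weight:
  assumes x: "x \<in> ext_grade n 1" and Y: "\<And>a. a \<in> I \<Longrightarrow> contr Y a \<in> I"
    and c: "(\<Sum>i\<in>Y. x {i}) \<noteq> 0"
  shows "exact_mod n I x"
  unfolding exact_mod_def
proof (intro ballI impI)
  fix a assume a: "a \<in> carrier (ext_alg n)" "wedge x a \<in> I"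
  let ?c = "\<Sum>i\<in>Y. x {i}"
  have "contr Y (wedge x a) = (\<lambda>S. ?c * a S - wedge x (contr Y a) S)"
    unfolding contr_wedge contr_grade_1[OF x] invol_grade_1[OF x] wedge_smult_left wedge_uminus_left
    by (simp add: wedge_one_left[OF a(1)])
  then have "(\<lambda>S. ?c * a S - wedge x (contr Y a) S) \<in> I" using Y[OF a(2)] by simp
  then have "(\<lambda>S. inverse ?c * (?c * a S - wedge x (contr Y a) S)) \<in> I" by (rule I_smult)
  moreover have "(\<lambda>S. inverse ?c * (?c * a S - wedge x (contr Y a) S)) =
     (\<lambda>S. a S - wedge x (\<lambda>S. inverse ?c * contr Y a S) S)"
    unfolding wedge_smult_right using c by (simp add: right_diff_distrib mult.assoc[symmetric])
  moreover have "(\<lambda>S. inverse ?c * contr Y a S) \<in> carrier (ext_alg n)"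
    using contr_closed[OF a(1), of Y] by (simp add: carrier_ext_alg)
  ultimately show "\<exists>b\<in>carrier (ext_alg n). (\<lambda>S. a S - wedge x b S) \<in> I" by metis
qed

end

text \<open>A partition of the hyperplanes into blocks such that nonempty intersection and closure can be
  tested block by block; \<open>cen\<close> is a set of blocks with nonempty intersection.\<close>

locale os_blocks = os_ideal_context n Cp Cl Dep field_ty
  for n Cp Cl Dep and field_ty :: "'k::field itself" +
  fixes m :: nat and Blk :: "nat \<Rightarrow> nat set" and cen :: "nat set"
  assumes Blk_cover: "(\<Union>j<m. Blk j) = {..<n}"
    and Blk_disjoint: "i < m \<Longrightarrow> j < m \<Longrightarrow> i \<noteq> j \<Longrightarrow> Blk i \<inter> Blk j = {}"
    and Blk_nonempty: "j < m \<Longrightarrow> Blk j \<noteq> {}"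
    and Cp_blocks: "S \<subseteq> {..<n} \<Longrightarrow> Cp S \<longleftrightarrow> (\<forall>j<m. Cp (S \<inter> Blk j))"
    and Cl_blocks: "S \<subseteq> {..<n} \<Longrightarrow> Cp S \<Longrightarrow> j < m \<Longrightarrow> e \<in> Blk j \<Longrightarrow> e \<in> Cl S \<longleftrightarrow> e \<in> Cl (S \<inter> Blk j)"
    and cen: "cen \<subseteq> {..<m}" "j \<in> cen \<Longrightarrow> Cp (Blk j)"
begin

lemma Blk_subset: "j < m \<Longrightarrow> Blk j \<subseteq> {..<n}"
  using Blk_cover by blast

lemma finite_Blk: "j < m \<Longrightarrow> finite (Blk j)"
  using Blk_subset finite_subset by blast

lemma block_exists: "e < n \<Longrightarrow> \<exists>j<m. e \<in> Blk j"
  using Blk_cover by blast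

text \<open>Adding the least element of a central block to a set does not create a broken circuit, which makes it the
  suitable generator to kill.\<close>

definition block_root :: "nat \<Rightarrow> nat" where "block_root j = Min (Blk j)"

lemma block_root: "j < m \<Longrightarrow> block_root j \<in> Blk j" "j < m \<Longrightarrow> e \<in> Blk j \<Longrightarrow> block_root j \<le> e"
  unfolding block_root_def using finite_Blk Blk_nonempty by auto

lemma cen_less: "j \<in> cen \<Longrightarrow> j < m"
  using cen(1) by blast

text \<open>If an element \<open>i\<close> of \<open>C\<close> lies in the block, then it contains the intersection of \<open>C - {i}\<close>, and therefore that of its part in the
  block; so the part of \<open>C\<close> in the block is already dependent.\<close>

lemma circuit_in_block:
  assumes "circuit C" "j < m" "C \<inter> Blk j \<noteq> {}"
  shows "C \<subseteq> Blk j"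
proof (rule ccontr)
  assume "\<not> C \<subseteq> Blk j"
  then have sub: "C \<inter> Blk j \<subset> C" by blast
  obtain i where i: "i \<in> C" "i \<in> Blk j" using assms by blast
  note C = circuitD[OF assms(1)]
  have "Cp (C - {i})" using Cp_subset[OF C(5)] by blast
  moreover have "C - {i} \<subseteq> {..<n}" using C(1) by blast
  ultimately have "i \<in> Cl ((C - {i}) \<inter> Blk j)"
    using circuit_closure[OF assms(1) i(1)] Cl_blocks[OF _ _ assms(2) i(2)] by blast
  moreover have "(C - {i}) \<inter> Blk j = C \<inter> Blk j - {i}" by blast
  moreover have "C \<inter> Blk j \<subseteq> {..<n}" "Cp (C \<inter> Blk j)" using C(1) Cp_subset[OF C(5)] by blast+
  ultimately have "Dep (C \<inter> Blk j)" using Dep_iff[of "C \<inter> Blk j"] i by auto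
  then show False using C(3)[OF sub] by blast
qed

text \<open>The boundary of a circuit inside of the block is itself a contraction with the block, so it is killed; a circuit
  outside is not touched. A set with empty intersection has empty intersection in some other block, which
  the contraction leaves intact.\<close>

lemma contr_block_I:
  assumes j: "j \<in> cen" and a: "a \<in> I"
  shows "contr (Blk j) a \<in> I"
proof (rule contr_I[OF _ a])
  fix r assume "r \<in> relations"
  then consider C where "r = bd_mono C" "circuit C" | S where "r = mono_elt S" "S \<subseteq> {..<n}" "\<not> Cp S"
    unfolding relations_def by blast
  then show "contr (Blk j) r \<in> I"
  proof cases
    case (1 C)
    show ?thesis
    proof (cases "C \<inter> Blk j = {}")
      case True
      have "contr (Blk j) r T = 0" for T
      proof (rule ccontr)
        assume "contr (Blk j) r T \<noteq> 0"
        then obtain i where i: "i \<in> Blk j" "i \<notin> T" "r (insert i T) \<noteq> 0" by (rule contr_nonzero)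
        obtain k where "k \<in> C" "insert i T = C - {k}" using i(3) unfolding 1(1) by (rule bd_mono_nonzero)
        then show False using i(1) True by blast
      qed
      then have "contr (Blk j) r = (\<lambda>S. 0)" by (rule ext)
      then show ?thesis using I_zero by simp
    next
      case False
      then have "C \<subseteq> Blk j" using circuit_in_block[OF 1(2) cen_less[OF j]] by blast
      then have "r = (\<lambda>T. - contr (Blk j) (mono_elt C) T)"
        unfolding 1(1) by (rule bd_mono_eq_contr[OF finite_Blk[OF cen_less[OF j]]])
      then have "contr (Blk j) r = (\<lambda>T. 0)" by (simp add: contr_linear contr_contr)
      then show ?thesis using I_zero by simp
    qed
  next
    case (2 S)
    obtain k where k: "k < m" "\<not> Cp (S \<inter> Blk k)" using Cp_blocks[OF 2(2)] 2(3) by blast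
    have kj: "k \<noteq> j" using k(2) cen(2)[OF j] Cp_subset by blast
    show ?thesis unfolding 2(1) contr_mono_elt[OF finite_Blk[OF cen_less[OF j]]]
    proof (intro I_sum I_smult mono_elt_in_I)
      fix i assume i: "i \<in> Blk j \<inter> S"
      then have "S \<inter> Blk k \<subseteq> S - {i}" using Blk_disjoint[OF k(1) cen_less[OF j] kj] by blast
      then show "\<not> Cp (S - {i})" using k(2) Cp_subset by blast
      show "S - {i} \<subseteq> {..<n}" using 2(2) by blast
    qed
  qed
qed

lemma nbc_blocks:
  assumes "S \<subseteq> {..<n}"
  shows "nbc S \<longleftrightarrow> (\<forall>j<m. Cp (S \<inter> Blk j) \<and> (\<forall>e\<in>Blk j. e \<notin> Cl {s \<in> S \<inter> Blk j. e < s}))"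
proof (cases "Cp S")
  case True
  have "e \<in> Cl {s \<in> S. e < s} \<longleftrightarrow> e \<in> Cl {s \<in> S \<inter> Blk j. e < s}" if "j < m" "e \<in> Blk j" for j e
  proof -
    have "{s \<in> S. e < s} \<subseteq> {..<n}" "Cp {s \<in> S. e < s}" using assms Cp_subset[OF True] by auto
    from Cl_blocks[OF this that] show ?thesis by (simp add: Int_def conj_ac)
  qed
  note Cl_iff = this
  have "nbc S \<longleftrightarrow> (\<forall>e<n. e \<notin> Cl {s \<in> S. e < s})" using True assms unfolding nbc_def by blast
  also have "\<dots> \<longleftrightarrow> (\<forall>j<m. \<forall>e\<in>Blk j. e \<notin> Cl {s \<in> S \<inter> Blk j. e < s})"
  proof
    assume l: "\<forall>e<n. e \<notin> Cl {s \<in> S. e < s}"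
    show "\<forall>j<m. \<forall>e\<in>Blk j. e \<notin> Cl {s \<in> S \<inter> Blk j. e < s}"
    proof (intro allI impI ballI)
      fix j e assume "j < m" "e \<in> Blk j"
      then show "e \<notin> Cl {s \<in> S \<inter> Blk j. e < s}" using l Cl_iff Blk_subset by blast
    qed
  next
    assume r: "\<forall>j<m. \<forall>e\<in>Blk j. e \<notin> Cl {s \<in> S \<inter> Blk j. e < s}"
    show "\<forall>e<n. e \<notin> Cl {s \<in> S. e < s}"
    proof (intro allI impI)
      fix e assume "e < n"
      then obtain j where "j < m" "e \<in> Blk j" using block_exists by blast
      then show "e \<notin> Cl {s \<in> S. e < s}" using r Cl_iff by blast
    qed
  qed
  also have "\<dots> \<longleftrightarrow> (\<forall>j<m. Cp (S \<inter> Blk j) \<and> (\<forall>e\<in>Blk j. e \<notin> Cl {s \<in> S \<inter> Blk j. e < s}))"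
    using Cp_subset[OF True] by blast
  finally show ?thesis .
next
  case False
  then show ?thesis using Cp_blocks[OF assms] unfolding nbc_def by blast
qed

definition roots :: "nat set" where "roots = block_root ` cen"

text \<open>The root of a block is its least element, so it never occurs in the sets \<open>{s \<in> S. e < s}\<close> for \<open>e\<close> in the block.\<close>

lemma nbc_Un_roots:
  assumes "nbc S" shows "nbc (S \<union> roots)"
proof -
  have S: "S \<subseteq> {..<n}" using assms unfolding nbc_def by blast
  have R: "roots \<subseteq> {..<n}" using block_root(1) cen_less Blk_subset unfolding roots_def by blast
  show ?thesis
  proof (subst nbc_blocks, use S R in blast, intro allI impI)
    fix j assume j: "j < m"
    show "Cp ((S \<union> roots) \<inter> Blk j) \<and> (\<forall>e\<in>Blk j. e \<notin> Cl {s \<in> (S \<union> roots) \<inter> Blk j. e < s})"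
    proof (cases "j \<in> cen")
      case True
      have "Cp ((S \<union> roots) \<inter> Blk j)" using Cp_subset[OF cen(2)[OF True]] by blast
      moreover have "e \<notin> Cl {s \<in> (S \<union> roots) \<inter> Blk j. e < s}" if e: "e \<in> Blk j" for e
      proof -
        have "\<not> e < s" if "s \<in> roots" "s \<in> Blk j" for s
        proof -
          obtain k where k: "k \<in> cen" "s = block_root k" using \<open>s \<in> roots\<close> unfolding roots_def by blast
          then have "k = j" using block_root(1)[OF cen_less[OF k(1)]] that(2) Blk_disjoint[OF cen_less[OF k(1)] j] by blast
          then show ?thesis using block_root(2)[OF j e] k by simp
        qed
        then have "{s \<in> (S \<union> roots) \<inter> Blk j. e < s} = {s \<in> S \<inter> Blk j. e < s}" by blast
        then show ?thesis using assms nbc_blocks[OF S] j e by simp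
      qed
      ultimately show ?thesis by blast
    next
      case False
      have "roots \<inter> Blk j = {}"
        using block_root(1) cen_less Blk_disjoint[OF _ j] False unfolding roots_def by blast
      then have "(S \<union> roots) \<inter> Blk j = S \<inter> Blk j" by blast
      then show ?thesis using assms nbc_blocks[OF S] j by simp
    qed
  qed
qed

definition reduced :: "nat set set" where "reduced = {S. nbc S \<and> S \<inter> roots = {}}"

text \<open>The factor of \<open>reduced\<close> that belongs to one block.\<close>

definition block_reduced :: "nat \<Rightarrow> nat set set" where
  "block_reduced j = {S. S \<subseteq> Blk j \<and> Cp S \<and> (\<forall>e\<in>Blk j. e \<notin> Cl {s \<in> S. e < s}) \<and> (j \<in> cen \<longrightarrow> block_root j \<notin> S)}"

lemma alt_count_reduced: "alt_count reduced = (\<Prod>j<m. alt_count (block_reduced j))"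
proof -
  let ?P = "\<lambda>j S. Cp S \<and> (\<forall>e\<in>Blk j. e \<notin> Cl {s \<in> S. e < s}) \<and> (j \<in> cen \<longrightarrow> block_root j \<notin> S)"
  have roots_iff: "S \<inter> roots = {} \<longleftrightarrow> (\<forall>j<m. j \<in> cen \<longrightarrow> block_root j \<notin> S \<inter> Blk j)" for S
    using cen_less block_root(1) unfolding roots_def by blast
  have "nbc S \<and> S \<inter> roots = {} \<longleftrightarrow> S \<subseteq> {..<n} \<and> (\<forall>j<m. ?P j (S \<inter> Blk j))" for S
  proof (cases "S \<subseteq> {..<n}")
    case True
    show ?thesis unfolding nbc_blocks[OF True] roots_iff using True by metis
  qed (simp add: nbc_def)
  then have "reduced = {S. S \<subseteq> (\<Union>j<m. Blk j) \<and> (\<forall>j<m. ?P j (S \<inter> Blk j))}"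
    unfolding reduced_def Blk_cover by (rule Collect_cong)
  then show ?thesis
    unfolding block_reduced_def using alt_count_product[of m Blk ?P] finite_Blk Blk_disjoint by simp
qed

text \<open>The invariant of adding the roots of the blocks in \<open>F\<close> to the ideal one at a time. The subspace \<open>J\<close>
  is the enlarged ideal; only multiplication by elements of degree one from the left is recorded.
  Contraction with the other central blocks remains available for later steps, and multiplication by the roots added
  so far leads back to \<open>I\<close>, which later transfers linear independence from \<open>I\<close> to \<open>J\<close>.\<close>

definition admissible :: "(nat set \<Rightarrow> 'k) \<Rightarrow> nat set \<Rightarrow> (nat set \<Rightarrow> 'k) set \<Rightarrow> bool" where
  "admissible x F J \<longleftrightarrow> linear_subset J \<and> I \<subseteq> J \<and>
     (\<forall>a\<in>J. \<forall>p. parity_part p a \<in> J) \<and>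
     (\<forall>w\<in>ext_grade n 1. \<forall>a\<in>J. wedge w a \<in> J) \<and>
     (\<forall>j\<in>cen - F. \<forall>a\<in>J. contr (Blk j) a \<in> J) \<and>
     (\<forall>a\<in>J. wedge (mono_elt (block_root ` F)) a \<in> I) \<and>
     (\<forall>j\<in>F. \<forall>b\<in>carrier (ext_alg n). wedge (mono_elt {block_root j}) b \<in> J) \<and>
     exact_mod n J x"

text \<open>Let \<open>e\<close> be the root of the block \<open>j\<close> and \<open>D\<close> the contraction with the block, so that \<open>D e = 1\<close> and
  \<open>D x = 0\<close>. Suppose that \<open>x \<and> a\<close> lies in \<open>J\<close> up to a multiple of \<open>e\<close>. Then \<open>x \<and> D (e \<and> a)\<close> lies in
  \<open>J\<close>, so \<open>D (e \<and> a)\<close> is divisible by \<open>x\<close> modulo \<open>J\<close>, and it differs from \<open>a\<close> by a multiple of \<open>e\<close>.\<close>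

lemma admissible_insert:
  assumes J: "admissible x F J" and x: "x \<in> ext_grade n 1"
    and j: "j \<in> cen - F" and F: "F \<subseteq> cen" and sum: "(\<Sum>i\<in>Blk j. x {i}) = 0"
  shows "\<exists>J'. admissible x (insert j F) J'"
proof -
  let ?E = "carrier (ext_alg n :: ('k, nat set \<Rightarrow> 'k) module)"
  have Jlin: "linear_subset J" and JI: "I \<subseteq> J" and Jpar: "\<And>a p. a \<in> J \<Longrightarrow> parity_part p a \<in> J"
    and Jw: "\<And>w a. w \<in> ext_grade n 1 \<Longrightarrow> a \<in> J \<Longrightarrow> wedge w a \<in> J"
    and Jc: "\<And>k a. k \<in> cen - F \<Longrightarrow> a \<in> J \<Longrightarrow> contr (Blk k) a \<in> J"
    and Jm: "\<And>a. a \<in> J \<Longrightarrow> wedge (mono_elt (block_root ` F)) a \<in> I"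
    and JF: "\<And>k b. k \<in> F \<Longrightarrow> b \<in> ?E \<Longrightarrow> wedge (mono_elt {block_root k}) b \<in> J"
    and Jex: "exact_mod n J x"
    using J unfolding admissible_def by blast+
  have J0: "(\<lambda>S. 0) \<in> J" and Jadd: "\<And>a b. a \<in> J \<Longrightarrow> b \<in> J \<Longrightarrow> (\<lambda>S. a S + b S) \<in> J"
    and Jsm: "\<And>a c. a \<in> J \<Longrightarrow> (\<lambda>S. c * a S) \<in> J"
    using Jlin unfolding linear_subset_def by blast+
  have Jdiff: "(\<lambda>S. a S - b S) \<in> J" if "a \<in> J" "b \<in> J" for a b
    using Jadd[OF that(1) Jsm[OF that(2), of "-1"]] by simp
  have jm: "j < m" using j cen_less by blast
  define e where "e = (mono_elt {block_root j} :: nat set \<Rightarrow> 'k)"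
  have rn: "block_root j < n" using block_root(1)[OF jm] Blk_subset[OF jm] by blast
  have e1: "e \<in> ext_grade n 1" unfolding e_def by (rule mono_elt_grade_1[OF rn])
  have eE: "e \<in> ?E" by (rule ext_grade_closed[OF e1])
  have De: "contr (Blk k) e = (\<lambda>T. (if k = j then 1 else 0) * mono_elt {} T)" if "k < m" for k
  proof -
    have "(\<Sum>i\<in>Blk k. e {i}) = (\<Sum>i\<in>Blk k. if i = block_root j then 1 else 0)" by (simp add: e_def mono_elt_def)
    also have "\<dots> = (if block_root j \<in> Blk k then 1 else 0)" using finite_Blk[OF that] by (subst sum.delta) auto
    also have "block_root j \<in> Blk k \<longleftrightarrow> k = j" using block_root(1)[OF jm] Blk_disjoint[OF that jm] by blast
    finally show ?thesis unfolding contr_grade_1[OF e1] by simp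
  qed
  have anti: "wedge w (wedge e b) = (\<lambda>S. - wedge e (wedge w b) S)" if "w \<in> ext_grade n 1" for w b
    using wedge_grade_1_commute[OF that, of e]
    by (simp add: wedge_assoc[symmetric] invol_grade_1[OF e1] wedge_uminus_left)
  \<comment> \<open>The multiples of \<open>e\<close> are added to \<open>J\<close>.\<close>
  define J' where "J' = {\<lambda>S. a S + wedge e b S | a b. a \<in> J \<and> b \<in> ?E}"
  have J'I: "(\<lambda>S. a S + wedge e b S) \<in> J'" if "a \<in> J" "b \<in> ?E" for a b using that unfolding J'_def by blast
  have J'E: thesis if "a' \<in> J'" "\<And>a b. a \<in> J \<Longrightarrow> b \<in> ?E \<Longrightarrow> a' = (\<lambda>S. a S + wedge e b S) \<Longrightarrow> thesis" for a' thesis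
    using that unfolding J'_def by blast
  have E0: "(\<lambda>S. 0) \<in> ?E" by (simp add: carrier_ext_alg)
  have Eadd: "(\<lambda>S. a S + b S) \<in> ?E" if "a \<in> ?E" "b \<in> ?E" for a b
    using that unfolding carrier_ext_alg by (auto, metis add.right_neutral lessThan_iff subsetD)
  have Esm: "(\<lambda>S. c * a S) \<in> ?E" if "a \<in> ?E" for a c using that unfolding carrier_ext_alg by auto
  have Eneg: "(\<lambda>S. - a S) \<in> ?E" if "a \<in> ?E" for a using Esm[OF that, of "-1"] by simp
  have JJ': "a \<in> J'" if "a \<in> J" for a using J'I[OF that E0] by (simp add: wedge_zero_right)
  have "linear_subset J'"
    unfolding linear_subset_def
  proof (intro conjI ballI allI)
    show "(\<lambda>S. 0) \<in> J'" by (rule JJ'[OF J0])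
    show "(\<lambda>S. u S + v S) \<in> J'" if u: "u \<in> J'" and v: "v \<in> J'" for u v
    proof -
      obtain a b where 1: "a \<in> J" "b \<in> ?E" "u = (\<lambda>S. a S + wedge e b S)" using u by (rule J'E)
      obtain c d where 2: "c \<in> J" "d \<in> ?E" "v = (\<lambda>S. c S + wedge e d S)" using v by (rule J'E)
      have "(\<lambda>S. u S + v S) = (\<lambda>S. (a S + c S) + wedge e (\<lambda>S. b S + d S) S)"
        unfolding 1 2 wedge_add_right by (simp add: algebra_simps)
      then show ?thesis using J'I[OF Jadd[OF 1(1) 2(1)] Eadd[OF 1(2) 2(2)]] by simp
    qed
    show "(\<lambda>S. c * u S) \<in> J'" if u: "u \<in> J'" for u c
    proof -
      obtain a b where 1: "a \<in> J" "b \<in> ?E" "u = (\<lambda>S. a S + wedge e b S)" using u by (rule J'E)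
      have "(\<lambda>S. c * u S) = (\<lambda>S. c * a S + wedge e (\<lambda>S. c * b S) S)"
        unfolding 1 wedge_smult_right by (simp add: algebra_simps)
      then show ?thesis using J'I[OF Jsm[OF 1(1)] Esm[OF 1(2)]] by simp
    qed
  qed
  moreover have "parity_part p u \<in> J'" if u: "u \<in> J'" for u p
  proof -
    obtain a b where 1: "a \<in> J" "b \<in> ?E" "u = (\<lambda>S. a S + wedge e b S)" using u by (rule J'E)
    have "parity_part p u = (\<lambda>S. parity_part p a S + parity_part p (wedge e b) S)"
      unfolding 1 by (auto simp: parity_part_def)
    then show ?thesis
      using J'I[OF Jpar[OF 1(1)] parity_part_closed[OF 1(2)]] parity_part_wedge_grade_1[OF e1] by simp
  qed
  moreover have "wedge w u \<in> J'" if w: "w \<in> ext_grade n 1" and u: "u \<in> J'" for u w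
  proof -
    obtain a b where 1: "a \<in> J" "b \<in> ?E" "u = (\<lambda>S. a S + wedge e b S)" using u by (rule J'E)
    have "wedge w u = (\<lambda>S. wedge w a S + wedge e (\<lambda>S. - wedge w b S) S)"
      unfolding 1 wedge_add_right anti[OF w] wedge_uminus_right by simp
    then show ?thesis
      using J'I[OF Jw[OF w 1(1)] Eneg[OF wedge_closed[OF ext_grade_closed[OF w] 1(2)]]] by simp
  qed
  moreover have "contr (Blk k) u \<in> J'" if k: "k \<in> cen - insert j F" and u: "u \<in> J'" for k u
  proof -
    obtain a b where 1: "a \<in> J" "b \<in> ?E" "u = (\<lambda>S. a S + wedge e b S)" using u by (rule J'E)
    have kj: "k < m" "k \<noteq> j" using k cen_less by auto
    have "contr (Blk k) u = (\<lambda>S. contr (Blk k) a S + wedge e (\<lambda>S. - contr (Blk k) b S) S)"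
      unfolding 1 contr_linear contr_wedge De[OF kj(1)] invol_grade_1[OF e1] wedge_uminus_left wedge_uminus_right
      using kj(2) by (simp add: wedge_zero_left)
    then show ?thesis using J'I[OF Jc[OF _ 1(1)] Eneg[OF contr_closed[OF 1(2)]]] k by simp
  qed
  moreover have "wedge (mono_elt (block_root ` insert j F)) u \<in> I" if u: "u \<in> J'" for u
  proof -
    obtain a b where 1: "a \<in> J" "b \<in> ?E" "u = (\<lambda>S. a S + wedge e b S)" using u by (rule J'E)
    let ?R = "block_root ` F"
    have finR: "finite ?R" using finite_subset[OF F] finite_subset[OF cen(1)] by simp
    have rR: "block_root j \<notin> ?R"
    proof
      assume "block_root j \<in> ?R"
      then obtain k where k: "k \<in> F" "block_root j = block_root k" by blast
      then show False
        using j F block_root(1)[OF jm] block_root(1)[of k] Blk_disjoint[of k j] cen_less jm by (metis DiffD2 IntI empty_iff subsetD)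
    qed
    let ?s = "wedge_sign {block_root j} ?R :: 'k"
    have m: "mono_elt (block_root ` insert j F) = (\<lambda>U. ?s * wedge e (mono_elt ?R) U)"
      unfolding e_def using wedge_mono_elt[of "{block_root j}" ?R, where 'k='k] finR rR
      by (simp add: mult.assoc[symmetric] wedge_sign_square)
    have zero: "wedge (mono_elt (block_root ` insert j F)) e = (\<lambda>U. 0)"
      unfolding e_def using finR by (subst wedge_mono_elt) auto
    have "wedge (mono_elt (block_root ` insert j F)) a = (\<lambda>U. ?s * wedge e (wedge (mono_elt ?R) a) U)"
      unfolding m wedge_smult_left wedge_assoc ..
    moreover have "wedge (mono_elt (block_root ` insert j F)) (wedge e b) = (\<lambda>U. 0)"
      unfolding wedge_assoc[symmetric] zero wedge_zero_left ..
    ultimately have "wedge (mono_elt (block_root ` insert j F)) u = (\<lambda>U. ?s * wedge e (wedge (mono_elt ?R) a) U)"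
      unfolding 1 wedge_add_right by simp
    then show ?thesis using I_smult[OF I_wedge_left[OF Jm[OF 1(1)] eE]] by simp
  qed
  moreover have "wedge (mono_elt {block_root k}) b \<in> J'" if "k \<in> insert j F" "b \<in> ?E" for k b
  proof (cases "k = j")
    case True
    then show ?thesis using J'I[OF J0 that(2)] by (simp add: e_def)
  next
    case False
    then show ?thesis using JF JJ' that by blast
  qed
  moreover have "exact_mod n J' x"
    unfolding exact_mod_def
  proof (intro ballI impI)
    fix a assume a: "a \<in> ?E" "wedge x a \<in> J'"
    obtain u b where u: "u \<in> J" "b \<in> ?E" "wedge x a = (\<lambda>S. u S + wedge e b S)" using a(2) by (rule J'E)
    let ?D = "contr (Blk j)"
    \<comment> \<open>The projection \<open>a \<mapsto> ?D (e \<and> a)\<close> kills multiples of \<open>e\<close> and commutes with \<open>x\<close>.\<close>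
    have proj: "?D (wedge e c) = (\<lambda>S. c S - wedge e (?D c) S)" if "c \<in> ?E" for c
      unfolding contr_wedge De[OF jm] invol_grade_1[OF e1] wedge_uminus_left
      using that by (simp add: wedge_one_left)
    have Dx: "?D x = (\<lambda>S. 0)" unfolding contr_grade_1[OF x] sum by simp
    have "?D (wedge x (wedge e a)) = (\<lambda>S. - wedge x (?D (wedge e a)) S)"
      unfolding contr_wedge[of _ x] Dx invol_grade_1[OF x] by (simp add: wedge_uminus_left wedge_zero_left)
    moreover have "wedge x (wedge e a) = (\<lambda>S. - wedge e u S)"
      unfolding anti[OF x] u(3) wedge_add_right wedge_assoc[of e e, symmetric] wedge_grade_1_self[OF e1]
      by (simp add: wedge_zero_left)
    ultimately have "wedge x (?D (wedge e a)) = ?D (wedge e u)"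
      by (simp add: contr_linear fun_eq_iff)
    also have "\<dots> \<in> J" using j by (intro Jc Jw[OF e1] u(1)) auto
    finally have "wedge x (?D (wedge e a)) \<in> J" .
    then obtain c where c: "c \<in> ?E" "(\<lambda>S. ?D (wedge e a) S - wedge x c S) \<in> J"
      using Jex contr_closed[OF wedge_closed[OF eE a(1)]] unfolding exact_mod_def by blast
    have "(\<lambda>S. a S - wedge x c S) = (\<lambda>S. (?D (wedge e a) S - wedge x c S) + wedge e (?D a) S)"
      unfolding proj[OF a(1)] by simp
    then show "\<exists>b\<in>?E. (\<lambda>S. a S - wedge x b S) \<in> J'"
      using J'I[OF c(2) contr_closed[OF a(1)]] c(1) by metis
  qed
  ultimately have "admissible x (insert j F) J'"
    unfolding admissible_def using JI JJ' by blast
  then show ?thesis ..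
qed

lemma admissible_exists:
  assumes x: "x \<in> ext_grade n 1" and sum: "\<And>j. j \<in> cen \<Longrightarrow> (\<Sum>i\<in>Blk j. x {i}) = 0"
    and ex: "exact_mod n I x"
  shows "\<exists>J. admissible x cen J"
proof -
  have "\<exists>J. admissible x F J" if "finite F" "F \<subseteq> cen" for F
    using that
  proof (induction F rule: finite_induct)
    case empty
    have "linear_subset I" unfolding linear_subset_def using I_zero I_add I_smult by blast
    moreover have "wedge (mono_elt {}) a \<in> I" if "a \<in> I" for a
      using that wedge_one_left[OF I_carrier[OF that]] by simp
    moreover have "wedge w a \<in> I" if "w \<in> ext_grade n 1" "a \<in> I" for w a
      by (rule I_wedge_left[OF that(2) ext_grade_closed[OF that(1)]])
    ultimately have "admissible x {} I"
      unfolding admissible_def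
      using parity_part_I contr_block_I ex by simp
    then show ?case ..
  next
    case (insert j F)
    then show ?case using admissible_insert[OF _ x, of F _ j] sum[of j] by blast
  qed
  moreover have "finite cen" using finite_subset[OF cen(1)] by simp
  ultimately show ?thesis by blast
qed

text \<open>After all roots of central blocks are killed, the monomials in \<open>reduced\<close> are a basis of the quotient. They
  span, since the other monomials without broken circuits contain a root. They are independent, since
  multiplication by the product of all roots maps the enlarged ideal to \<open>I\<close> and these monomials, up to sign,
  to different monomials without broken circuits.\<close>

lemma alt_count_reduced_zero:
  assumes x: "x \<in> ext_grade n 1" and sum: "\<And>j. j \<in> cen \<Longrightarrow> (\<Sum>i\<in>Blk j. x {i}) = 0"
    and ex: "exact_mod n I x"
  shows "alt_count reduced = 0"
proof -
  let ?E = "carrier (ext_alg n :: ('k, nat set \<Rightarrow> 'k) module)"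
  obtain J where J: "admissible x cen J" using admissible_exists[OF assms] by blast
  then have Jlin: "linear_subset J" and JI: "I \<subseteq> J" and Jpar: "\<And>a p. a \<in> J \<Longrightarrow> parity_part p a \<in> J"
    and Jx: "\<And>a. a \<in> J \<Longrightarrow> wedge x a \<in> J" and Jex: "exact_mod n J x"
    and Jm: "\<And>a. a \<in> J \<Longrightarrow> wedge (mono_elt roots) a \<in> I"
    and Jr: "\<And>j b. j \<in> cen \<Longrightarrow> b \<in> ?E \<Longrightarrow> wedge (mono_elt {block_root j}) b \<in> J"
    unfolding admissible_def roots_def using x by blast+
  have J0: "(\<lambda>S. 0) \<in> J" and Jadd: "\<And>a b. a \<in> J \<Longrightarrow> b \<in> J \<Longrightarrow> (\<lambda>S. a S + b S) \<in> J"
    and Jsm: "\<And>a c. a \<in> J \<Longrightarrow> (\<lambda>S. c * a S) \<in> J"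
    using Jlin unfolding linear_subset_def by blast+
  have Jsum: "(\<lambda>S. \<Sum>i\<in>X. f i S) \<in> J" if "\<And>i. i \<in> X \<Longrightarrow> f i \<in> J" for X :: "nat set set" and f
    using that
  proof (induction X rule: infinite_finite_induct)
    case (insert i X)
    then show ?case using Jadd[of "f i" "\<lambda>S. \<Sum>i\<in>X. f i S"] by simp
  qed (simp_all add: J0)
  have root_J: "mono_elt S \<in> J" if S: "S \<subseteq> {..<n}" "S \<inter> roots \<noteq> {}" for S
  proof -
    obtain j where j: "j \<in> cen" "block_root j \<in> S" using S(2) unfolding roots_def by blast
    have "mono_elt S = (\<lambda>U. wedge_sign {block_root j} (S - {block_root j}) * (wedge (mono_elt {block_root j}) (mono_elt (S - {block_root j})) U :: 'k))"
      using finite_subset[OF S(1)] j by (intro mono_elt_split) auto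
    also have "\<dots> \<in> J" by (intro Jsm Jr[OF j(1)] mono_elt_closed) (use S in auto)
    finally show ?thesis .
  qed
  show ?thesis
  proof (rule exact_mod_imp_alt_count_zero[OF x Jlin Jpar Jx _ _ _ Jex])
    show "reduced \<subseteq> Pow {..<n}" unfolding reduced_def nbc_def by blast
    show "\<exists>u\<in>supported_on reduced. (\<lambda>S. a S - u S) \<in> J" if a: "a \<in> ?E" for a
    proof -
      obtain u where u: "\<And>S. u S \<noteq> 0 \<Longrightarrow> nbc S" "(\<lambda>S. a S - u S) \<in> I"
        using nbc_spans[OF a] unfolding span_mod_def by blast
      let ?u = "\<lambda>S. if S \<inter> roots = {} then u S else 0" and ?v = "\<lambda>S. if S \<inter> roots = {} then 0 else u S"
      have "?u \<in> supported_on reduced" using u(1) unfolding supported_on_def reduced_def by auto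
      moreover have "?v \<in> J"
      proof -
        have vE: "?v \<in> ?E" using u(1) unfolding carrier_ext_alg nbc_def by auto
        have "(\<lambda>U. \<Sum>T\<in>Pow {..<n}. ?v T * mono_elt T U) \<in> J"
        proof (rule Jsum)
          fix T assume "T \<in> Pow {..<n}"
          then show "(\<lambda>U. ?v T * mono_elt T U) \<in> J"
            using root_J[of T] J0 by (cases "T \<inter> roots = {}") (simp_all add: Jsm)
        qed
        then show ?thesis using ext_alg_decomp[OF vE] by metis
      qed
      moreover have "(\<lambda>S. a S - ?u S) = (\<lambda>S. (a S - u S) + ?v S)" by auto
      ultimately show ?thesis using Jadd[of "\<lambda>S. a S - u S" ?v] u(2) JI by (metis subsetD)
    qed
    show "u = (\<lambda>S. 0)" if u: "u \<in> supported_on reduced" "u \<in> J" for u :: "nat set \<Rightarrow> 'k"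
    proof -
      have finr: "finite roots" unfolding roots_def using finite_subset[OF cen(1)] by simp
      have "wedge (mono_elt roots) u = (\<lambda>S. 0)"
      proof (rule nbc_independent[OF Jm[OF u(2)]])
        fix U assume U: "wedge (mono_elt roots) u U \<noteq> 0"
        then have "finite U" using wedge_infinite by blast
        then have "roots \<subseteq> U" "u (U - roots) \<noteq> 0" using U by (auto simp: wedge_mono_elt_left split: if_splits)
        moreover from this have "nbc (U - roots)" using u(1) unfolding supported_on_def reduced_def by blast
        ultimately show "nbc U" using nbc_Un_roots[of "U - roots"] by (simp add: Un_absorb2)
      qed
      then have *: "wedge (mono_elt roots) u (S \<union> roots) = 0" for S by simp
      have "u S = 0" for S
      proof (rule ccontr)
        assume "u S \<noteq> 0"
        then have S: "nbc S" "S \<inter> roots = {}" using u(1) unfolding supported_on_def reduced_def by blast+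
        then have "finite S" unfolding nbc_def using finite_subset by blast
        moreover have "S \<union> roots - roots = S" using S(2) by blast
        ultimately show False using *[of S] finr \<open>u S \<noteq> 0\<close> by (simp add: wedge_mono_elt_left)
      qed
      then show ?thesis by (rule ext)
    qed
  qed
qed

text \<open>If all block sums of an exact \<open>x\<close> were zero, the alternating count of the reduced sets would vanish; but it is
  a product over all blocks, in which no factor is zero.\<close>

theorem exact_iff:
  assumes x: "x \<in> ext_grade n 1" and nz: "\<And>j. j < m \<Longrightarrow> alt_count (block_reduced j) \<noteq> 0"
  shows "exact_mod n I x \<longleftrightarrow> (\<exists>j\<in>cen. (\<Sum>i\<in>Blk j. x {i}) \<noteq> 0)"
proof
  assume "\<exists>j\<in>cen. (\<Sum>i\<in>Blk j. x {i}) \<noteq> 0"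
  then show "exact_mod n I x" using exact_of_nonzero_weight[OF x contr_block_I] by blast
next
  assume "exact_mod n I x"
  moreover have "alt_count reduced \<noteq> 0" unfolding alt_count_reduced using nz by simp
  ultimately show "\<exists>j\<in>cen. (\<Sum>i\<in>Blk j. x {i}) \<noteq> 0" using alt_count_reduced_zero[OF x] by blast
qed

end

section \<open>The singular variety of a quotient\<close>

text \<open>The Orlik--Solomon algebra with an arbitrary ideal in place of the ideal of an arrangement.\<close>

definition os_quotient :: "nat \<Rightarrow> (nat set \<Rightarrow> 'k::field) set \<Rightarrow> (nat set \<Rightarrow> 'k, (nat set \<Rightarrow> 'k) set) module" where
  "os_quotient n J = (let E = ext_alg n; Q = E Quot J
     in ring.extend Q (module.fields (\<lambda>x a. (J +>\<^bsub>E\<^esub> x) \<otimes>\<^bsub>Q\<^esub> a)))"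

lemma os_algebra_quotient: "os_algebra l Hs = os_quotient (length Hs) (os_ideal l Hs)"
  by (simp add: os_algebra_def os_quotient_def Let_def)

text \<open>Exactness is inclusion of the kernel of \<open>x\<close> in its image; the converse inclusion holds because \<open>x\<close> squares
  to zero.\<close>

lemma singular_on_quotient:
  fixes J :: "(nat set \<Rightarrow> 'k::field) set"
  assumes J: "ideal J (ext_alg n)" and x: "x \<in> ext_grade n 1"
  shows "singular_on (os_quotient n J) x \<longleftrightarrow> \<not> exact_mod n J x"
proof -
  let ?E = "ext_alg n :: ('k, nat set \<Rightarrow> 'k) module" and ?M = "os_quotient n J"
  interpret R: ring ?E by (rule ring_ext_alg)
  have xE: "x \<in> carrier ?E" by (rule ext_grade_closed[OF x])
  have M: "carrier ?M = a_rcosets\<^bsub>?E\<^esub> J" "\<zero>\<^bsub>?M\<^esub> = J"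
    "\<And>m. x \<odot>\<^bsub>?M\<^esub> m = rcoset_mult ?E J (J +>\<^bsub>?E\<^esub> x) m"
    by (simp_all add: os_quotient_def Let_def FactRing_def ring.defs module.defs)
  have carr: "carrier ?M = (\<lambda>a. J +>\<^bsub>?E\<^esub> a) ` carrier ?E"
    unfolding M(1) A_RCOSETS_def' by blast
  have smult: "x \<odot>\<^bsub>?M\<^esub> (J +>\<^bsub>?E\<^esub> a) = J +>\<^bsub>?E\<^esub> wedge x a" if "a \<in> carrier ?E" for a
    using ideal.rcoset_mult_add[OF J xE that] unfolding M(3) by (simp add: ext_alg_def)
  have minus: "a \<ominus>\<^bsub>?E\<^esub> b = (\<lambda>S. a S - b S)" if "a \<in> carrier ?E" "b \<in> carrier ?E" for a b
  proof -
    have nb: "(\<lambda>S. - b S) \<in> carrier ?E" using that(2) by (simp add: carrier_ext_alg)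
    have "\<ominus>\<^bsub>?E\<^esub> b = (\<lambda>S. - b S)"
      by (rule R.minus_equality[OF _ that(2) nb]) (simp add: ext_alg_def)
    then show ?thesis by (simp add: a_minus_def) (simp add: ext_alg_def)
  qed
  have eq: "J +>\<^bsub>?E\<^esub> a = J +>\<^bsub>?E\<^esub> b \<longleftrightarrow> (\<lambda>S. a S - b S) \<in> J" if "a \<in> carrier ?E" "b \<in> carrier ?E" for a b
    using R.quotient_eq_iff_same_a_r_cos[OF J that] minus[OF that] by simp
  have zero: "(\<lambda>S. 0) \<in> carrier ?E" by (simp add: carrier_ext_alg)
  have "(\<lambda>S. 0) \<in> J"
    using additive_subgroup.zero_closed[OF ideal.axioms(1)[OF J]] by (simp add: ext_alg_def)
  then have J0: "J +>\<^bsub>?E\<^esub> (\<lambda>S. 0) = J"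
    using ideal.axioms(1)[OF J] R.a_rcos_zero[OF J] by (simp add: ext_alg_def)
  have eq0: "J +>\<^bsub>?E\<^esub> a = J \<longleftrightarrow> a \<in> J" if "a \<in> carrier ?E" for a
    using eq[OF that zero] J0 by simp
  have xa: "wedge x a \<in> carrier ?E" if "a \<in> carrier ?E" for a by (rule wedge_closed[OF xE that])
  define K where "K = {m \<in> carrier ?M. x \<odot>\<^bsub>?M\<^esub> m = \<zero>\<^bsub>?M\<^esub>}"
  define X where "X = (\<lambda>m. x \<odot>\<^bsub>?M\<^esub> m) ` carrier ?M"
  have K: "J +>\<^bsub>?E\<^esub> a \<in> K \<longleftrightarrow> wedge x a \<in> J" if "a \<in> carrier ?E" for a
  proof -
    have "J +>\<^bsub>?E\<^esub> a \<in> carrier ?M" unfolding carr using that by (rule imageI)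
    then show ?thesis unfolding K_def M(2) by (simp add: smult[OF that] eq0[OF xa[OF that]])
  qed
  have X_image: "X = (\<lambda>b. J +>\<^bsub>?E\<^esub> wedge x b) ` carrier ?E"
    unfolding X_def carr image_image using smult by (rule image_cong[OF refl])
  have X: "J +>\<^bsub>?E\<^esub> a \<in> X \<longleftrightarrow> (\<exists>b\<in>carrier ?E. (\<lambda>S. a S - wedge x b S) \<in> J)" if a: "a \<in> carrier ?E" for a
    unfolding X_image image_iff using eq[OF a xa] by (intro bex_cong refl)
  have "X \<subseteq> K"
  proof
    fix m assume "m \<in> X"
    then obtain b where b: "b \<in> carrier ?E" "m = J +>\<^bsub>?E\<^esub> wedge x b" unfolding X_image by (rule imageE)
    have "wedge x (wedge x b) = (\<lambda>S. 0)"
      unfolding wedge_assoc[symmetric] wedge_grade_1_self[OF x] wedge_zero_left ..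
    then show "m \<in> K" unfolding b(2) K[OF xa[OF b(1)]] using \<open>(\<lambda>S. 0) \<in> J\<close> by simp
  qed
  moreover have "K \<subseteq> carrier ?M" unfolding K_def by (rule Collect_restrict)
  ultimately have "K = X \<longleftrightarrow> (\<forall>m\<in>carrier ?M. m \<in> K \<longrightarrow> m \<in> X)" by blast
  also have "\<dots> \<longleftrightarrow> (\<forall>a\<in>carrier ?E. J +>\<^bsub>?E\<^esub> a \<in> K \<longrightarrow> J +>\<^bsub>?E\<^esub> a \<in> X)"
    unfolding carr by (simp only: ball_simps)
  also have "\<dots> \<longleftrightarrow> exact_mod n J x" unfolding exact_mod_def using K X by (intro ball_cong refl) simp
  finally show ?thesis unfolding singular_on_def K_def X_def by blast
qed

lemma ext_grade_1_supported: "ext_grade n 1 = supported_on ((\<lambda>i. {i}) ` {..<n})"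
proof -
  have *: "(\<exists>i<n. S = {i}) \<longleftrightarrow> S \<in> (\<lambda>i. {i}) ` {..<n}" for S by auto
  show ?thesis by (rule Set.set_eqI) (simp only: ext_grade_1_iff supported_on_def mem_Collect_eq *)
qed

context os_blocks
begin

definition weightless :: "(nat set \<Rightarrow> 'k) set" where
  "weightless = {x \<in> ext_grade n 1. \<forall>j\<in>cen. (\<Sum>i\<in>Blk j. x {i}) = 0}"

lemma singular_variety_weightless:
  assumes "\<And>j. j < m \<Longrightarrow> alt_count (block_reduced j) \<noteq> 0"
  shows "singular_variety n (os_quotient n I) = weightless"
  unfolding singular_variety_def weightless_def
  using singular_on_quotient[OF ideal_I] exact_iff assms by blast

lemma linear_subset_grade_1: "linear_subset (ext_grade n 1 :: (nat set \<Rightarrow> 'k) set)"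
  unfolding ext_grade_1_supported by (rule linear_subset_supported_on)

lemma linear_subset_weightless: "linear_subset weightless"
  using linear_subset_grade_1 unfolding linear_subset_def weightless_def
  by (auto simp: sum.distrib sum_distrib_left[symmetric])

lemma subspace_weightless: "VectorSpace.subspace class_ring weightless (ext_subspace n (ext_grade n 1))"
  by (rule subspace_ext_subspace[OF linear_subset_weightless linear_subset_grade_1])
     (auto simp: weightless_def)

text \<open>Rank and nullity for the map of block sums. It is surjective, because the root of one block can
  be given any coordinate without changing the sums over the other blocks.\<close>

lemma dim_weightless:
  "vectorspace.dim class_ring (ext_subspace n (ext_grade n 1 :: (nat set \<Rightarrow> 'k) set)) =
    vectorspace.dim class_ring (ext_subspace n weightless) + card cen"
proof -
  let ?N = "(\<lambda>i. {i}) ` {..<n} :: nat set set" and ?C = "(\<lambda>j. {j}) ` cen :: nat set set"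
  have fin: "finite ?N" "finite cen" using finite_subset[OF cen(1)] by auto
  \<comment> \<open>The map of block sums, with the sum over block \<open>j\<close> recorded as the coefficient of \<open>{j}\<close>.\<close>
  let ?T = "\<lambda>x S. if S \<in> ?C then \<Sum>i\<in>Blk (the_elem S). x {i} else (0 :: 'k)"
  have lin: "linear_map class_ring (ext_subspace n (supported_on ?N)) (ext_subspace n (supported_on ?C)) ?T"
    by (rule linear_map_ext_subspace[OF linear_subset_supported_on linear_subset_supported_on])
       (auto simp: supported_on_def sum.distrib sum_distrib_left fun_eq_iff)
  have surj: "?T ` supported_on ?N = supported_on ?C"
  proof (intro equalityI subsetI)
    fix y :: "nat set \<Rightarrow> 'k" assume y: "y \<in> supported_on ?C"
    \<comment> \<open>The preimage of \<open>y\<close> is supported on the roots.\<close>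
    let ?x = "\<lambda>S. \<Sum>k\<in>cen. y {k} * mono_elt {block_root k} S"
    have x: "?x \<in> supported_on ?N"
      unfolding supported_on_def
    proof (intro CollectI allI impI)
      fix S assume "?x S \<noteq> 0"
      then obtain k where "k \<in> cen" "y {k} * mono_elt {block_root k} S \<noteq> 0"
        by (meson sum.not_neutral_contains_not_neutral)
      then have "k \<in> cen" "S = {block_root k}" by (auto simp: mono_elt_def split: if_splits)
      then show "S \<in> ?N" using block_root(1)[OF cen_less] Blk_subset[OF cen_less] by blast
    qed
    have Tx: "?T ?x = y"
    proof
      fix S
      show "?T ?x S = y S"
      proof (cases "S \<in> ?C")
        case True
        then obtain j where j: "j \<in> cen" "S = {j}" by blast
        note jm = cen_less[OF j(1)]
        have "(\<Sum>i\<in>Blk j. ?x {i}) = (\<Sum>k\<in>cen. y {k} * (\<Sum>i\<in>Blk j. mono_elt {block_root k} {i}))"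
          unfolding sum_distrib_left by (rule sum.swap)
        also have "\<dots> = (\<Sum>k\<in>cen. if k = j then y {k} else 0)"
        proof (rule sum.cong[OF refl])
          fix k assume k: "k \<in> cen"
          have "(\<Sum>i\<in>Blk j. mono_elt {block_root k} {i} :: 'k) = (\<Sum>i\<in>Blk j. if i = block_root k then 1 else 0)"
            by (simp add: mono_elt_def)
          also have "\<dots> = (if block_root k \<in> Blk j then 1 else 0)" using finite_Blk[OF jm] by (subst sum.delta) auto
          also have "block_root k \<in> Blk j \<longleftrightarrow> k = j" using block_root(1)[OF cen_less[OF k]] Blk_disjoint[OF cen_less[OF k] jm] by blast
          finally show "y {k} * (\<Sum>i\<in>Blk j. mono_elt {block_root k} {i}) = (if k = j then y {k} else 0)" by simp
        qed
        also have "\<dots> = y {j}" using fin(2) j(1) by (subst sum.delta) auto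
        finally show ?thesis using j by simp
      next
        case False
        then show ?thesis using y unfolding supported_on_def by auto
      qed
    qed
    show "y \<in> ?T ` supported_on ?N" by (rule image_eqI[where f = ?T, OF Tx[symmetric] x])
  qed (auto simp: supported_on_def)
  have ker: "{x \<in> supported_on ?N. ?T x = (\<lambda>S. 0)} = weightless"
  proof -
    have "?T x = (\<lambda>S. 0) \<longleftrightarrow> (\<forall>j\<in>cen. (\<Sum>i\<in>Blk j. x {i}) = 0)" for x
    proof -
      have "?T x = (\<lambda>S. 0) \<longleftrightarrow> (\<forall>S\<in>?C. (\<Sum>i\<in>Blk (the_elem S). x {i}) = 0)"
        unfolding fun_eq_iff by (simp only: if_split Ball_def) simp
      then show ?thesis by simp
    qed
    then show ?thesis unfolding weightless_def ext_grade_1_supported by simp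
  qed
  have card: "card ?C = card cen" by (rule card_image) simp
  have "vectorspace.dim class_ring (ext_subspace n (supported_on ?N :: (nat set \<Rightarrow> 'k) set)) = card ?N"
    by (rule dim_supported_on(2)[OF fin(1)])
  moreover have "vectorspace.dim class_ring (ext_subspace n (supported_on ?C :: (nat set \<Rightarrow> 'k) set)) = card ?C"
    by (rule dim_supported_on(2)) (use fin in simp)
  ultimately show ?thesis
    using rank_nullity_ext_subspace[OF lin fin(1)] unfolding surj ker card ext_grade_1_supported by simp
qed

end

section \<open>Dimensions of subspaces\<close>

definition linear_subspace :: "nat \<Rightarrow> 'a::field vec set \<Rightarrow> bool" where
  "linear_subspace l W \<longleftrightarrow> W \<subseteq> carrier_vec l \<and> 0\<^sub>v l \<in> W \<and>
     (\<forall>u\<in>W. \<forall>v\<in>W. u + v \<in> W) \<and> (\<forall>c. \<forall>u\<in>W. c \<cdot>\<^sub>v u \<in> W)"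

definition subspace_dim :: "nat \<Rightarrow> 'a::field vec set \<Rightarrow> nat" where
  "subspace_dim l W = vectorspace.dim class_ring (module_vec TYPE('a) l\<lparr>carrier := W\<rparr>)"

lemma linear_subspaceD:
  assumes "linear_subspace l W"
  shows "W \<subseteq> carrier_vec l" "0\<^sub>v l \<in> W" "u \<in> W \<Longrightarrow> v \<in> W \<Longrightarrow> u + v \<in> W" "u \<in> W \<Longrightarrow> c \<cdot>\<^sub>v u \<in> W"
  using assms unfolding linear_subspace_def by blast+

context vec_space
begin

lemma linear_subspace_iff: "linear_subspace n (W :: 'a vec set) \<Longrightarrow> VectorSpace.subspace class_ring W V"
proof -
  assume W: "linear_subspace n W"
  have "submodule class_ring W V"
    by (intro submodule.intro module_axioms) (use W in \<open>auto simp: linear_subspace_def module_vec_simps\<close>)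
  then show ?thesis by (intro VectorSpace.subspace.intro vectorspace_axioms)
qed

text \<open>A basis of the subspace is a maximal linearly independent subset; being independent in the
  subspace and in the ambient space is the same.\<close>

lemma linear_subspace_basis:
  assumes W: "linear_subspace n (W :: 'a vec set)"
  obtains b where "finite b" "b \<subseteq> W" "lin_indpt b" "span b = W" "card b = subspace_dim n W"
    "vectorspace.basis class_ring (vs W) b"
proof -
  have sub: "VectorSpace.subspace class_ring W V" by (rule linear_subspace_iff[OF W])
  then have sm: "submodule class_ring W V" by (rule VectorSpace.subspace.submod)
  interpret Wv: vectorspace class_ring "vs W" by (rule subspace_is_vs[OF sub])
  have Wc: "W \<subseteq> carrier_vec n" using linear_subspaceD[OF W] by blast
  have li: "Wv.lin_indpt S \<longleftrightarrow> lin_indpt S" if "S \<subseteq> W" for S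
    using span_li_not_depend(2)[OF that sm] by simp
  have "\<exists>b. finite b \<and> maximal b (\<lambda>S. S \<subseteq> carrier (vs W) \<and> Wv.lin_indpt S)"
  proof (rule maximal_exists[of _ n "{}"])
    fix S assume "S \<subseteq> carrier (vs W) \<and> Wv.lin_indpt S"
    then have "S \<subseteq> carrier_vec n" "lin_indpt S" using Wc li by auto
    then show "finite S \<and> card S \<le> n" using li_le_dim[OF fin_dim] dim_is_n by auto
  next
    show "{} \<subseteq> carrier (vs W) \<and> Wv.lin_indpt {}" using Wv.lin_dep_def by auto
  qed
  then obtain b where b: "finite b" "maximal b (\<lambda>S. S \<subseteq> carrier (vs W) \<and> Wv.lin_indpt S)" by blast
  have basis: "Wv.basis b" by (rule Wv.max_li_is_basis[OF b(2)])
  have bW: "b \<subseteq> W" "Wv.lin_indpt b" using b(2) unfolding maximal_def by auto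
  have "Wv.span b = W" using basis unfolding Wv.basis_def by simp
  moreover have "Wv.span b = span b" using span_li_not_depend(1)[OF bW(1) sm] by simp
  moreover have "card b = subspace_dim n W"
    unfolding subspace_dim_def using Wv.dim_basis[OF b(1) basis] by simp
  ultimately show thesis using that[OF b(1) bW(1)] li[OF bW(1)] bW(2) basis by simp
qed

lemma subspace_dim_carrier: "subspace_dim n (carrier_vec n :: 'a vec set) = n"
proof -
  have "V\<lparr>carrier := carrier_vec n\<rparr> = V" by (simp add: module_vec_def)
  then show ?thesis unfolding subspace_dim_def using dim_is_n by metis
qed

lemma subspace_dim_zero_iff:
  assumes W: "linear_subspace n (W :: 'a vec set)"
  shows "subspace_dim n W = 0 \<longleftrightarrow> W = {0\<^sub>v n}"
proof -
  obtain b where b: "finite b" "b \<subseteq> W" "lin_indpt b" "span b = W" "card b = subspace_dim n W"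
    by (rule linear_subspace_basis[OF W])
  show ?thesis
  proof
    assume "subspace_dim n W = 0"
    then have "b = {}" using b by simp
    then show "W = {0\<^sub>v n}" using b(4) span_empty by simp
  next
    assume "W = {0\<^sub>v n}"
    moreover have "0\<^sub>v n \<notin> b" using vs_zero_lin_dep[of b] b linear_subspaceD(1)[OF W] by auto
    ultimately have "b = {}" using b(2) by auto
    then show "subspace_dim n W = 0" using b(5) by simp
  qed
qed

text \<open>The columns of \<open>B\<close> are a basis of \<open>W\<close>.\<close>

lemma subspace_parametrization:
  assumes W: "linear_subspace n (W :: 'a vec set)"
  obtains B where "B \<in> carrier_mat n (subspace_dim n W)"
    "W = (\<lambda>u. B *\<^sub>v u) ` carrier_vec (subspace_dim n W)"
    "\<forall>u\<in>carrier_vec (subspace_dim n W). B *\<^sub>v u = 0\<^sub>v n \<longrightarrow> u = 0\<^sub>v (subspace_dim n W)"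
proof -
  obtain b where b: "finite b" "b \<subseteq> W" "lin_indpt b" "span b = W" "card b = subspace_dim n W"
    by (rule linear_subspace_basis[OF W])
  obtain bs where bs: "set bs = b" "distinct bs" using finite_distinct_list[OF b(1)] by blast
  let ?k = "subspace_dim n W"
  have len: "length bs = ?k" using bs b(5) distinct_card by fastforce
  have bc: "set bs \<subseteq> carrier_vec n" using bs b(2) linear_subspaceD(1)[OF W] by blast
  let ?B = "mat_of_cols n bs"
  have B: "?B \<in> carrier_mat n ?k" using mat_of_cols_carrier(1)[of n bs] unfolding len .
  have lincomb: "?B *\<^sub>v u = lincomb (\<lambda>v. sum (\<lambda>i. if v = bs ! i then u $ i else 0) {0..<length bs}) b"
    if "u \<in> carrier_vec ?k" for u
    using mat_of_cols_mult_as_finsum[of u bs] that len bc bs(1) nth_mem[of _ bs] by auto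
  have coeff: "sum (\<lambda>i. if bs ! k = bs ! i then u $ i else 0) {0..<length bs} = u $ k" if "k < length bs" for k and u :: "'a vec"
  proof -
    have "sum (\<lambda>i. if bs ! k = bs ! i then u $ i else 0) {0..<length bs} = sum (\<lambda>i. if k = i then u $ i else 0) {0..<length bs}"
      using that bs(2) by (intro sum.cong) (auto simp: nth_eq_iff_index_eq)
    then show ?thesis using that by simp
  qed
  have img: "W = (\<lambda>u. ?B *\<^sub>v u) ` carrier_vec ?k"
  proof
    show "(\<lambda>u. ?B *\<^sub>v u) ` carrier_vec ?k \<subseteq> W"
    proof
      fix w assume "w \<in> (\<lambda>u. ?B *\<^sub>v u) ` carrier_vec ?k"
      then obtain u where "u \<in> carrier_vec ?k" "w = ?B *\<^sub>v u" by blast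
      then have "w \<in> span b" unfolding span_def using lincomb b(1) by blast
      then show "w \<in> W" using b(4) by simp
    qed
    show "W \<subseteq> (\<lambda>u. ?B *\<^sub>v u) ` carrier_vec ?k"
    proof
      fix w assume "w \<in> W"
      then obtain a where a: "w = lincomb a b" using b(4) finite_in_span[OF b(1), of w] bc bs(1) by auto
      let ?u = "vec ?k (\<lambda>i. a (bs ! i))"
      have "?B *\<^sub>v ?u = lincomb (\<lambda>v. sum (\<lambda>i. if v = bs ! i then ?u $ i else 0) {0..<length bs}) b"
        by (rule lincomb) simp
      also have "\<dots> = lincomb a b"
      proof (rule lincomb_cong[OF refl])
        fix v assume "v \<in> b"
        then obtain k where "k < length bs" "v = bs ! k" using bs(1) by (metis in_set_conv_nth)
        then show "sum (\<lambda>i. if v = bs ! i then ?u $ i else 0) {0..<length bs} = a v"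
          using coeff[of k ?u] len by simp
      qed (use bc bs(1) in auto)
      finally show "w \<in> (\<lambda>u. ?B *\<^sub>v u) ` carrier_vec ?k" using a by (metis imageI vec_carrier)
    qed
  qed
  have inj: "u = 0\<^sub>v ?k" if u: "u \<in> carrier_vec ?k" "?B *\<^sub>v u = 0\<^sub>v n" for u
  proof (rule eq_vecI)
    fix k assume "k < dim_vec (0\<^sub>v ?k :: 'a vec)"
    then have k: "k < length bs" using len by simp
    let ?a = "\<lambda>v. sum (\<lambda>i. if v = bs ! i then u $ i else 0) {0..<length bs}"
    have "lincomb ?a b = 0\<^sub>v n" using lincomb[OF u(1)] u(2) by simp
    then have "?a v = 0" if "v \<in> b" for v
      using not_lindepD[OF b(3) b(1) subset_refl, of ?a] that by auto
    then have "?a (bs ! k) = 0" using k bs(1) by auto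
    then show "u $ k = 0\<^sub>v ?k $ k" using coeff[OF k, of u] k len by simp
  qed (use u in auto)
  show thesis by (rule that[OF B img]) (use inj in blast)
qed

text \<open>A linear functional has rank zero or one, and rank and nullity apply.\<close>

lemma subspace_dim_kernel:
  assumes W: "linear_subspace n (W :: 'a vec set)" and a: "a \<in> carrier_vec n"
  shows "subspace_dim n W = subspace_dim n {v \<in> W. a \<bullet> v = 0} + (if \<forall>v\<in>W. a \<bullet> v = 0 then 0 else 1)"
proof -
  interpret One: vec_space "TYPE('a)" 1 .
  interpret Wv: vectorspace class_ring "vs W" by (rule subspace_is_vs[OF linear_subspace_iff[OF W]])
  let ?T = "\<lambda>v. vec 1 (\<lambda>_. a \<bullet> v)"
  have Wc: "w \<in> carrier_vec n" if "w \<in> W" for w using linear_subspaceD(1)[OF W] that by blast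
  have hom: "?T \<in> LinearCombinations.module_hom class_ring (vs W) One.V"
    unfolding LinearCombinations.module_hom_def
    using a Wc by (auto simp: module_vec_simps scalar_prod_add_distrib[of a n])
  interpret T: linear_map class_ring "vs W" One.V ?T
    using hom by unfold_locales
  obtain b where b: "finite b" "b \<subseteq> W" "lin_indpt b" "span b = W" "card b = subspace_dim n W"
    "Wv.basis b" by (rule linear_subspace_basis[OF W])
  have fd: "Wv.fin_dim" unfolding Wv.fin_dim_def using b(1,6) unfolding Wv.basis_def by blast
  have ker: "T.kerT = {v \<in> W. a \<bullet> v = 0}" unfolding T.ker_def by (auto simp: module_vec_simps dest: arg_cong[of _ _ "\<lambda>v. v $ 0"])
  have imT: "T.imT = ?T ` W" unfolding T.im_def by simp
  have im: "vectorspace.dim class_ring (One.V\<lparr>carrier := T.imT\<rparr>) = (if \<forall>v\<in>W. a \<bullet> v = 0 then 0 else 1)"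
  proof (cases "\<forall>v\<in>W. a \<bullet> v = 0")
    case True
    have "T.imT = {0\<^sub>v 1}"
    proof -
      have "?T v = 0\<^sub>v 1" if "v \<in> W" for v using True that by (intro eq_vecI) auto
      then show ?thesis unfolding imT using linear_subspaceD(2)[OF W] by (force simp: image_iff)
    qed
    moreover have "linear_subspace 1 {0\<^sub>v 1 :: 'a vec}" unfolding linear_subspace_def by auto
    ultimately show ?thesis
      using One.subspace_dim_zero_iff[of "{0\<^sub>v 1}"] True unfolding subspace_dim_def by simp
  next
    case False
    then obtain w where w: "w \<in> W" "a \<bullet> w \<noteq> 0" by blast
    have "carrier_vec 1 \<subseteq> T.imT"
    proof
      fix z :: "'a vec" assume z: "z \<in> carrier_vec 1"
      let ?v = "(z $ 0 / (a \<bullet> w)) \<cdot>\<^sub>v w"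
      have "?v \<in> W" by (rule linear_subspaceD(4)[OF W w(1)])
      moreover have "?T ?v = z" using z w a Wc[OF w(1)] by (intro eq_vecI) auto
      ultimately show "z \<in> T.imT" unfolding imT by (intro image_eqI[of z ?T ?v]) simp_all
    qed
    moreover have "T.imT \<subseteq> carrier_vec 1" unfolding imT by auto
    ultimately have "T.imT = carrier_vec 1" by blast
    then show ?thesis using One.subspace_dim_carrier False unfolding subspace_dim_def by simp
  qed
  have "(if \<forall>v\<in>W. a \<bullet> v = 0 then 0 else 1) + subspace_dim n {v \<in> W. a \<bullet> v = 0} = subspace_dim n W"
    using T.rank_nullity[OF fd] unfolding im ker subspace_dim_def by simp
  then show ?thesis by simp
qed

end

section \<open>Systems of hyperplanes\<close>

text \<open>An arrangement with its hyperplanes numbered by \<open>Ix\<close>. The numbers are kept for the factors of an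
  arrangement, so they need not be an initial segment.\<close>

locale hyperplane_system =
  fixes l :: nat and Ix :: "nat set" and G :: "nat \<Rightarrow> complex vec set"
  assumes finite_Ix: "finite Ix"
    and hyp: "i \<in> Ix \<Longrightarrow> hyperplane l (G i)"
    and inj_G: "inj_on G Ix"
begin

definition normal_vec :: "nat \<Rightarrow> complex vec" where
  "normal_vec i = (SOME a. a \<in> carrier_vec l \<and> a \<noteq> 0\<^sub>v l \<and> (\<exists>c. G i = {v \<in> carrier_vec l. a \<bullet> v = c}))"

definition offset :: "nat \<Rightarrow> complex" where
  "offset i = (SOME c. G i = {v \<in> carrier_vec l. normal_vec i \<bullet> v = c})"

lemma normal_vec:
  assumes "i \<in> Ix"
  shows "normal_vec i \<in> carrier_vec l" "normal_vec i \<noteq> 0\<^sub>v l" "G i = {v \<in> carrier_vec l. normal_vec i \<bullet> v = offset i}"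
proof -
  have "\<exists>a. a \<in> carrier_vec l \<and> a \<noteq> 0\<^sub>v l \<and> (\<exists>c. G i = {v \<in> carrier_vec l. a \<bullet> v = c})"
    using hyp[OF assms] unfolding hyperplane_def by blast
  from someI_ex[OF this] have n: "normal_vec i \<in> carrier_vec l" "normal_vec i \<noteq> 0\<^sub>v l"
    "\<exists>c. G i = {v \<in> carrier_vec l. normal_vec i \<bullet> v = c}"
    unfolding normal_vec_def by blast+
  then show "normal_vec i \<in> carrier_vec l" "normal_vec i \<noteq> 0\<^sub>v l" by blast+
  show "G i = {v \<in> carrier_vec l. normal_vec i \<bullet> v = offset i}"
    unfolding offset_def by (rule someI_ex[OF n(3)])
qed

text \<open>For a set \<open>S\<close> of indices: \<open>sys S\<close> is the intersection of the hyperplanes, \<open>dirs S\<close> the space of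
  directions common to all of them, \<open>lin S\<close> the rank of their normal vectors. Unlike the codimension of
  \<open>sys S\<close>, the last two make sense for empty intersections as well.\<close>

definition sys :: "nat set \<Rightarrow> complex vec set" where
  "sys S = {v \<in> carrier_vec l. \<forall>i\<in>S. v \<in> G i}"

definition dirs :: "nat set \<Rightarrow> complex vec set" where
  "dirs S = {v \<in> carrier_vec l. \<forall>i\<in>S. normal_vec i \<bullet> v = 0}"

definition lin :: "nat set \<Rightarrow> nat" where
  "lin S = l - subspace_dim l (dirs S)"

definition cmp :: "nat set \<Rightarrow> bool" where
  "cmp S \<longleftrightarrow> sys S \<noteq> {}"

definition cl :: "nat set \<Rightarrow> nat set" where
  "cl S = {e \<in> Ix. sys S \<subseteq> G e}"

lemma intersection_image: "intersection l (G ` S) = sys S"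
  unfolding intersection_def sys_def by auto

lemma sys_iff: "S \<subseteq> Ix \<Longrightarrow> v \<in> sys S \<longleftrightarrow> v \<in> carrier_vec l \<and> (\<forall>i\<in>S. normal_vec i \<bullet> v = offset i)"
  unfolding sys_def using normal_vec(3) by auto

lemma mem_G_iff: "i \<in> Ix \<Longrightarrow> v \<in> G i \<longleftrightarrow> v \<in> carrier_vec l \<and> normal_vec i \<bullet> v = offset i"
  using normal_vec(3)[of i] by auto

lemma dirs_subspace: "S \<subseteq> Ix \<Longrightarrow> linear_subspace l (dirs S)"
  unfolding linear_subspace_def dirs_def using normal_vec(1)
  by (auto simp: subset_iff scalar_prod_add_distrib[of _ l])

lemma dirs_insert: "dirs (insert i S) = {v \<in> dirs S. normal_vec i \<bullet> v = 0}"
  unfolding dirs_def by auto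

lemma sys_mono: "S \<subseteq> T \<Longrightarrow> sys T \<subseteq> sys S" and dirs_mono: "S \<subseteq> T \<Longrightarrow> dirs T \<subseteq> dirs S"
  unfolding sys_def dirs_def by auto

lemma cmp_mono: "cmp T \<Longrightarrow> S \<subseteq> T \<Longrightarrow> cmp S"
  unfolding cmp_def using sys_mono by blast

lemma cmp_empty: "cmp {}"
proof -
  have "0\<^sub>v l \<in> sys {}" unfolding sys_def by simp
  then show ?thesis unfolding cmp_def by blast
qed

lemma sys_add_dirs:
  assumes "S \<subseteq> Ix" "p \<in> sys S" "v \<in> dirs S" shows "p + v \<in> sys S"
proof -
  have "normal_vec i \<bullet> (p + v) = offset i" if "i \<in> S" for i
    using assms that normal_vec(1)[of i] sys_iff[OF assms(1), of p]
    by (auto simp: dirs_def scalar_prod_add_distrib[of _ l])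
  then show ?thesis using assms sys_iff[OF assms(1)] by (simp add: dirs_def)
qed

lemma sys_diff:
  assumes "S \<subseteq> Ix" "p \<in> sys S" "q \<in> sys S" shows "p - q \<in> dirs S"
proof -
  have "normal_vec i \<bullet> (p - q) = 0" if "i \<in> S" for i
    using assms that normal_vec(1)[of i] sys_iff[OF assms(1)]
    by (auto simp: scalar_prod_minus_distrib[of _ l])
  then show ?thesis using assms sys_iff[OF assms(1)] by (simp add: dirs_def)
qed

lemma subspace_dim_dirs_le: "S \<subseteq> Ix \<Longrightarrow> subspace_dim l (dirs S) \<le> l"
proof -
  assume S: "S \<subseteq> Ix"
  then have "finite S" using finite_Ix finite_subset by blast
  then show ?thesis using S
  proof (induction S rule: finite_induct)
    case empty
    have "dirs {} = carrier_vec l" unfolding dirs_def by simp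
    then show ?case using vec_space.subspace_dim_carrier[of l, where 'a = complex] by simp
  next
    case (insert i S)
    then show ?case
      using vec_space.subspace_dim_kernel[OF dirs_subspace normal_vec(1), of S i] unfolding dirs_insert by auto
  qed
qed

lemma lin_empty: "lin {} = 0"
proof -
  have "dirs {} = carrier_vec l" unfolding dirs_def by simp
  then show ?thesis unfolding lin_def using vec_space.subspace_dim_carrier[of l, where 'a = complex] by simp
qed

lemma lin_le: "lin S \<le> l" unfolding lin_def by simp

lemma lin_insert:
  assumes "S \<subseteq> Ix" "i \<in> Ix"
  shows "lin (insert i S) = lin S + (if \<forall>v\<in>dirs S. normal_vec i \<bullet> v = 0 then 0 else 1)"
  using vec_space.subspace_dim_kernel[OF dirs_subspace normal_vec(1), of S i] assms
    subspace_dim_dirs_le[OF assms(1)]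
  unfolding lin_def dirs_insert by auto

lemma cl_dirs:
  assumes "S \<subseteq> Ix" "cmp S" "e \<in> cl S" "v \<in> dirs S"
  shows "normal_vec e \<bullet> v = 0"
proof -
  obtain p where p: "p \<in> sys S" using assms(2) unfolding cmp_def by blast
  have e: "e \<in> Ix" "sys S \<subseteq> G e" using assms(3) unfolding cl_def by auto
  have "p \<in> G e" "p + v \<in> G e" using sys_add_dirs[OF assms(1) p assms(4)] p e(2) by auto
  moreover have "v \<in> carrier_vec l" using assms(4) by (simp add: dirs_def)
  ultimately show ?thesis using mem_G_iff[OF e(1)] normal_vec(1)[OF e(1)]
    by (simp add: scalar_prod_add_distrib[of _ l])
qed

lemma cmp_insert_cl: "cmp S \<Longrightarrow> e \<in> cl S \<Longrightarrow> cmp (insert e S)"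
  unfolding cmp_def cl_def sys_def by blast

text \<open>Moving a point of the intersection along \<open>v\<close> reaches the hyperplane, since its defining function is not
  constant in this direction.\<close>

lemma cmp_insert_transversal:
  assumes "S \<subseteq> Ix" "cmp S" "e \<in> Ix" "v \<in> dirs S" "normal_vec e \<bullet> v \<noteq> 0"
  shows "cmp (insert e S)"
proof -
  obtain p where p: "p \<in> sys S" using assms(2) unfolding cmp_def by blast
  have c: "p \<in> carrier_vec l" "v \<in> carrier_vec l" using p assms(4) unfolding sys_def dirs_def by auto
  let ?t = "(offset e - normal_vec e \<bullet> p) / (normal_vec e \<bullet> v)"
  have "?t \<cdot>\<^sub>v v \<in> dirs S" using linear_subspaceD(4)[OF dirs_subspace[OF assms(1)] assms(4)] .
  then have q: "p + ?t \<cdot>\<^sub>v v \<in> sys S" by (rule sys_add_dirs[OF assms(1) p])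
  have "normal_vec e \<bullet> (p + ?t \<cdot>\<^sub>v v) = offset e"
    using c normal_vec(1)[OF assms(3)] assms(5) by (simp add: scalar_prod_add_distrib[of _ l])
  then have "p + ?t \<cdot>\<^sub>v v \<in> G e" using mem_G_iff[OF assms(3)] c by simp
  then show ?thesis using q unfolding cmp_def sys_def by auto
qed

lemma cl_of_cmp_insert:
  assumes "S \<subseteq> Ix" "e \<in> Ix" "cmp (insert e S)" "\<forall>v\<in>dirs S. normal_vec e \<bullet> v = 0"
  shows "e \<in> cl S"
proof -
  obtain p where p: "p \<in> sys (insert e S)" using assms(3) unfolding cmp_def by blast
  have "p \<in> sys S" "p \<in> G e" using p unfolding sys_def by auto
  have "q \<in> G e" if q: "q \<in> sys S" for q
  proof -
    have "normal_vec e \<bullet> (q - p) = 0" using sys_diff[OF assms(1) q \<open>p \<in> sys S\<close>] assms(4) by blast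
    moreover have c: "q \<in> carrier_vec l" "p \<in> carrier_vec l" using q p unfolding sys_def by auto
    ultimately have "normal_vec e \<bullet> q = offset e"
      using \<open>p \<in> G e\<close> mem_G_iff[OF assms(2)] normal_vec(1)[OF assms(2)]
      by (simp add: scalar_prod_minus_distrib[of _ l])
    then show ?thesis using mem_G_iff[OF assms(2)] c by simp
  qed
  then show ?thesis unfolding cl_def using assms(2) by blast
qed

lemma lin_insert_cmp:
  assumes "S \<subseteq> Ix" "e \<in> Ix" "cmp (insert e S)"
  shows "lin (insert e S) = lin S + (if e \<in> cl S then 0 else 1)"
proof -
  have "cmp S" using cmp_mono[OF assms(3)] by blast
  then have "(\<forall>v\<in>dirs S. normal_vec e \<bullet> v = 0) \<longleftrightarrow> e \<in> cl S"
    using cl_dirs[OF assms(1)] cl_of_cmp_insert[OF assms] by blast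
  then show ?thesis using lin_insert[OF assms(1,2)] by simp
qed

lemma sys_image_diff:
  assumes "S \<subseteq> Ix" "cmp S"
  shows "{u - v | u v. u \<in> sys S \<and> v \<in> sys S} = dirs S"
proof
  show "{u - v | u v. u \<in> sys S \<and> v \<in> sys S} \<subseteq> dirs S" using sys_diff[OF assms(1)] by blast
  show "dirs S \<subseteq> {u - v | u v. u \<in> sys S \<and> v \<in> sys S}"
  proof
    fix v assume v: "v \<in> dirs S"
    obtain p where p: "p \<in> sys S" using assms(2) unfolding cmp_def by blast
    have "p \<in> carrier_vec l" "v \<in> carrier_vec l" using p v unfolding sys_def dirs_def by auto
    then have "v = (p + v) - p" by auto
    then show "v \<in> {u - v | u v. u \<in> sys S \<and> v \<in> sys S}" using sys_add_dirs[OF assms(1) p v] p by blast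
  qed
qed

lemma aff_codim_sys: "S \<subseteq> Ix \<Longrightarrow> cmp S \<Longrightarrow> aff_codim l (sys S) = lin S"
  unfolding aff_codim_def aff_dim_def lin_def subspace_dim_def by (simp add: sys_image_diff)

lemma lin_full_iff:
  assumes "S \<subseteq> Ix" "cmp S"
  shows "lin S = l \<longleftrightarrow> (\<exists>p. sys S = {p})"
proof -
  have "lin S = l \<longleftrightarrow> subspace_dim l (dirs S) = 0"
    using subspace_dim_dirs_le[OF assms(1)] unfolding lin_def by auto
  also have "\<dots> \<longleftrightarrow> dirs S = {0\<^sub>v l}" by (rule vec_space.subspace_dim_zero_iff[OF dirs_subspace[OF assms(1)]])
  also have "\<dots> \<longleftrightarrow> (\<exists>p. sys S = {p})"
  proof
    assume d: "dirs S = {0\<^sub>v l}"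
    obtain p where p: "p \<in> sys S" using assms(2) unfolding cmp_def by blast
    have "q = p" if q: "q \<in> sys S" for q
    proof -
      have "q - p = 0\<^sub>v l" using sys_diff[OF assms(1) q p] d by blast
      moreover have "q \<in> carrier_vec l" "p \<in> carrier_vec l" using p q unfolding sys_def by auto
      ultimately show ?thesis
      proof (intro eq_vecI)
        fix k assume "k < dim_vec p"
        then have "(q - p) $ k = 0\<^sub>v l $ k" "k < l" using \<open>q - p = 0\<^sub>v l\<close> \<open>p \<in> carrier_vec l\<close> by auto
        then show "q $ k = p $ k" using \<open>q \<in> carrier_vec l\<close> \<open>p \<in> carrier_vec l\<close> by simp
      qed auto
    qed
    then show "\<exists>p. sys S = {p}" using p by blast
  next
    assume "\<exists>p. sys S = {p}"
    then obtain p where p: "sys S = {p}" by blast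
    then have "p \<in> carrier_vec l" unfolding sys_def by auto
    then have "p - p = 0\<^sub>v l" by simp
    then show "dirs S = {0\<^sub>v l}" unfolding sys_image_diff[OF assms, symmetric] p by auto
  qed
  finally show ?thesis .
qed

text \<open>For nonempty intersections, codimension \<open>l\<close> means a single point; so an arrangement is essential if
  and only if some of its hyperplanes meet in exactly one point.\<close>

lemma arr_rank_full_iff: "arr_rank l (G ` Ix) = l \<longleftrightarrow> (\<exists>S\<subseteq>Ix. \<exists>p. sys S = {p})"
proof -
  let ?X = "aff_codim l ` intersection_poset l (G ` Ix)"
  have X: "?X = lin ` {S. S \<subseteq> Ix \<and> cmp S}"
  proof -
    have "intersection_poset l (G ` Ix) = sys ` {S. S \<subseteq> Ix \<and> cmp S}"
    proof
      show "intersection_poset l (G ` Ix) \<subseteq> sys ` {S. S \<subseteq> Ix \<and> cmp S}"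
      proof
        fix X assume "X \<in> intersection_poset l (G ` Ix)"
        then obtain S where S: "X = intersection l S" "S \<subseteq> G ` Ix" "intersection l S \<noteq> {}"
          unfolding intersection_poset_def by blast
        then obtain S' where S': "S' \<subseteq> Ix" "S = G ` S'" unfolding subset_image_iff by blast
        then have "X = sys S'" "cmp S'" using S intersection_image unfolding cmp_def by simp_all
        then show "X \<in> sys ` {S. S \<subseteq> Ix \<and> cmp S}" using S'(1) by blast
      qed
      show "sys ` {S. S \<subseteq> Ix \<and> cmp S} \<subseteq> intersection_poset l (G ` Ix)"
      proof
        fix X assume "X \<in> sys ` {S. S \<subseteq> Ix \<and> cmp S}"
        then obtain S where S: "S \<subseteq> Ix" "cmp S" "X = sys S" by blast
        then show "X \<in> intersection_poset l (G ` Ix)"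
          unfolding intersection_poset_def cmp_def intersection_image[of S, symmetric]
          by (intro CollectI exI[of _ "G ` S"]) auto
      qed
    qed
    then have "?X = (\<lambda>S. aff_codim l (sys S)) ` {S. S \<subseteq> Ix \<and> cmp S}" by (simp only: image_image)
    also have "\<dots> = lin ` {S. S \<subseteq> Ix \<and> cmp S}" by (rule image_cong) (simp_all add: aff_codim_sys)
    finally show ?thesis .
  qed
  have fin: "finite ?X" unfolding X using finite_Ix by (intro finite_imageI) simp
  have "{} \<in> {S. S \<subseteq> Ix \<and> cmp S}" using cmp_empty by simp
  then have ne: "?X \<noteq> {}" unfolding X by blast
  have "arr_rank l (G ` Ix) = l \<longleftrightarrow> l \<in> ?X"
    unfolding arr_rank_def
  proof
    assume "Max ?X = l" then show "l \<in> ?X" using Max_in[OF fin ne] by simp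
  next
    assume "l \<in> ?X"
    then show "Max ?X = l" unfolding X using lin_le fin[unfolded X] by (intro Max_eqI) auto
  qed
  also have "\<dots> \<longleftrightarrow> (\<exists>S\<subseteq>Ix. \<exists>p. sys S = {p})"
  proof
    assume "l \<in> ?X"
    then obtain S where S: "S \<subseteq> Ix" "cmp S" "lin S = l" unfolding X by auto
    from S(3) have "\<exists>p. sys S = {p}" unfolding lin_full_iff[OF S(1,2)] .
    then show "\<exists>S\<subseteq>Ix. \<exists>p. sys S = {p}" using S(1) by blast
  next
    assume "\<exists>S\<subseteq>Ix. \<exists>p. sys S = {p}"
    then obtain S p where S: "S \<subseteq> Ix" "sys S = {p}" by blast
    then have "cmp S" unfolding cmp_def by simp
    then have "lin S = l" using lin_full_iff[OF S(1)] S(2) by blast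
    then show "l \<in> ?X" unfolding X using S(1) \<open>cmp S\<close> by (intro image_eqI[of _ _ S]) simp_all
  qed
  finally show ?thesis .
qed

lemma lin_mono: "S \<subseteq> T \<Longrightarrow> T \<subseteq> Ix \<Longrightarrow> lin S \<le> lin T"
proof -
  assume ST: "S \<subseteq> T" "T \<subseteq> Ix"
  then have "finite T" using finite_Ix finite_subset by blast
  have "lin S \<le> lin (S \<union> D)" if "finite D" "D \<subseteq> T" for D
    using that
  proof (induction D rule: finite_induct)
    case (insert d D)
    then have "lin (S \<union> D) \<le> lin (insert d (S \<union> D))" using lin_insert[of "S \<union> D" d] ST by fastforce
    then show ?case using insert by simp
  qed simp
  from this[of T] show ?thesis using ST \<open>finite T\<close> by (simp add: Un_absorb1)
qed

lemma lin_le_card: "S \<subseteq> Ix \<Longrightarrow> lin S \<le> card S"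
proof -
  assume S: "S \<subseteq> Ix"
  then have "finite S" using finite_Ix finite_subset by blast
  then show ?thesis using S
  proof (induction S rule: finite_induct)
    case (insert i S)
    then show ?case using lin_insert[of S i] by auto
  qed (simp add: lin_empty)
qed

lemma cl_mono: "S \<subseteq> T \<Longrightarrow> cl S \<subseteq> cl T"
  unfolding cl_def using sys_mono by blast

lemma dependent_iff_lin:
  assumes "S \<subseteq> Ix"
  shows "dependent l (G ` S) \<longleftrightarrow> cmp S \<and> lin S < card S"
proof -
  have "card (G ` S) = card S" by (rule card_image[OF inj_on_subset[OF inj_G assms]])
  then show ?thesis
    unfolding dependent_def intersection_image cmp_def[symmetric] using aff_codim_sys[OF assms] by auto
qed

text \<open>Along an enumeration of \<open>S\<close>, the rank goes up at each step exactly when each new hyperplane does not contain the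
  intersection of the previous ones.\<close>

lemma dependent_iff_cl:
  assumes S: "S \<subseteq> Ix"
  shows "dependent l (G ` S) \<longleftrightarrow> cmp S \<and> (\<exists>e\<in>S. e \<in> cl (S - {e}))"
proof -
  have fin: "finite S" using S finite_Ix finite_subset by blast
  have "lin S = card S" if cmp: "cmp S" and ind: "\<forall>e\<in>S. e \<notin> cl (S - {e})"
  proof -
    have "lin T = card T" if "finite T" "T \<subseteq> S" for T
      using that
    proof (induction T rule: finite_induct)
      case (insert e T)
      have "cl T \<subseteq> cl (S - {e})" by (rule cl_mono) (use insert in auto)
      then have "e \<notin> cl T" using ind insert.prems by blast
      moreover have "cmp (insert e T)" using cmp_mono[OF cmp insert.prems] .
      ultimately show ?case using lin_insert_cmp[of T e] insert S by auto
    qed (simp add: lin_empty)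
    then show ?thesis using fin by blast
  qed
  moreover have "lin S < card S" if cmp: "cmp S" and e: "e \<in> S" "e \<in> cl (S - {e})" for e
  proof -
    have eq: "insert e (S - {e}) = S" using e(1) by blast
    have "lin S = lin (S - {e})" using lin_insert_cmp[of "S - {e}" e] e S cmp unfolding eq by auto
    also have "\<dots> \<le> card (S - {e})" by (rule lin_le_card) (use S in auto)
    also have "\<dots> < card S" using e fin by (intro card_Diff1_less)
    finally show ?thesis .
  qed
  ultimately show ?thesis unfolding dependent_iff_lin[OF S] by (metis less_irrefl)
qed

lemma G_proper:
  assumes "i \<in> Ix" shows "\<not> carrier_vec l \<subseteq> G i"
proof
  assume all: "carrier_vec l \<subseteq> G i"
  then have "normal_vec i \<bullet> v = offset i" if "v \<in> carrier_vec l" for v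
    using mem_G_iff[OF assms] that by blast
  from this[of "0\<^sub>v l"] this have z: "normal_vec i \<bullet> v = 0" if "v \<in> carrier_vec l" for v
    using that normal_vec(1)[OF assms] by simp
  have "normal_vec i $ k = 0" if "k < l" for k
    using z[of "unit_vec l k"] that normal_vec(1)[OF assms] by (simp add: scalar_prod_right_unit)
  then have "normal_vec i = 0\<^sub>v l" using normal_vec(1)[OF assms] by (intro eq_vecI) auto
  then show False using normal_vec(2)[OF assms] by simp
qed

subsection \<open>The rank function of the cone\<close>

text \<open>Element \<open>0\<close> is the hyperplane at infinity, and \<open>Suc i\<close> is the cone over \<open>G i\<close>.\<close>

definition finite_part :: "nat set \<Rightarrow> nat set" where
  "finite_part S = {i. Suc i \<in> S}"

text \<open>A set that contains the hyperplane at infinity, or whose finite part has empty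
  intersection, has the linear functional at infinity in the span of its equations; the rank is then one more than
  that of the normal vectors.\<close>

definition cone_rank :: "nat set \<Rightarrow> nat" where
  "cone_rank S = lin (finite_part S) + (if 0 \<in> S \<or> \<not> cmp (finite_part S) then 1 else 0)"

definition cone_ground :: "nat set" where
  "cone_ground = insert 0 (Suc ` Ix)"

lemma finite_part_simps [simp]:
  "finite_part (insert 0 S) = finite_part S"
  "finite_part (insert (Suc i) S) = insert i (finite_part S)"
  "finite_part (Suc ` X) = X" "finite_part {} = {}"
  unfolding finite_part_def by auto

lemma finite_part_subset: "S \<subseteq> cone_ground \<Longrightarrow> finite_part S \<subseteq> Ix"
  unfolding finite_part_def cone_ground_def by auto

text \<open>Membership in the closure of \<open>S\<close> in the matroid of the cone. If infinity is in the closure of \<open>S\<close>, then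
  only the normal vector of \<open>e\<close> matters; otherwise \<open>e\<close> has to contain the nonempty intersection of
  the finite part.\<close>

definition cone_cl :: "nat \<Rightarrow> nat set \<Rightarrow> bool" where
  "cone_cl e S = (if 0 \<in> S \<or> \<not> cmp (finite_part S)
     then e = 0 \<or> (\<forall>v\<in>dirs (finite_part S). normal_vec (e - 1) \<bullet> v = 0)
     else e \<noteq> 0 \<and> e - 1 \<in> cl (finite_part S))"

lemma cone_rank_insert:
  assumes S: "S \<subseteq> cone_ground" and e: "e \<in> cone_ground"
  shows "cone_rank (insert e S) = cone_rank S + (if cone_cl e S then 0 else 1)"
proof (cases e)
  case 0
  then show ?thesis by (simp add: cone_rank_def cone_cl_def)
next
  case (Suc i)
  let ?S = "finite_part S"
  have i: "i \<in> Ix" using e Suc unfolding cone_ground_def by auto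
  have sub: "?S \<subseteq> Ix" by (rule finite_part_subset[OF S])
  show ?thesis
  proof (cases "0 \<in> S \<or> \<not> cmp ?S")
    case True
    then have "0 \<in> S \<or> \<not> cmp (insert i ?S)" using cmp_mono by blast
    then show ?thesis using True lin_insert[OF sub i] Suc by (simp add: cone_rank_def cone_cl_def)
  next
    case False
    then have cmp: "cmp ?S" "0 \<notin> S" by auto
    show ?thesis
    proof (cases "i \<in> cl ?S")
      case True
      then have "cmp (insert i ?S)" using cmp_insert_cl cmp(1) by blast
      then show ?thesis using True lin_insert_cmp[OF sub i] Suc cmp by (simp add: cone_rank_def cone_cl_def)
    next
      case ncl: False
      show ?thesis
      proof (cases "cmp (insert i ?S)")
        case True
        then show ?thesis using ncl lin_insert_cmp[OF sub i] Suc cmp by (simp add: cone_rank_def cone_cl_def)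
      next
        case False
        then have "\<forall>v\<in>dirs ?S. normal_vec i \<bullet> v = 0" using cmp_insert_transversal[OF sub cmp(1) i] by blast
        then show ?thesis using False ncl lin_insert[OF sub i] Suc cmp by (simp add: cone_rank_def cone_cl_def)
      qed
    qed
  qed
qed

lemma cone_cl_mono:
  assumes "S \<subseteq> T" "T \<subseteq> cone_ground" "cone_cl e S"
  shows "cone_cl e T"
proof -
  let ?S = "finite_part S" and ?T = "finite_part T"
  have sub: "?S \<subseteq> ?T" "?S \<subseteq> Ix" using assms(1) finite_part_subset[OF assms(2)] unfolding finite_part_def by auto
  show ?thesis
  proof (cases "0 \<in> S \<or> \<not> cmp ?S")
    case True
    then have "0 \<in> T \<or> \<not> cmp ?T" using assms(1) cmp_mono[of ?T ?S] sub by blast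
    then show ?thesis using assms(3) True dirs_mono[OF sub(1)] unfolding cone_cl_def by auto
  next
    case False
    then have e: "e \<noteq> 0" "e - 1 \<in> cl ?S" using assms(3) unfolding cone_cl_def by auto
    then have "\<forall>v\<in>dirs ?T. normal_vec (e - 1) \<bullet> v = 0"
      using cl_dirs[OF sub(2) _ e(2)] False dirs_mono[OF sub(1)] by blast
    moreover have "e - 1 \<in> cl ?T" using cl_mono[OF sub(1)] e(2) by blast
    ultimately show ?thesis using e(1) unfolding cone_cl_def by simp
  qed
qed

text \<open>The rank increases by one exactly outside of the closure, and closures are monotone.\<close>

lemma matroid_rank_cone: "matroid_rank cone_ground cone_rank"
  unfolding matroid_rank_def
proof (intro conjI allI impI)
  show "cone_rank {} = 0" by (simp add: cone_rank_def lin_empty cmp_empty)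
  fix S e assume "S \<subseteq> cone_ground \<and> e \<in> cone_ground"
  then show "cone_rank S \<le> cone_rank (insert e S)" "cone_rank (insert e S) \<le> cone_rank S + 1"
    using cone_rank_insert[of S e] by auto
next
  fix S T e
  assume *: "S \<subseteq> T \<and> T \<subseteq> cone_ground \<and> e \<in> cone_ground \<and> cone_rank (insert e S) = cone_rank S"
  then have S: "S \<subseteq> cone_ground" by blast
  have "cone_cl e S" using * cone_rank_insert[OF S, of e] by (auto split: if_splits)
  then have "cone_cl e T" using cone_cl_mono * by blast
  then show "cone_rank (insert e T) = cone_rank T" using cone_rank_insert[of T e] * by auto
qed

end

section \<open>Irreducible arrangements have connected matroids\<close>

lemma invertible_mat_of_injective:
  assumes M: "(M :: 'a::field mat) \<in> carrier_mat l l"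
    and inj: "\<And>v. v \<in> carrier_vec l \<Longrightarrow> M *\<^sub>v v = 0\<^sub>v l \<Longrightarrow> v = 0\<^sub>v l"
  obtains N where "N \<in> carrier_mat l l" "M * N = 1\<^sub>m l" "N * M = 1\<^sub>m l" "invertible_mat N"
proof -
  have "det M \<noteq> 0" using det_0_iff_vec_prod_zero_field[OF M] inj by blast
  from det_non_zero_imp_unit[OF M this, of "()"]
  obtain N where N: "N * M = 1\<^sub>m l" "M * N = 1\<^sub>m l" "N \<in> carrier_mat l l"
    unfolding Units_def ring_mat_def by auto
  have "invertible_mat N"
    unfolding invertible_mat_def inverts_mat_def square_mat.simps using N M by auto
  then show thesis using that N by blast
qed

lemma arrangement_of_point:
  fixes X :: "nat set"
  assumes "finite X" "\<And>i. i \<in> X \<Longrightarrow> hyperplane m (H i)" "inj_on H X"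
    and "S \<subseteq> X" "{u \<in> carrier_vec m. \<forall>i\<in>S. u \<in> H i} = {p}"
  shows "arrangement m (H ` X)"
proof -
  interpret hyperplane_system m X H using assms by unfold_locales auto
  have "arr_rank m (H ` X) = m" unfolding arr_rank_full_iff using assms(4,5) unfolding sys_def by blast
  then show ?thesis unfolding arrangement_def using assms by auto
qed

context hyperplane_system
begin

text \<open>The directions common to all hyperplanes are among those of a set of hyperplanes that meet in one
  point.\<close>

lemma essential_dirs:
  assumes "arrangement l (G ` Ix)"
  shows "dirs Ix = {0\<^sub>v l}" and "lin Ix = l"
proof -
  have "arr_rank l (G ` Ix) = l" using assms unfolding arrangement_def by blast
  then obtain S p where S: "S \<subseteq> Ix" "sys S = {p}" unfolding arr_rank_full_iff by blast
  then have c: "cmp S" unfolding cmp_def by blast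
  have "lin S = l" unfolding lin_full_iff[OF S(1) c] using S(2) by blast
  then show l: "lin Ix = l" using lin_mono[OF S(1)] lin_le[of Ix] by simp
  have "subspace_dim l (dirs Ix) = 0" using l subspace_dim_dirs_le[of Ix] unfolding lin_def by auto
  then show "dirs Ix = {0\<^sub>v l}" unfolding vec_space.subspace_dim_zero_iff[OF dirs_subspace[OF subset_refl]] .
qed

lemma lin_submodular:
  assumes "P \<subseteq> Ix" "Q \<subseteq> Ix" "P \<inter> Q = {}"
  shows "lin (P \<union> Q) \<le> lin P + lin Q"
proof -
  have c: "cone_rank (insert 0 (Suc ` X)) = lin X + 1" for X by (simp add: cone_rank_def)
  let ?P = "insert 0 (Suc ` P)" and ?Q = "insert 0 (Suc ` Q)"
  have "cone_rank (?P \<union> ?Q) + cone_rank (?P \<inter> ?Q) \<le> cone_rank ?P + cone_rank ?Q"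
    by (rule matroid_rank_submodular[OF matroid_rank_cone])
       (use assms finite_Ix in \<open>auto simp: cone_ground_def\<close>)
  moreover have "?P \<union> ?Q = insert 0 (Suc ` (P \<union> Q))" "?P \<inter> ?Q = insert 0 (Suc ` {})" using assms(3) by auto
  ultimately have "(lin (P \<union> Q) + 1) + (lin {} + 1) \<le> (lin P + 1) + (lin Q + 1)" by (simp only: c)
  then show ?thesis by simp
qed

text \<open>The space is the direct sum of the directions \<open>dirs Q\<close>, in which the hyperplanes of \<open>Q\<close> are constant, and
  \<open>dirs P\<close>, in which those of \<open>P\<close> are constant: their dimensions add up to \<open>l\<close>, and they meet in zero by
  essentiality. In coordinates adapted to this decomposition, the equations of the hyperplanes in \<open>P\<close> involve only the
  first group of variables, and those in \<open>Q\<close> only the second one. A point cut out by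
  hyperplanes of the arrangement has two components, each cut out by hyperplanes of one factor, so both
  factors are essential.\<close>

theorem splitting_reducible:
  assumes arr: "arrangement l (G ` Ix)"
    and PQ: "P \<union> Q = Ix" "P \<inter> Q = {}" "P \<noteq> {}" "Q \<noteq> {}" and le: "lin P + lin Q \<le> l"
  shows "\<not> irreducible_arr l (G ` Ix)"
proof -
  have sub: "P \<subseteq> Ix" "Q \<subseteq> Ix" using PQ by auto
  define l1 where "l1 = subspace_dim l (dirs Q)"
  define l2 where "l2 = subspace_dim l (dirs P)"
  have "lin P + lin Q = l" using lin_submodular[OF sub PQ(2)] essential_dirs(2)[OF arr] le unfolding PQ(1) by simp
  then have l: "l = l1 + l2"
    using subspace_dim_dirs_le[OF sub(1)] subspace_dim_dirs_le[OF sub(2)] unfolding lin_def l1_def l2_def by linarith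
  obtain B1 where B1: "B1 \<in> carrier_mat l l1" "dirs Q = (\<lambda>u. B1 *\<^sub>v u) ` carrier_vec l1"
    "\<forall>u\<in>carrier_vec l1. B1 *\<^sub>v u = 0\<^sub>v l \<longrightarrow> u = 0\<^sub>v l1"
    unfolding l1_def by (rule vec_space.subspace_parametrization[OF dirs_subspace[OF sub(2)]])
  obtain B2 where B2: "B2 \<in> carrier_mat l l2" "dirs P = (\<lambda>u. B2 *\<^sub>v u) ` carrier_vec l2"
    "\<forall>u\<in>carrier_vec l2. B2 *\<^sub>v u = 0\<^sub>v l \<longrightarrow> u = 0\<^sub>v l2"
    unfolding l2_def by (rule vec_space.subspace_parametrization[OF dirs_subspace[OF sub(1)]])
  \<comment> \<open>The lower blocks have no rows, so \<open>M\<close> is \<open>B1\<close> and \<open>B2\<close> side by side.\<close>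
  define M where "M = four_block_mat B1 B2 (0\<^sub>m 0 l1) (0\<^sub>m 0 l2)"
  have M: "M \<in> carrier_mat l l"
    using four_block_carrier_mat[OF B1(1), of "0\<^sub>m 0 l2" 0 l2] l unfolding M_def by simp
  have Mv: "M *\<^sub>v (u1 @\<^sub>v u2) = B1 *\<^sub>v u1 + B2 *\<^sub>v u2" if "u1 \<in> carrier_vec l1" "u2 \<in> carrier_vec l2" for u1 u2
  proof -
    have "M *\<^sub>v (u1 @\<^sub>v u2) = (B1 *\<^sub>v u1 + B2 *\<^sub>v u2) @\<^sub>v (0\<^sub>m 0 l1 *\<^sub>v u1 + 0\<^sub>m 0 l2 *\<^sub>v u2)"
      unfolding M_def by (rule four_block_mat_mult_vec[OF B1(1) B2(1) _ _ that]) auto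
    also have "\<dots> = B1 *\<^sub>v u1 + B2 *\<^sub>v u2" by (intro eq_vecI) (use B1 B2 in auto)
    finally show ?thesis .
  qed
  have split: "\<exists>u1\<in>carrier_vec l1. \<exists>u2\<in>carrier_vec l2. v = u1 @\<^sub>v u2" if "v \<in> carrier_vec l" for v :: "complex vec"
    using vec_first_last_append[of v l1 l2] that vec_first_carrier vec_last_carrier l by metis
  have B1c: "B1 *\<^sub>v u \<in> dirs Q" "B1 *\<^sub>v u \<in> carrier_vec l" if "u \<in> carrier_vec l1" for u
    using that B1 by auto
  have B2c: "B2 *\<^sub>v u \<in> dirs P" "B2 *\<^sub>v u \<in> carrier_vec l" if "u \<in> carrier_vec l2" for u
    using that B2 by auto
  have "v = 0\<^sub>v l" if v: "v \<in> carrier_vec l" "M *\<^sub>v v = 0\<^sub>v l" for v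
  proof -
    obtain u1 u2 where u: "u1 \<in> carrier_vec l1" "u2 \<in> carrier_vec l2" "v = u1 @\<^sub>v u2" using split[OF v(1)] by blast
    have sum0: "B1 *\<^sub>v u1 + B2 *\<^sub>v u2 = 0\<^sub>v l" using v(2) Mv[OF u(1,2)] u(3) by simp
    have "B1 *\<^sub>v u1 \<in> dirs P"
    proof -
      have "normal_vec i \<bullet> (B1 *\<^sub>v u1) = 0" if i: "i \<in> P" for i
      proof -
        have n: "normal_vec i \<in> carrier_vec l" using normal_vec(1) i sub by blast
        have "normal_vec i \<bullet> (B1 *\<^sub>v u1 + B2 *\<^sub>v u2) = 0" unfolding sum0 using n by simp
        moreover have "normal_vec i \<bullet> (B2 *\<^sub>v u2) = 0" using B2c(1)[OF u(2)] i unfolding dirs_def by blast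
        ultimately show ?thesis using scalar_prod_add_distrib[OF n B1c(2)[OF u(1)] B2c(2)[OF u(2)]] by simp
      qed
      then show ?thesis unfolding dirs_def using B1c(2)[OF u(1)] by simp
    qed
    then have "B1 *\<^sub>v u1 \<in> dirs Ix" using B1c(1)[OF u(1)] unfolding PQ(1)[symmetric] dirs_def by auto
    then have z1: "B1 *\<^sub>v u1 = 0\<^sub>v l" using essential_dirs(1)[OF arr] by simp
    then have "B2 *\<^sub>v u2 = 0\<^sub>v l" using sum0 B2c(2)[OF u(2)] by simp
    then have "u1 = 0\<^sub>v l1" "u2 = 0\<^sub>v l2" using B1(3) B2(3) u(1,2) z1 by blast+
    then show ?thesis unfolding u(3) l by (intro eq_vecI) auto
  qed
  then obtain N where N: "N \<in> carrier_mat l l" "M * N = 1\<^sub>m l" "N * M = 1\<^sub>m l" "invertible_mat N"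
    using invertible_mat_of_injective[OF M] by blast
  define \<phi> where "\<phi> v = N *\<^sub>v v + 0\<^sub>v l" for v
  have aff: "affine_change l \<phi>" unfolding affine_change_def \<phi>_def using N by (intro bexI[of _ N] bexI[of _ "0\<^sub>v l"]) auto
  have \<phi>M: "\<phi> (M *\<^sub>v w) = w" if "w \<in> carrier_vec l" for w
  proof -
    have "N *\<^sub>v (M *\<^sub>v w) = (N * M) *\<^sub>v w" using assoc_mult_mat_vec[OF N(1) M that] by simp
    then show ?thesis unfolding \<phi>_def N(3) using that by simp
  qed
  have M\<phi>: "M *\<^sub>v \<phi> v = v" "\<phi> v \<in> carrier_vec l" if "v \<in> carrier_vec l" for v
  proof -
    have Nv: "N *\<^sub>v v \<in> carrier_vec l" using N(1) that by simp
    then have e: "\<phi> v = N *\<^sub>v v" unfolding \<phi>_def by simp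
    show "\<phi> v \<in> carrier_vec l" unfolding e by (rule Nv)
    have "M *\<^sub>v (N *\<^sub>v v) = (M * N) *\<^sub>v v" using assoc_mult_mat_vec[OF M N(1) that] by simp
    then show "M *\<^sub>v \<phi> v = v" unfolding e N(2) using that by simp
  qed
  define H1 where "H1 i = {u \<in> carrier_vec l1. (transpose_mat B1 *\<^sub>v normal_vec i) \<bullet> u = offset i}" for i
  define H2 where "H2 i = {u \<in> carrier_vec l2. (transpose_mat B2 *\<^sub>v normal_vec i) \<bullet> u = offset i}" for i
  have dual: "(transpose_mat B *\<^sub>v normal_vec i) \<bullet> u = normal_vec i \<bullet> (B *\<^sub>v u)"
    if "B \<in> carrier_mat l k" "u \<in> carrier_vec k" "i \<in> Ix" for B u k i
    using transpose_vec_mult_scalar[OF that(1,2) normal_vec(1)[OF that(3)]] .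
  have Mdot: "normal_vec i \<bullet> (M *\<^sub>v (u1 @\<^sub>v u2)) = normal_vec i \<bullet> (B1 *\<^sub>v u1) + normal_vec i \<bullet> (B2 *\<^sub>v u2)"
    "M *\<^sub>v (u1 @\<^sub>v u2) \<in> carrier_vec l"
    if "u1 \<in> carrier_vec l1" "u2 \<in> carrier_vec l2" "i \<in> Ix" for u1 u2 i
    using Mv[OF that(1,2)] scalar_prod_add_distrib[OF normal_vec(1)[OF that(3)] B1c(2)[OF that(1)] B2c(2)[OF that(2)]]
      B1c(2)[OF that(1)] B2c(2)[OF that(2)] by simp_all
  have mem1: "M *\<^sub>v (u1 @\<^sub>v u2) \<in> G i \<longleftrightarrow> u1 \<in> H1 i"
    if u: "u1 \<in> carrier_vec l1" "u2 \<in> carrier_vec l2" and i: "i \<in> P" for u1 u2 i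
  proof -
    have iI: "i \<in> Ix" using i sub by blast
    have "normal_vec i \<bullet> (B2 *\<^sub>v u2) = 0" using B2c(1)[OF u(2)] i unfolding dirs_def by blast
    then show ?thesis unfolding mem_G_iff[OF iI] H1_def using Mdot[OF u iI] dual[OF B1(1) u(1) iI] u by simp
  qed
  have mem2: "M *\<^sub>v (u1 @\<^sub>v u2) \<in> G i \<longleftrightarrow> u2 \<in> H2 i"
    if u: "u1 \<in> carrier_vec l1" "u2 \<in> carrier_vec l2" and i: "i \<in> Q" for u1 u2 i
  proof -
    have iI: "i \<in> Ix" using i sub by blast
    have "normal_vec i \<bullet> (B1 *\<^sub>v u1) = 0" using B1c(1)[OF u(1)] i unfolding dirs_def by blast
    then show ?thesis unfolding mem_G_iff[OF iI] H2_def using Mdot[OF u iI] dual[OF B2(1) u(2) iI] u by simp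
  qed
  \<comment> \<open>A nonzero normal vector cannot vanish on both summands of the space.\<close>
  have vanish: False if i: "i \<in> Ix" and v1: "\<And>u. u \<in> carrier_vec l1 \<Longrightarrow> normal_vec i \<bullet> (B1 *\<^sub>v u) = 0"
    and v2: "\<And>u. u \<in> carrier_vec l2 \<Longrightarrow> normal_vec i \<bullet> (B2 *\<^sub>v u) = 0" for i
  proof -
    have "normal_vec i \<bullet> v = 0" if v: "v \<in> carrier_vec l" for v
    proof -
      obtain u1 u2 where u: "u1 \<in> carrier_vec l1" "u2 \<in> carrier_vec l2" "\<phi> v = u1 @\<^sub>v u2"
        using split[OF M\<phi>(2)[OF v]] by blast
      have "normal_vec i \<bullet> v = normal_vec i \<bullet> (M *\<^sub>v (u1 @\<^sub>v u2))" using M\<phi>(1)[OF v] u(3) by simp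
      then show ?thesis using Mdot(1)[OF u(1,2) i] v1[OF u(1)] v2[OF u(2)] by simp
    qed
    then have "carrier_vec l \<subseteq> G i \<or> G i = {}" using mem_G_iff[OF i] by auto
    moreover have "normal_vec i = 0\<^sub>v l"
    proof (rule eq_vecI)
      fix k assume "k < dim_vec (0\<^sub>v l :: complex vec)"
      then show "normal_vec i $ k = 0\<^sub>v l $ k"
        using \<open>\<And>v. v \<in> carrier_vec l \<Longrightarrow> normal_vec i \<bullet> v = 0\<close>[of "unit_vec l k"] normal_vec(1)[OF i]
        by (simp add: scalar_prod_right_unit)
    qed (use normal_vec(1)[OF i] in simp)
    ultimately show False using normal_vec(2)[OF i] by simp
  qed
  have nz1: "transpose_mat B1 *\<^sub>v normal_vec i \<noteq> 0\<^sub>v l1" if i: "i \<in> P" for i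
  proof
    assume z: "transpose_mat B1 *\<^sub>v normal_vec i = 0\<^sub>v l1"
    have iI: "i \<in> Ix" using i sub by blast
    show False
    proof (rule vanish[OF iI])
      show "normal_vec i \<bullet> (B1 *\<^sub>v u) = 0" if "u \<in> carrier_vec l1" for u using dual[OF B1(1) that iI] z that by simp
      show "normal_vec i \<bullet> (B2 *\<^sub>v u) = 0" if "u \<in> carrier_vec l2" for u using B2c(1)[OF that] i unfolding dirs_def by blast
    qed
  qed
  have nz2: "transpose_mat B2 *\<^sub>v normal_vec i \<noteq> 0\<^sub>v l2" if i: "i \<in> Q" for i
  proof
    assume z: "transpose_mat B2 *\<^sub>v normal_vec i = 0\<^sub>v l2"
    have iI: "i \<in> Ix" using i sub by blast
    show False
    proof (rule vanish[OF iI])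
      show "normal_vec i \<bullet> (B2 *\<^sub>v u) = 0" if "u \<in> carrier_vec l2" for u using dual[OF B2(1) that iI] z that by simp
      show "normal_vec i \<bullet> (B1 *\<^sub>v u) = 0" if "u \<in> carrier_vec l1" for u using B1c(1)[OF that] i unfolding dirs_def by blast
    qed
  qed
  have tc1: "transpose_mat B1 *\<^sub>v normal_vec i \<in> carrier_vec l1" "transpose_mat B2 *\<^sub>v normal_vec i \<in> carrier_vec l2" for i
    by (rule carrier_vecI, use B1(1) B2(1) in simp)+
  have hyp1: "hyperplane l1 (H1 i)" if "i \<in> P" for i
    unfolding hyperplane_def H1_def by (intro bexI[OF _ tc1(1)[of i]] exI[of _ "offset i"] conjI nz1[OF that] refl)
  have hyp2: "hyperplane l2 (H2 i)" if "i \<in> Q" for i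
    unfolding hyperplane_def H2_def by (intro bexI[OF _ tc1(2)[of i]] exI[of _ "offset i"] conjI nz2[OF that] refl)
  have vec0: "v = 0\<^sub>v 0" if "v \<in> carrier_vec 0" for v :: "complex vec" using that by (intro eq_vecI) auto
  have pos: "l1 > 0" "l2 > 0"
  proof -
    obtain i j where ij: "i \<in> P" "j \<in> Q" using PQ(3,4) by blast
    show "l1 > 0"
    proof (rule ccontr)
      assume "\<not> l1 > 0"
      then have "l1 = 0" by simp
      then show False using nz1[OF ij(1)] vec0[of "transpose_mat B1 *\<^sub>v normal_vec i"] tc1(1)[of i] by simp
    qed
    show "l2 > 0"
    proof (rule ccontr)
      assume "\<not> l2 > 0"
      then have "l2 = 0" by simp
      then show False using nz2[OF ij(2)] vec0[of "transpose_mat B2 *\<^sub>v normal_vec j"] tc1(2)[of j] by simp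
    qed
  qed
  have img1: "\<phi> ` G i = vprod (H1 i) (carrier_vec l2)" if i: "i \<in> P" for i
  proof (intro equalityI subsetI)
    fix w assume "w \<in> \<phi> ` G i"
    then obtain v where v: "v \<in> G i" "w = \<phi> v" by blast
    have vc: "v \<in> carrier_vec l" using v(1) mem_G_iff i sub by blast
    obtain u1 u2 where u: "u1 \<in> carrier_vec l1" "u2 \<in> carrier_vec l2" "\<phi> v = u1 @\<^sub>v u2"
      using split[OF M\<phi>(2)[OF vc]] by blast
    have "u1 \<in> H1 i" using mem1[OF u(1,2) i] M\<phi>(1)[OF vc] u(3) v(1) by simp
    then show "w \<in> vprod (H1 i) (carrier_vec l2)" unfolding v(2) u(3) vprod_def using u by blast
  next
    fix w assume "w \<in> vprod (H1 i) (carrier_vec l2)"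
    then obtain u1 u2 where u: "u1 \<in> H1 i" "u2 \<in> carrier_vec l2" "w = u1 @\<^sub>v u2" unfolding vprod_def by blast
    then have u1: "u1 \<in> carrier_vec l1" unfolding H1_def by blast
    have "w \<in> carrier_vec l" using u u1 unfolding l by simp
    then have "w = \<phi> (M *\<^sub>v w)" using \<phi>M by simp
    moreover have "M *\<^sub>v w \<in> G i" using mem1[OF u1 u(2) i] u by simp
    ultimately show "w \<in> \<phi> ` G i" by blast
  qed
  have img2: "\<phi> ` G i = vprod (carrier_vec l1) (H2 i)" if i: "i \<in> Q" for i
  proof (intro equalityI subsetI)
    fix w assume "w \<in> \<phi> ` G i"
    then obtain v where v: "v \<in> G i" "w = \<phi> v" by blast
    have vc: "v \<in> carrier_vec l" using v(1) mem_G_iff i sub by blast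
    obtain u1 u2 where u: "u1 \<in> carrier_vec l1" "u2 \<in> carrier_vec l2" "\<phi> v = u1 @\<^sub>v u2"
      using split[OF M\<phi>(2)[OF vc]] by blast
    have "u2 \<in> H2 i" using mem2[OF u(1,2) i] M\<phi>(1)[OF vc] u(3) v(1) by simp
    then show "w \<in> vprod (carrier_vec l1) (H2 i)" unfolding v(2) u(3) vprod_def using u by blast
  next
    fix w assume "w \<in> vprod (carrier_vec l1) (H2 i)"
    then obtain u1 u2 where u: "u1 \<in> carrier_vec l1" "u2 \<in> H2 i" "w = u1 @\<^sub>v u2" unfolding vprod_def by blast
    then have u2: "u2 \<in> carrier_vec l2" unfolding H2_def by blast
    have "w \<in> carrier_vec l" using u u2 unfolding l by simp
    then have "w = \<phi> (M *\<^sub>v w)" using \<phi>M by simp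
    moreover have "M *\<^sub>v w \<in> G i" using mem2[OF u(1) u2 i] u by simp
    ultimately show "w \<in> \<phi> ` G i" by blast
  qed
  have G_of_img: "G i = G j" if "i \<in> Ix" "j \<in> Ix" "\<phi> ` G i = \<phi> ` G j" for i j
  proof -
    have "G i = (\<lambda>w. M *\<^sub>v w) ` \<phi> ` G i" if "i \<in> Ix" for i
    proof -
      have "(\<lambda>w. M *\<^sub>v w) ` \<phi> ` G i = (\<lambda>v. v) ` G i"
        unfolding image_image using M\<phi>(1) mem_G_iff[OF that] by (intro image_cong) auto
      then show ?thesis by simp
    qed
    then show ?thesis using that by metis
  qed
  have inj1: "inj_on H1 P"
  proof (rule inj_onI)
    fix i j assume ij: "i \<in> P" "j \<in> P" "H1 i = H1 j"
    then have "i \<in> Ix" "j \<in> Ix" using sub by blast+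
    moreover have "\<phi> ` G i = \<phi> ` G j" using img1[OF ij(1)] img1[OF ij(2)] ij(3) by simp
    ultimately have "G i = G j" by (rule G_of_img)
    then show "i = j" using inj_onD[OF inj_G] ij sub by blast
  qed
  have inj2: "inj_on H2 Q"
  proof (rule inj_onI)
    fix i j assume ij: "i \<in> Q" "j \<in> Q" "H2 i = H2 j"
    then have "i \<in> Ix" "j \<in> Ix" using sub by blast+
    moreover have "\<phi> ` G i = \<phi> ` G j" using img2[OF ij(1)] img2[OF ij(2)] ij(3) by simp
    ultimately have "G i = G j" by (rule G_of_img)
    then show "i = j" using inj_onD[OF inj_G] ij sub by blast
  qed
  \<comment> \<open>The components of \<open>p\<close> are points cut out by the two parts of \<open>S\<close>.\<close>
  obtain S p where S: "S \<subseteq> Ix" "sys S = {p}"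
    using arr unfolding arrangement_def arr_rank_full_iff by blast
  have p: "p \<in> sys S" using S(2) by blast
  then have pc: "p \<in> carrier_vec l" unfolding sys_def by blast
  obtain p1 p2 where pp: "p1 \<in> carrier_vec l1" "p2 \<in> carrier_vec l2" "\<phi> p = p1 @\<^sub>v p2" using split[OF M\<phi>(2)[OF pc]] by blast
  have pM: "p = M *\<^sub>v (p1 @\<^sub>v p2)" using M\<phi>(1)[OF pc] pp(3) by simp
  have sys_iff': "M *\<^sub>v (u1 @\<^sub>v u2) \<in> sys S \<longleftrightarrow> (\<forall>i\<in>S \<inter> P. u1 \<in> H1 i) \<and> (\<forall>i\<in>S \<inter> Q. u2 \<in> H2 i)"
    if "u1 \<in> carrier_vec l1" "u2 \<in> carrier_vec l2" for u1 u2
  proof -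
    have "S = (S \<inter> P) \<union> (S \<inter> Q)" using S(1) PQ(1) by blast
    moreover have "M *\<^sub>v (u1 @\<^sub>v u2) \<in> carrier_vec l" using Mv[OF that] B1c(2)[OF that(1)] B2c(2)[OF that(2)] by simp
    ultimately have "M *\<^sub>v (u1 @\<^sub>v u2) \<in> sys S \<longleftrightarrow>
      (\<forall>i\<in>S \<inter> P. M *\<^sub>v (u1 @\<^sub>v u2) \<in> G i) \<and> (\<forall>i\<in>S \<inter> Q. M *\<^sub>v (u1 @\<^sub>v u2) \<in> G i)"
      unfolding sys_def by blast
    then show ?thesis using mem1[OF that] mem2[OF that] by auto
  qed
  have p12: "\<forall>i\<in>S \<inter> P. p1 \<in> H1 i" "\<forall>i\<in>S \<inter> Q. p2 \<in> H2 i" using p sys_iff'[OF pp(1,2)] pM by auto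
  have uniq: "u1 = p1 \<and> u2 = p2"
    if u: "u1 \<in> carrier_vec l1" "u2 \<in> carrier_vec l2" and "\<forall>i\<in>S \<inter> P. u1 \<in> H1 i" "\<forall>i\<in>S \<inter> Q. u2 \<in> H2 i" for u1 u2
  proof -
    have "M *\<^sub>v (u1 @\<^sub>v u2) = p" using sys_iff'[OF u] that S(2) by blast
    moreover have "u1 @\<^sub>v u2 \<in> carrier_vec l" using u unfolding l by simp
    ultimately have "u1 @\<^sub>v u2 = \<phi> p" using \<phi>M by metis
    then have "u1 @\<^sub>v u2 = p1 @\<^sub>v p2" using pp(3) by simp
    then show ?thesis using append_vec_eq[OF u(1) pp(1)] by simp
  qed
  have finPQ: "finite P" "finite Q" using finite_subset[OF _ finite_Ix] sub by auto
  have pt1: "{u \<in> carrier_vec l1. \<forall>i\<in>S \<inter> P. u \<in> H1 i} = {p1}"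
    using pp p12 uniq[OF _ pp(2) _ p12(2)] by blast
  have pt2: "{u \<in> carrier_vec l2. \<forall>i\<in>S \<inter> Q. u \<in> H2 i} = {p2}"
    using pp p12 uniq[OF pp(1) _ p12(1)] by blast
  have arr1: "arrangement l1 (H1 ` P)"
    by (rule arrangement_of_point[OF finPQ(1) hyp1 inj1 _ pt1]) auto
  have arr2: "arrangement l2 (H2 ` Q)"
    by (rule arrangement_of_point[OF finPQ(2) hyp2 inj2 _ pt2]) auto
  have "(`) \<phi> ` G ` Ix = (\<lambda>i. \<phi> ` G i) ` P \<union> (\<lambda>i. \<phi> ` G i) ` Q"
    unfolding PQ(1)[symmetric] image_Un image_image ..
  also have "(\<lambda>i. \<phi> ` G i) ` P = (\<lambda>H. vprod H (carrier_vec l2)) ` H1 ` P"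
    unfolding image_image using img1 by (rule image_cong[OF refl])
  also have "(\<lambda>i. \<phi> ` G i) ` Q = (\<lambda>H. vprod (carrier_vec l1) H) ` H2 ` Q"
    unfolding image_image using img2 by (rule image_cong[OF refl])
  finally have "(`) \<phi> ` G ` Ix = arr_prod l1 (H1 ` P) l2 (H2 ` Q)" unfolding arr_prod_def .
  then show ?thesis unfolding irreducible_arr_def using pos l arr1 arr2 aff by blast
qed

lemma irreducible_lin:
  assumes "irreducible_arr l (G ` Ix)" "P \<union> Q = Ix" "P \<inter> Q = {}" "P \<noteq> {}" "Q \<noteq> {}"
  shows "lin P + lin Q > l"
  using splitting_reducible[of P Q] assms unfolding irreducible_arr_def by (meson not_le)

lemma finite_cone_ground: "finite cone_ground"
  unfolding cone_ground_def using finite_Ix by simp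

text \<open>In a separation of the cone, infinity lies on one side, whose rank is one more than that of its normal vectors. So
  the ranks of the normal vectors of both sides add up to at most \<open>l\<close>, which an irreducible arrangement allows
  only if infinity is alone on its side. But then the other side, having empty intersection, has full
  rank in the cone.\<close>

lemma connected_cone:
  assumes irr: "irreducible_arr l (G ` Ix)" and nc: "\<not> cmp Ix"
  shows "connected_matroid cone_ground cone_rank"
proof -
  have l: "lin Ix = l" using essential_dirs(2) irr unfolding irreducible_arr_def by blast
  have rE: "cone_rank cone_ground = l + 1" unfolding cone_ground_def by (simp add: cone_rank_def l)
  have main: "cone_rank P + cone_rank Q \<noteq> cone_rank cone_ground"
    if PQ: "P \<union> Q = cone_ground" "P \<inter> Q = {}" "Q \<noteq> {}" "0 \<in> P" for P Q
  proof
    assume eq: "cone_rank P + cone_rank Q = cone_rank cone_ground"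
    let ?P = "finite_part P" and ?Q = "finite_part Q"
    have fp: "?P \<union> ?Q = Ix" "?P \<inter> ?Q = {}"
      using PQ unfolding finite_part_def cone_ground_def by auto
    have Q: "Q = Suc ` ?Q"
    proof
      show "Q \<subseteq> Suc ` ?Q"
      proof
        fix x assume x: "x \<in> Q"
        then have "x \<noteq> 0" using PQ(2,4) by (metis IntI empty_iff)
        then obtain i where "x = Suc i" using not0_implies_Suc by blast
        then show "x \<in> Suc ` ?Q" using x unfolding finite_part_def by blast
      qed
    qed (auto simp: finite_part_def)
    then have Qne: "?Q \<noteq> {}" using PQ(3) by auto
    have 1: "cone_rank P = lin ?P + 1" using PQ(4) by (simp add: cone_rank_def)
    have 2: "cone_rank Q = lin ?Q + (if cmp ?Q then 0 else 1)" using PQ(2,4) by (auto simp: cone_rank_def)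
    have sum: "lin ?P + lin ?Q + (if cmp ?Q then 0 else 1) = l" using eq rE 1 2 by simp
    show False
    proof (cases "?P = {}")
      case True
      then have "?Q = Ix" using fp by simp
      then show False using sum nc l True by (simp add: lin_empty)
    next
      case False
      then show False using irreducible_lin[OF irr fp False Qne] sum by simp
    qed
  qed
  show ?thesis unfolding connected_matroid_def
  proof (intro conjI allI impI)
    show "0 < cone_rank cone_ground" unfolding rE by simp
    fix P Q assume h: "P \<union> Q = cone_ground \<and> P \<inter> Q = {} \<and> P \<noteq> {} \<and> Q \<noteq> {}"
    have "0 \<in> P \<or> 0 \<in> Q" using h unfolding cone_ground_def by blast
    then show "cone_rank P + cone_rank Q \<noteq> cone_rank cone_ground"
      using main[of P Q] main[of Q P] h by (auto simp: Un_commute Int_commute add.commute)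
  qed
qed

text \<open>If all hyperplanes have a common point, then a separation of the matroid is a splitting of the normal
  vectors.\<close>

lemma connected_central:
  assumes irr: "irreducible_arr l (G ` Ix)" and c: "cmp Ix"
  shows "connected_matroid (Suc ` Ix) cone_rank"
proof -
  have l: "lin Ix = l" "l > 0" using essential_dirs(2) irr unfolding irreducible_arr_def by blast+
  have r: "cone_rank (Suc ` X) = lin X" if "X \<subseteq> Ix" for X
    using cmp_mono[OF c that] by (auto simp: cone_rank_def)
  show ?thesis unfolding connected_matroid_def
  proof (intro conjI allI impI)
    show "0 < cone_rank (Suc ` Ix)" using r[of Ix] l by simp
    fix P Q assume h: "P \<union> Q = Suc ` Ix \<and> P \<inter> Q = {} \<and> P \<noteq> {} \<and> Q \<noteq> {}"
    have "P \<subseteq> Suc ` Ix" "Q \<subseteq> Suc ` Ix" using h by blast+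
    then obtain P' Q' where P': "P' \<subseteq> Ix" "P = Suc ` P'" and Q': "Q' \<subseteq> Ix" "Q = Suc ` Q'"
      unfolding subset_image_iff by blast
    have "P' \<union> Q' = Ix" "P' \<inter> Q' = {}" "P' \<noteq> {}" "Q' \<noteq> {}"
      using h unfolding P'(2) Q'(2) image_Un[symmetric] by (auto simp: inj_image_eq_iff)
    then show "cone_rank P + cone_rank Q \<noteq> cone_rank (Suc ` Ix)"
      using irreducible_lin[OF irr, of P' Q'] r P' Q' l by simp
  qed
qed

lemma alt_count_Suc_image: "alt_count ((`) Suc ` \<N>) = alt_count \<N>"
proof -
  have "inj_on ((`) Suc) \<N>" by (auto simp: inj_on_def inj_image_eq_iff)
  then show ?thesis unfolding alt_count_def by (simp add: sum.reindex card_image)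
qed

lemma cone_rank_Suc_insert:
  assumes "S \<subseteq> Ix" "cmp S"
  shows "e \<in> Ix \<Longrightarrow> cone_rank (insert (Suc e) (Suc ` S)) \<noteq> cone_rank (Suc ` S) \<longleftrightarrow> e \<notin> cl S"
proof -
  assume e: "e \<in> Ix"
  have "Suc ` S \<subseteq> cone_ground" "Suc e \<in> cone_ground" using assms(1) e unfolding cone_ground_def by auto
  then have "cone_rank (insert (Suc e) (Suc ` S)) = cone_rank (Suc ` S) + (if e \<in> cl S then 0 else 1)"
    using cone_rank_insert[of "Suc ` S" "Suc e"] assms(2) by (simp add: cone_cl_def)
  then show ?thesis by simp
qed

text \<open>With infinity as the least element of the cone, the reduced sets without broken circuits of the cone are
  exactly the sets without broken circuits of the affine arrangement: the condition for infinity says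
  that the intersection is nonempty.\<close>

theorem noncentral_count:
  assumes irr: "irreducible_arr l (G ` Ix)" and nc: "\<not> cmp Ix"
  shows "alt_count {S. S \<subseteq> Ix \<and> cmp S \<and> (\<forall>e\<in>Ix. e \<notin> cl {s \<in> S. e < s})} \<noteq> 0"
proof -
  let ?N = "{S. S \<subseteq> Ix \<and> cmp S \<and> (\<forall>e\<in>Ix. e \<notin> cl {s \<in> S. e < s})}"
  have min: "Min cone_ground = 0" unfolding cone_ground_def using finite_Ix by (intro Min_eqI) auto
  have nbc: "rank_nbc cone_ground cone_rank (Suc ` S) \<longleftrightarrow> S \<in> ?N" if S: "S \<subseteq> Ix" for S
  proof -
    have e0: "{s \<in> Suc ` S. 0 < s} = Suc ` S" by auto
    have es: "{s \<in> Suc ` S. Suc e < s} = Suc ` {s \<in> S. e < s}" for e by auto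
    have "rank_nbc cone_ground cone_rank (Suc ` S) \<longleftrightarrow>
      cone_rank (insert 0 (Suc ` S)) \<noteq> cone_rank (Suc ` S) \<and>
      (\<forall>e\<in>Ix. cone_rank (insert (Suc e) (Suc ` {s \<in> S. e < s})) \<noteq> cone_rank (Suc ` {s \<in> S. e < s}))"
      unfolding rank_nbc_def cone_ground_def by (simp add: e0 es)
    also have "cone_rank (insert 0 (Suc ` S)) \<noteq> cone_rank (Suc ` S) \<longleftrightarrow> cmp S" by (auto simp: cone_rank_def)
    also have "cmp S \<and> (\<forall>e\<in>Ix. cone_rank (insert (Suc e) (Suc ` {s \<in> S. e < s})) \<noteq> cone_rank (Suc ` {s \<in> S. e < s}))
      \<longleftrightarrow> cmp S \<and> (\<forall>e\<in>Ix. e \<notin> cl {s \<in> S. e < s})"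
    proof (rule conj_cong[OF refl], rule ball_cong[OF refl])
      fix e assume e: "cmp S" "e \<in> Ix"
      have sub: "{s \<in> S. e < s} \<subseteq> S" by auto
      show "(cone_rank (insert (Suc e) (Suc ` {s \<in> S. e < s})) \<noteq> cone_rank (Suc ` {s \<in> S. e < s})) = (e \<notin> cl {s \<in> S. e < s})"
        by (rule cone_rank_Suc_insert[OF _ cmp_mono[OF e(1) sub] e(2)]) (use sub S in blast)
    qed
    finally show ?thesis using S by simp
  qed
  have "reduced_nbc cone_ground cone_rank = (`) Suc ` ?N"
  proof (intro equalityI subsetI)
    fix S assume "S \<in> reduced_nbc cone_ground cone_rank"
    then have S: "S \<subseteq> cone_ground - {0}" "rank_nbc cone_ground cone_rank S"
      unfolding reduced_nbc_def min by auto
    then have "S \<subseteq> Suc ` Ix" unfolding cone_ground_def by blast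
    then obtain S' where "S' \<subseteq> Ix" "S = Suc ` S'" unfolding subset_image_iff by blast
    then show "S \<in> (`) Suc ` ?N" using nbc S(2) by blast
  next
    fix S assume "S \<in> (`) Suc ` ?N"
    then obtain S' where S': "S' \<in> ?N" "S = Suc ` S'" by blast
    then have "S' \<subseteq> Ix" by blast
    then show "S \<in> reduced_nbc cone_ground cone_rank"
      using nbc[of S'] S' unfolding reduced_nbc_def min by (auto simp: cone_ground_def)
  qed
  moreover have "0 < (-1) ^ (cone_rank cone_ground + 1) * alt_count (reduced_nbc cone_ground cone_rank)"
    by (rule alt_count_reduced_nbc(2)[OF matroid_rank_cone finite_cone_ground _ connected_cone[OF irr nc]])
       (simp add: cone_ground_def)
  ultimately show ?thesis unfolding alt_count_Suc_image[symmetric, of ?N] by auto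
qed

theorem central_count:
  assumes irr: "irreducible_arr l (G ` Ix)" and c: "cmp Ix"
  shows "alt_count {S. S \<subseteq> Ix \<and> cmp S \<and> (\<forall>e\<in>Ix. e \<notin> cl {s \<in> S. e < s}) \<and> Min Ix \<notin> S} \<noteq> 0"
proof -
  let ?N = "{S. S \<subseteq> Ix \<and> cmp S \<and> (\<forall>e\<in>Ix. e \<notin> cl {s \<in> S. e < s}) \<and> Min Ix \<notin> S}"
  have conn: "connected_matroid (Suc ` Ix) cone_rank" by (rule connected_central[OF irr c])
  have ne: "Ix \<noteq> {}"
  proof
    assume "Ix = {}"
    then have "cone_rank (Suc ` Ix) = 0" using matroid_rankD(1)[OF matroid_rank_cone] by simp
    then show False using conn unfolding connected_matroid_def by simp
  qed
  have min: "Min (Suc ` Ix) = Suc (Min Ix)" using finite_Ix ne by (intro Min_eqI) auto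
  have mat: "matroid_rank (Suc ` Ix) cone_rank"
    by (rule matroid_rank_subset[OF matroid_rank_cone]) (auto simp: cone_ground_def)
  have nbc: "rank_nbc (Suc ` Ix) cone_rank (Suc ` S) \<longleftrightarrow> (\<forall>e\<in>Ix. e \<notin> cl {s \<in> S. e < s})" if S: "S \<subseteq> Ix" for S
  proof -
    have es: "{s \<in> Suc ` S. Suc e < s} = Suc ` {s \<in> S. e < s}" for e by auto
    have "rank_nbc (Suc ` Ix) cone_rank (Suc ` S) \<longleftrightarrow>
      (\<forall>e\<in>Ix. cone_rank (insert (Suc e) (Suc ` {s \<in> S. e < s})) \<noteq> cone_rank (Suc ` {s \<in> S. e < s}))"
      unfolding rank_nbc_def by (simp add: es)
    also have "\<dots> \<longleftrightarrow> (\<forall>e\<in>Ix. e \<notin> cl {s \<in> S. e < s})"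
    proof (rule ball_cong[OF refl])
      fix e assume e: "e \<in> Ix"
      have sub: "{s \<in> S. e < s} \<subseteq> Ix" using S by auto
      show "(cone_rank (insert (Suc e) (Suc ` {s \<in> S. e < s})) \<noteq> cone_rank (Suc ` {s \<in> S. e < s})) = (e \<notin> cl {s \<in> S. e < s})"
        by (rule cone_rank_Suc_insert[OF sub cmp_mono[OF c sub] e])
    qed
    finally show ?thesis .
  qed
  have "reduced_nbc (Suc ` Ix) cone_rank = (`) Suc ` ?N"
  proof (intro equalityI subsetI)
    fix S assume "S \<in> reduced_nbc (Suc ` Ix) cone_rank"
    then have S: "S \<subseteq> Suc ` Ix" "Suc (Min Ix) \<notin> S" "rank_nbc (Suc ` Ix) cone_rank S"
      unfolding reduced_nbc_def min by auto
    then obtain S' where "S' \<subseteq> Ix" "S = Suc ` S'" unfolding subset_image_iff by blast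
    then show "S \<in> (`) Suc ` ?N" using nbc S(2,3) cmp_mono[OF c] by blast
  next
    fix S assume "S \<in> (`) Suc ` ?N"
    then obtain S' where S': "S' \<in> ?N" "S = Suc ` S'" by blast
    then have "S' \<subseteq> Ix" by blast
    then show "S \<in> reduced_nbc (Suc ` Ix) cone_rank"
      using nbc[of S'] S' unfolding reduced_nbc_def min by auto
  qed
  moreover have "0 < (-1) ^ (cone_rank (Suc ` Ix) + 1) * alt_count (reduced_nbc (Suc ` Ix) cone_rank)"
    by (rule alt_count_reduced_nbc(2)[OF mat _ _ conn]) (use finite_Ix ne in auto)
  ultimately show ?thesis unfolding alt_count_Suc_image[symmetric, of ?N] by auto
qed

end

section \<open>Products of arrangements\<close>

lemma hyperplane_nonempty:
  assumes "hyperplane l H" shows "\<exists>v\<in>carrier_vec l. v \<in> H"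
proof -
  obtain a c where a: "a \<in> carrier_vec l" "a \<noteq> 0\<^sub>v l" "H = {v \<in> carrier_vec l. a \<bullet> v = c}"
    using assms unfolding hyperplane_def by blast
  have "\<exists>k<l. a $ k \<noteq> 0"
  proof (rule ccontr)
    assume "\<not> ?thesis"
    then have "a = 0\<^sub>v l" using a(1) by (intro eq_vecI) auto
    then show False using a(2) by simp
  qed
  then obtain k where k: "k < l" "a $ k \<noteq> 0" by blast
  have "a \<bullet> ((c / a $ k) \<cdot>\<^sub>v unit_vec l k) = c" using a(1) k by (simp add: scalar_prod_right_unit)
  then show ?thesis unfolding a(3) by (intro bexI[of _ "(c / a $ k) \<cdot>\<^sub>v unit_vec l k"]) auto
qed

context hyperplane_system
begin

lemma cl_empty: "cl {} = {}"
  unfolding cl_def using G_proper by (auto simp: sys_def)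

lemma hyperplane_closure_sys:
  assumes "Ix = {..<n}"
  shows "hyperplane_closure n cmp cl (\<lambda>S. dependent l (G ` S))"
proof
  show "cmp S" if "cmp T" "S \<subseteq> T" for S T by (rule cmp_mono[OF that])
  show "cl S \<subseteq> {..<n}" for S using assms unfolding cl_def by blast
  show "cl {} = {}" by (rule cl_empty)
  show "S \<subseteq> cl S" if "S \<subseteq> {..<n}" for S using that assms unfolding cl_def sys_def by blast
  show "cl T \<subseteq> cl S" if "T \<subseteq> cl S" for S T using that unfolding cl_def sys_def by blast
  show "cmp (cl S)" if "cmp S" for S
  proof -
    have "sys S \<subseteq> sys (cl S)" unfolding cl_def sys_def by blast
    then show ?thesis using that unfolding cmp_def by blast
  qed
  show "dependent l (G ` S) \<longleftrightarrow> cmp S \<and> (\<exists>e\<in>S. e \<in> cl (S - {e}))" if "S \<subseteq> {..<n}" for S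
    by (rule dependent_iff_cl) (use that assms in simp)
  show "\<not> dependent l (G ` insert i T)"
    if h: "insert i T \<subseteq> {..<n}" "cmp (insert i T)" "\<not> dependent l (G ` T)" "i \<notin> cl T" for i T
  proof -
    have sub: "T \<subseteq> Ix" "i \<in> Ix" "insert i T \<subseteq> Ix" using h(1) assms by auto
    have fin: "finite T" using sub(1) finite_Ix finite_subset by blast
    have "i \<notin> T" using h(4) sub unfolding cl_def sys_def by blast
    moreover have "cmp T" using cmp_mono[OF h(2)] by blast
    then have "card T \<le> lin T" using h(3) dependent_iff_lin[OF sub(1)] by simp
    ultimately have "card (insert i T) \<le> lin (insert i T)"
      using lin_insert_cmp[OF sub(1,2) h(2)] h(4) fin by simp
    then show ?thesis using dependent_iff_lin[OF sub(3)] by simp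
  qed
qed

end

text \<open>An arrangement in coordinates that split the space into a product, with the hyperplanes of the \<open>j\<close>-th block
  being pulled back along the \<open>j\<close>-th coordinate from an irreducible arrangement. What matters about the
  coordinates is that their values can be prescribed independently.\<close>

locale decomposed_system = W: hyperplane_system l "{..<n}" H
  for l n and H :: "nat \<Rightarrow> complex vec set" +
  fixes m :: nat and d :: "nat \<Rightarrow> nat" and Blk :: "nat \<Rightarrow> nat set"
    and G :: "nat \<Rightarrow> nat \<Rightarrow> complex vec set" and coordinate :: "nat \<Rightarrow> complex vec \<Rightarrow> complex vec"
  assumes factor_system: "j < m \<Longrightarrow> hyperplane_system (d j) (Blk j) (G j)"
    and factor_irreducible: "j < m \<Longrightarrow> irreducible_arr (d j) (G j ` Blk j)"
    and cover: "(\<Union>j<m. Blk j) = {..<n}"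
    and coordinate_closed: "j < m \<Longrightarrow> v \<in> carrier_vec l \<Longrightarrow> coordinate j v \<in> carrier_vec (d j)"
    and mem_iff: "j < m \<Longrightarrow> i \<in> Blk j \<Longrightarrow> v \<in> carrier_vec l \<Longrightarrow> v \<in> H i \<longleftrightarrow> coordinate j v \<in> G j i"
    and lift: "(\<And>j. j < m \<Longrightarrow> u j \<in> carrier_vec (d j)) \<Longrightarrow> \<exists>v\<in>carrier_vec l. \<forall>j<m. coordinate j v = u j"
begin

abbreviation "fsys j \<equiv> hyperplane_system.sys (d j) (G j)"
abbreviation "fcmp j \<equiv> hyperplane_system.cmp (d j) (G j)"
abbreviation "fcl j \<equiv> hyperplane_system.cl (d j) (Blk j) (G j)"

lemma fsys_iff: "j < m \<Longrightarrow> u \<in> fsys j S \<longleftrightarrow> u \<in> carrier_vec (d j) \<and> (\<forall>i\<in>S. u \<in> G j i)"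
  using hyperplane_system.sys_def[OF factor_system] by blast

lemma fcmp_iff: "j < m \<Longrightarrow> fcmp j S \<longleftrightarrow> (\<exists>u. u \<in> fsys j S)"
  using hyperplane_system.cmp_def[OF factor_system] by blast

lemma fcl_iff: "j < m \<Longrightarrow> e \<in> fcl j S \<longleftrightarrow> e \<in> Blk j \<and> (\<forall>u\<in>fsys j S. u \<in> G j e)"
  using hyperplane_system.cl_def[OF factor_system] by blast

lemma Blk_sub: "j < m \<Longrightarrow> Blk j \<subseteq> {..<n}"
  using cover by blast

lemma sys_iff_coordinates:
  assumes "S \<subseteq> {..<n}" "v \<in> carrier_vec l"
  shows "v \<in> W.sys S \<longleftrightarrow> (\<forall>j<m. coordinate j v \<in> fsys j (S \<inter> Blk j))"
proof
  assume v: "v \<in> W.sys S"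
  show "\<forall>j<m. coordinate j v \<in> fsys j (S \<inter> Blk j)"
  proof (intro allI impI)
    fix j assume j: "j < m"
    have "coordinate j v \<in> G j i" if "i \<in> S \<inter> Blk j" for i
      using mem_iff[OF j _ assms(2), of i] that v unfolding W.sys_def by blast
    then show "coordinate j v \<in> fsys j (S \<inter> Blk j)"
      unfolding fsys_iff[OF j] using coordinate_closed[OF j assms(2)] by simp
  qed
next
  assume c: "\<forall>j<m. coordinate j v \<in> fsys j (S \<inter> Blk j)"
  have "v \<in> H i" if i: "i \<in> S" for i
  proof -
    obtain j where j: "j < m" "i \<in> Blk j" using assms(1) i cover by blast
    have "coordinate j v \<in> fsys j (S \<inter> Blk j)" using c j(1) by simp
    then have "coordinate j v \<in> G j i" unfolding fsys_iff[OF j(1)] using i j(2) by simp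
    then show ?thesis using mem_iff[OF j assms(2)] by blast
  qed
  then show "v \<in> W.sys S" unfolding W.sys_def using assms(2) by blast
qed

lemma lift_one:
  assumes j: "j < m" and u: "u \<in> carrier_vec (d j)" and p: "p \<in> carrier_vec l"
  shows "\<exists>v\<in>carrier_vec l. coordinate j v = u \<and> (\<forall>k<m. k \<noteq> j \<longrightarrow> coordinate k v = coordinate k p)"
proof -
  have "\<exists>v\<in>carrier_vec l. \<forall>k<m. coordinate k v = (if k = j then u else coordinate k p)"
    by (rule lift) (use u coordinate_closed[OF _ p] in auto)
  then obtain v where v: "v \<in> carrier_vec l"
    "\<forall>k<m. coordinate k v = (if k = j then u else coordinate k p)" by blast
  then have "coordinate j v = u" "\<forall>k<m. k \<noteq> j \<longrightarrow> coordinate k v = coordinate k p" using j by simp_all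
  then show ?thesis using v(1) by blast
qed

text \<open>A hyperplane in two blocks would be pulled back along two independent coordinates: prescribing a point
  inside for one of them and a point outside for the other gives a contradiction.\<close>

lemma disjoint: assumes jk: "j < m" "k < m" "j \<noteq> k" shows "Blk j \<inter> Blk k = {}"
proof (rule ccontr)
  assume "Blk j \<inter> Blk k \<noteq> {}"
  then obtain i where i: "i \<in> Blk j" "i \<in> Blk k" by blast
  obtain a where a: "a \<in> carrier_vec (d j)" "a \<in> G j i"
    using hyperplane_nonempty[OF hyperplane_system.hyp[OF factor_system[OF jk(1)] i(1)]] by blast
  obtain b where b: "b \<in> carrier_vec (d k)" "b \<notin> G k i"
    using hyperplane_system.G_proper[OF factor_system[OF jk(2)] i(2)] by blast
  obtain p where p: "p \<in> carrier_vec l" "coordinate k p = b"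
    using lift_one[OF jk(2) b(1), of "0\<^sub>v l"] by auto
  obtain v where v: "v \<in> carrier_vec l" "coordinate j v = a" "coordinate k v = b"
    using lift_one[OF jk(1) a(1) p(1)] jk p(2) by metis
  show False using mem_iff[OF jk(1) i(1) v(1)] mem_iff[OF jk(2) i(2) v(1)] v a b by simp
qed

lemma nonempty: assumes j: "j < m" shows "Blk j \<noteq> {}"
proof
  assume e: "Blk j = {}"
  have "arrangement (d j) (G j ` Blk j)" "d j > 0" using factor_irreducible[OF j] unfolding irreducible_arr_def by blast+
  then have "hyperplane_system.lin (d j) (G j) {} = d j"
    using hyperplane_system.essential_dirs(2)[OF factor_system[OF j]] e by simp
  then show False using hyperplane_system.lin_empty[OF factor_system[OF j]] \<open>d j > 0\<close> by simp
qed

lemma cmp_iff_factors: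
  assumes S: "S \<subseteq> {..<n}"
  shows "W.cmp S \<longleftrightarrow> (\<forall>j<m. fcmp j (S \<inter> Blk j))"
proof
  assume "W.cmp S"
  then obtain v where v: "v \<in> W.sys S" unfolding W.cmp_def by blast
  then have "v \<in> carrier_vec l" unfolding W.sys_def by blast
  then have "\<forall>j<m. coordinate j v \<in> fsys j (S \<inter> Blk j)" using v sys_iff_coordinates[OF S] by simp
  then show "\<forall>j<m. fcmp j (S \<inter> Blk j)" using fcmp_iff by fast
next
  assume "\<forall>j<m. fcmp j (S \<inter> Blk j)"
  then have "\<forall>j. \<exists>u. j < m \<longrightarrow> u \<in> fsys j (S \<inter> Blk j)" using fcmp_iff by simp
  from choice[OF this] obtain u where u: "\<And>j. j < m \<Longrightarrow> u j \<in> fsys j (S \<inter> Blk j)" by blast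
  have "\<exists>v\<in>carrier_vec l. \<forall>j<m. coordinate j v = u j"
  proof (rule lift)
    show "u j \<in> carrier_vec (d j)" if "j < m" for j using u[OF that] unfolding fsys_iff[OF that] by blast
  qed
  then obtain v where "v \<in> carrier_vec l" "\<forall>j<m. coordinate j v = u j" by blast
  then have "v \<in> W.sys S" using sys_iff_coordinates[OF S] u by simp
  then show "W.cmp S" unfolding W.cmp_def by blast
qed

lemma cmp_block:
  assumes j: "j < m" and S: "S \<subseteq> Blk j"
  shows "W.cmp S \<longleftrightarrow> fcmp j S"
proof -
  have sub: "S \<subseteq> {..<n}" using S Blk_sub[OF j] by blast
  have "fcmp k (S \<inter> Blk k)" if "k < m" "k \<noteq> j" for k
  proof -
    have "S \<inter> Blk k = {}" using disjoint[OF j that(1)] that(2) S by blast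
    then show ?thesis using hyperplane_system.cmp_empty[OF factor_system[OF that(1)]] by simp
  qed
  note others = this
  have Sj: "S \<inter> Blk j = S" using S by blast
  show ?thesis unfolding cmp_iff_factors[OF sub]
  proof
    assume "\<forall>k<m. fcmp k (S \<inter> Blk k)"
    then show "fcmp j S" using j Sj by force
  next
    assume "fcmp j S"
    then show "\<forall>k<m. fcmp k (S \<inter> Blk k)" using others Sj by force
  qed
qed

text \<open>Membership of a point in a hyperplane of block \<open>j\<close> depends only on the \<open>j\<close>-th coordinate, and this coordinate
  can be varied on its own while the point stays in the hyperplanes of the other blocks.\<close>

lemma cl_iff_factor:
  assumes S: "S \<subseteq> {..<n}" "W.cmp S" and j: "j < m" "e \<in> Blk j"
  shows "e \<in> W.cl S \<longleftrightarrow> e \<in> fcl j (S \<inter> Blk j)"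
proof
  assume e: "e \<in> W.cl S"
  obtain p where p: "p \<in> W.sys S" using S(2) unfolding W.cmp_def by blast
  then have pc: "p \<in> carrier_vec l" unfolding W.sys_def by blast
  have "u \<in> G j e" if u: "u \<in> fsys j (S \<inter> Blk j)" for u
  proof -
    have "u \<in> carrier_vec (d j)" using u unfolding fsys_iff[OF j(1)] by blast
    from lift_one[OF j(1) this pc] obtain v where v: "v \<in> carrier_vec l" "coordinate j v = u"
      "\<forall>k<m. k \<noteq> j \<longrightarrow> coordinate k v = coordinate k p" by blast
    have "coordinate k v \<in> fsys k (S \<inter> Blk k)" if "k < m" for k
      using p sys_iff_coordinates[OF S(1) pc] v u that by (cases "k = j") auto
    then have "v \<in> W.sys S" unfolding sys_iff_coordinates[OF S(1) v(1)] by simp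
    then have "v \<in> H e" using e unfolding W.cl_def by blast
    then show ?thesis using mem_iff[OF j v(1)] v(2) by simp
  qed
  then show "e \<in> fcl j (S \<inter> Blk j)" unfolding fcl_iff[OF j(1)] using j(2) by simp
next
  assume e: "e \<in> fcl j (S \<inter> Blk j)"
  have "v \<in> H e" if v: "v \<in> W.sys S" for v
  proof -
    have vc: "v \<in> carrier_vec l" using v unfolding W.sys_def by blast
    have "coordinate j v \<in> fsys j (S \<inter> Blk j)" using sys_iff_coordinates[OF S(1) vc] v j(1) by simp
    then have "coordinate j v \<in> G j e" using e unfolding fcl_iff[OF j(1)] by simp
    then show ?thesis unfolding mem_iff[OF j vc] .
  qed
  then show "e \<in> W.cl S" unfolding W.cl_def using Blk_sub[OF j(1)] j(2) by blast
qed

definition central_blocks :: "nat set" where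
  "central_blocks = {j. j < m \<and> fcmp j (Blk j)}"

lemma os_blocks_decomposed:
  "os_blocks n W.cmp W.cl (\<lambda>S. dependent l (H ` S)) m Blk central_blocks"
proof -
  interpret hyperplane_closure n W.cmp W.cl "\<lambda>S. dependent l (H ` S)"
    by (rule W.hyperplane_closure_sys) simp
  show ?thesis
  proof
    show "(\<Union>j<m. Blk j) = {..<n}" by (rule cover)
    show "Blk i \<inter> Blk j = {}" if "i < m" "j < m" "i \<noteq> j" for i j by (rule disjoint[OF that])
    show "Blk j \<noteq> {}" if "j < m" for j by (rule nonempty[OF that])
    show "W.cmp S \<longleftrightarrow> (\<forall>j<m. W.cmp (S \<inter> Blk j))" if "S \<subseteq> {..<n}" for S
      unfolding cmp_iff_factors[OF that] using cmp_block[OF _ Int_lower2] by simp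
    show "e \<in> W.cl S \<longleftrightarrow> e \<in> W.cl (S \<inter> Blk j)"
      if h: "S \<subseteq> {..<n}" "W.cmp S" "j < m" "e \<in> Blk j" for S j e
    proof -
      have "S \<inter> Blk j \<subseteq> {..<n}" "W.cmp (S \<inter> Blk j)" using h(1) W.cmp_mono[OF h(2)] by blast+
      from cl_iff_factor[OF this h(3,4)] cl_iff_factor[OF h] show ?thesis by (simp add: Int_assoc)
    qed
    show "central_blocks \<subseteq> {..<m}" unfolding central_blocks_def by blast
    show "W.cmp (Blk j)" if "j \<in> central_blocks" for j
      using that cmp_block[of j "Blk j"] unfolding central_blocks_def by simp
  qed
qed

text \<open>The combinatorics of a block is that of the corresponding irreducible factor.\<close>

lemma alt_count_block:
  assumes j: "j < m"
  shows "alt_count (os_blocks.block_reduced W.cmp W.cl Blk central_blocks j) \<noteq> 0"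
proof -
  \<comment> \<open>The sets in question do not involve the field of coefficients, so any field serves.\<close>
  interpret os_blocks n W.cmp W.cl "\<lambda>S. dependent l (H ` S)" "TYPE(rat)" m Blk central_blocks
    by (rule os_blocks_decomposed)
  interpret F: hyperplane_system "d j" "Blk j" "G j" by (rule factor_system[OF j])
  let ?c = "\<lambda>S. S \<subseteq> Blk j \<and> F.cmp S \<and> (\<forall>e\<in>Blk j. e \<notin> F.cl {s \<in> S. e < s})"
  have iff: "S \<subseteq> Blk j \<and> W.cmp S \<and> (\<forall>e\<in>Blk j. e \<notin> W.cl {s \<in> S. e < s}) \<longleftrightarrow> ?c S" for S
  proof (cases "S \<subseteq> Blk j \<and> F.cmp S")
    case True
    have "e \<in> W.cl {s \<in> S. e < s} \<longleftrightarrow> e \<in> F.cl {s \<in> S. e < s}" if e: "e \<in> Blk j" for e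
    proof -
      have sub: "{s \<in> S. e < s} \<subseteq> Blk j" "{s \<in> S. e < s} \<subseteq> {..<n}" using True Blk_sub[OF j] by auto
      have "F.cmp {s \<in> S. e < s}" by (rule F.cmp_mono[of S]) (use True in auto)
      then have "W.cmp {s \<in> S. e < s}" using cmp_block[OF j sub(1)] by simp
      from cl_iff_factor[OF sub(2) this j e] show ?thesis using sub(1) by (simp add: Int_absorb2)
    qed
    then show ?thesis using True cmp_block[OF j, of S] by simp
  next
    case False
    then show ?thesis using cmp_block[OF j, of S] by blast
  qed
  show ?thesis
  proof (cases "j \<in> central_blocks")
    case True
    then have c: "F.cmp (Blk j)" unfolding central_blocks_def by blast
    have "block_reduced j = {S. S \<subseteq> Blk j \<and> F.cmp S \<and> (\<forall>e\<in>Blk j. e \<notin> F.cl {s \<in> S. e < s}) \<and> Min (Blk j) \<notin> S}"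
      unfolding block_reduced_def block_root_def using iff True by blast
    then show ?thesis using F.central_count[OF factor_irreducible[OF j] c] by simp
  next
    case False
    then have c: "\<not> F.cmp (Blk j)" unfolding central_blocks_def using j by blast
    have "block_reduced j = {S. S \<subseteq> Blk j \<and> F.cmp S \<and> (\<forall>e\<in>Blk j. e \<notin> F.cl {s \<in> S. e < s})}"
      unfolding block_reduced_def using iff False by blast
    then show ?thesis using F.noncentral_count[OF factor_irreducible[OF j] c] by simp
  qed
qed

end

subsection \<open>Coordinates of a product of arrangements\<close>

fun component :: "arr_family \<Rightarrow> nat \<Rightarrow> complex vec \<Rightarrow> complex vec" where
  "component [] j w = w"
| "component ((l, B) # Fs) 0 w = vec_first w l"
| "component ((l, B) # Fs) (Suc j) w = component Fs j (vec_last w (total_dim Fs))"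

lemma total_dim_simps [simp]: "total_dim [] = 0" "total_dim ((l, B) # Fs) = l + total_dim Fs"
  by (simp_all add: total_dim_def)

lemma component_closed:
  "w \<in> carrier_vec (total_dim Fs) \<Longrightarrow> j < length Fs \<Longrightarrow> component Fs j w \<in> carrier_vec (fst (Fs ! j))"
proof (induction Fs j w rule: component.induct)
  case (3 l B Fs j w)
  then show ?case by simp
qed simp_all

lemma vec_first_append: "u \<in> carrier_vec l \<Longrightarrow> vec_first (u @\<^sub>v v) l = u"
  unfolding vec_first_def by (intro eq_vecI) auto

lemma vec_last_append: "v \<in> carrier_vec k \<Longrightarrow> vec_last (u @\<^sub>v v) k = v"
  unfolding vec_last_def by (intro eq_vecI) auto

lemma component_surj:
  assumes "\<And>j. j < length Fs \<Longrightarrow> u j \<in> carrier_vec (fst (Fs ! j))"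
  shows "\<exists>w\<in>carrier_vec (total_dim Fs). \<forall>j<length Fs. component Fs j w = u j"
  using assms
proof (induction Fs arbitrary: u)
  case Nil
  show ?case by (intro bexI[of _ "0\<^sub>v 0"]) auto
next
  case (Cons F Fs)
  obtain l B where F: "F = (l, B)" by (cases F)
  have "\<exists>w\<in>carrier_vec (total_dim Fs). \<forall>j<length Fs. component Fs j w = u (Suc j)"
  proof (rule Cons.IH)
    show "u (Suc j) \<in> carrier_vec (fst (Fs ! j))" if "j < length Fs" for j
      using Cons.prems[of "Suc j"] that by simp
  qed
  then obtain w where w: "w \<in> carrier_vec (total_dim Fs)" "\<forall>j<length Fs. component Fs j w = u (Suc j)" by blast
  have u0: "u 0 \<in> carrier_vec l" using Cons.prems[of 0] F by simp
  have "component (F # Fs) j (u 0 @\<^sub>v w) = u j" if "j < length (F # Fs)" for j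
    using that w u0 vec_first_append[OF u0, of w] vec_last_append[OF w(1), of "u 0"] by (cases j) (auto simp: F)
  moreover have "u 0 @\<^sub>v w \<in> carrier_vec (total_dim (F # Fs))" using u0 w(1) by (simp add: F)
  ultimately show ?case by blast
qed

lemma vprod_carrier_right:
  assumes "H \<subseteq> carrier_vec l"
  shows "vprod H (carrier_vec k) = {w \<in> carrier_vec (l + k). vec_first w l \<in> H}"
proof (intro equalityI subsetI)
  fix w assume "w \<in> vprod H (carrier_vec k)"
  then obtain u v where w: "w = u @\<^sub>v v" "u \<in> H" "v \<in> carrier_vec k" unfolding vprod_def by blast
  have u: "u \<in> carrier_vec l" using w(2) assms by blast
  show "w \<in> {w \<in> carrier_vec (l + k). vec_first w l \<in> H}"
    using w u vec_first_append[OF u, of v] by simp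
next
  fix w assume "w \<in> {w \<in> carrier_vec (l + k). vec_first w l \<in> H}"
  then have w: "w \<in> carrier_vec (l + k)" "vec_first w l \<in> H" by blast+
  have "w = vec_first w l @\<^sub>v vec_last w k" using vec_first_last_append[OF w(1)] by simp
  then show "w \<in> vprod H (carrier_vec k)" unfolding vprod_def using w(2) vec_last_carrier by blast
qed

lemma vprod_carrier_left:
  assumes "H \<subseteq> carrier_vec k"
  shows "vprod (carrier_vec l) H = {w \<in> carrier_vec (l + k). vec_last w k \<in> H}"
proof (intro equalityI subsetI)
  fix w assume "w \<in> vprod (carrier_vec l) H"
  then obtain u v where w: "w = u @\<^sub>v v" "u \<in> carrier_vec l" "v \<in> H" unfolding vprod_def by blast
  have v: "v \<in> carrier_vec k" using w(3) assms by blast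
  show "w \<in> {w \<in> carrier_vec (l + k). vec_last w k \<in> H}"
    using w v vec_last_append[OF v, of u] by simp
next
  fix w assume "w \<in> {w \<in> carrier_vec (l + k). vec_last w k \<in> H}"
  then have w: "w \<in> carrier_vec (l + k)" "vec_last w k \<in> H" by blast+
  have "w = vec_first w l @\<^sub>v vec_last w k" using vec_first_last_append[OF w(1)] by simp
  then show "w \<in> vprod (carrier_vec l) H" unfolding vprod_def using w(2) vec_first_carrier by blast
qed

text \<open>The hyperplanes of the \<open>j\<close>-th factor become cylinders over the \<open>j\<close>-th component.\<close>

lemma factor_images_eq:
  assumes "\<And>m B H. (m, B) \<in> set Fs \<Longrightarrow> H \<in> B \<Longrightarrow> H \<subseteq> carrier_vec m" and "j < length Fs"
  shows "factor_images Fs ! j = (\<lambda>H. {w \<in> carrier_vec (total_dim Fs). component Fs j w \<in> H}) ` snd (Fs ! j)"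
  using assms
proof (induction Fs arbitrary: j)
  case (Cons F Fs)
  obtain l B where F: "F = (l, B)" by (cases F)
  show ?case
  proof (cases j)
    case 0
    have "H \<subseteq> carrier_vec l" if "H \<in> B" for H by (rule Cons.prems(1)[of l B]) (use F that in auto)
    then have "(\<lambda>H. vprod H (carrier_vec (total_dim Fs))) ` B =
        (\<lambda>H. {w \<in> carrier_vec (l + total_dim Fs). vec_first w l \<in> H}) ` B"
      by (intro image_cong refl vprod_carrier_right)
    then show ?thesis unfolding 0 F by simp
  next
    case (Suc k)
    have k: "k < length Fs" using Cons.prems(2) Suc by simp
    have "factor_images Fs ! k = (\<lambda>H. {w \<in> carrier_vec (total_dim Fs). component Fs k w \<in> H}) ` snd (Fs ! k)"
      by (rule Cons.IH[OF _ k]) (use Cons.prems(1) in auto)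
    then have "factor_images (F # Fs) ! j =
      (\<lambda>H. vprod (carrier_vec l) {w \<in> carrier_vec (total_dim Fs). component Fs k w \<in> H}) ` snd (Fs ! k)"
      using k by (simp add: F Suc image_image)
    also have "\<dots> = (\<lambda>H. {w \<in> carrier_vec (total_dim (F # Fs)). component (F # Fs) j w \<in> H}) ` snd (Fs ! k)"
    proof (rule image_cong[OF refl])
      fix H
      show "vprod (carrier_vec l) {w \<in> carrier_vec (total_dim Fs). component Fs k w \<in> H} =
        {w \<in> carrier_vec (total_dim (F # Fs)). component (F # Fs) j w \<in> H}"
        by (subst vprod_carrier_left) (auto simp: F Suc)
    qed
    finally show ?thesis by (simp add: Suc)
  qed
qed simp

lemma affine_change_bij:
  assumes "affine_change l \<phi>"
  shows "inj_on \<phi> (carrier_vec l)" "\<phi> ` carrier_vec l = carrier_vec l"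
proof -
  obtain P b where P: "P \<in> carrier_mat l l" "b \<in> carrier_vec l" "invertible_mat P"
    "\<And>v. v \<in> carrier_vec l \<Longrightarrow> \<phi> v = P *\<^sub>v v + b" using assms unfolding affine_change_def by blast
  obtain Q where Q: "inverts_mat P Q" "inverts_mat Q P" using P(3) unfolding invertible_mat_def by blast
  have PQ: "P * Q = 1\<^sub>m l" using Q(1) P(1) unfolding inverts_mat_def by simp
  have "dim_col (P * Q) = l" unfolding PQ by simp
  then have dc: "dim_col Q = l" by simp
  have QP': "Q * P = 1\<^sub>m (dim_row Q)" using Q(2) unfolding inverts_mat_def .
  have "dim_col (Q * P) = dim_row Q" unfolding QP' by simp
  then have dr: "dim_row Q = l" using P(1) by simp
  have Qc: "Q \<in> carrier_mat l l" using dc dr by blast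
  have QP: "Q * P = 1\<^sub>m l" using QP' dr by simp
  have Pv: "P *\<^sub>v v \<in> carrier_vec l" if "v \<in> carrier_vec l" for v using P(1) that by simp
  have Qv: "Q *\<^sub>v v \<in> carrier_vec l" if "v \<in> carrier_vec l" for v using Qc that by simp
  have QPv: "Q *\<^sub>v (P *\<^sub>v v) = v" if "v \<in> carrier_vec l" for v
    using assoc_mult_mat_vec[OF Qc P(1) that] QP that by simp
  have PQv: "P *\<^sub>v (Q *\<^sub>v v) = v" if "v \<in> carrier_vec l" for v
    using assoc_mult_mat_vec[OF P(1) Qc that] PQ that by simp
  have cancel: "(a + b) - b = a" "(a - b) + b = a" if "a \<in> carrier_vec l" for a :: "complex vec"
    using that P(2) by (auto intro!: eq_vecI)
  have inv: "Q *\<^sub>v (\<phi> v - b) = v" if "v \<in> carrier_vec l" for v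
    using P(4)[OF that] cancel(1)[OF Pv[OF that]] QPv[OF that] by simp
  show "inj_on \<phi> (carrier_vec l)" by (rule inj_on_inverseI[where g = "\<lambda>w. Q *\<^sub>v (w - b)"]) (rule inv)
  show "\<phi> ` carrier_vec l = carrier_vec l"
  proof (intro equalityI subsetI)
    fix w assume "w \<in> \<phi> ` carrier_vec l"
    then show "w \<in> carrier_vec l" using P(2,4) Pv by auto
  next
    fix w :: "complex vec" assume w: "w \<in> carrier_vec l"
    let ?v = "Q *\<^sub>v (w - b)"
    have wb: "w - b \<in> carrier_vec l" using w P(2) by simp
    have "\<phi> ?v = w" using P(4)[OF Qv[OF wb]] PQv[OF wb] cancel(2)[OF w] by simp
    then show "w \<in> \<phi> ` carrier_vec l" using Qv[OF wb] by force
  qed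
qed

lemma hyperplane_carrier: "hyperplane l H \<Longrightarrow> H \<subseteq> carrier_vec l"
  unfolding hyperplane_def by blast

text \<open>The coordinates are the components of the affine change of coordinates \<open>\<phi>\<close>. A hyperplane \<open>H\<close> of the
  \<open>j\<close>-th block is mapped by \<open>\<phi>\<close> to a cylinder over a unique hyperplane of the \<open>j\<close>-th factor, which is
  the value of \<open>G\<close>.\<close>

theorem decomposed_system_exists:
  assumes A: "arrangement l A" and Hs: "distinct Hs" "set Hs = A" "length Hs = n"
    and dec: "irreducible_decomposition l A Fs \<phi>"
  shows "\<exists>G. decomposed_system l n ((!) Hs) (length Fs) (\<lambda>j. fst (Fs ! j))
      (\<lambda>j. {i. i < n \<and> Hs ! i \<in> factor_of A Fs \<phi> j}) G (\<lambda>j v. component Fs j (\<phi> v)) \<and>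
    (\<forall>j<length Fs. G j ` {i. i < n \<and> Hs ! i \<in> factor_of A Fs \<phi> j} = snd (Fs ! j))"
proof -
  let ?m = "length Fs" and ?B = "\<lambda>j. {i. i < n \<and> Hs ! i \<in> factor_of A Fs \<phi> j}"
  have irr: "\<And>m B. (m, B) \<in> set Fs \<Longrightarrow> irreducible_arr m B" and ltd: "l = total_dim Fs"
    and aff: "affine_change l \<phi>" and img: "(`) \<phi> ` A = family_prod Fs"
    using dec unfolding irreducible_decomposition_def by blast+
  have irrj: "irreducible_arr (fst (Fs ! j)) (snd (Fs ! j))" if "j < ?m" for j
    using irr[of "fst (Fs ! j)" "snd (Fs ! j)"] nth_mem[OF that] by simp
  then have hypj: "hyperplane (fst (Fs ! j)) K" if "j < ?m" "K \<in> snd (Fs ! j)" for j K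
    using that unfolding irreducible_arr_def arrangement_def by blast
  note bij = affine_change_bij[OF aff]
  have hypA: "hyperplane l (Hs ! i)" if "i < n" for i
    using A Hs that nth_mem[of i Hs] unfolding arrangement_def by simp
  have phic: "\<phi> v \<in> carrier_vec l" if "v \<in> carrier_vec l" for v using bij(2) that by blast
  define cyl where "cyl j K = {w \<in> carrier_vec (total_dim Fs). component Fs j w \<in> K}" for j K
  have fi: "factor_images Fs ! j = cyl j ` snd (Fs ! j)" if "j < ?m" for j
    unfolding cyl_def
  proof (rule factor_images_eq[OF _ that])
    fix m B K assume "(m, B) \<in> set Fs" "K \<in> B"
    then have "hyperplane m K" using irr[of m B] unfolding irreducible_arr_def arrangement_def by simp
    then show "K \<subseteq> carrier_vec m" by (rule hyperplane_carrier)
  qed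
  define G where "G j i = (SOME K. K \<in> snd (Fs ! j) \<and> \<phi> ` (Hs ! i) = cyl j K)" for j i
  have G: "G j i \<in> snd (Fs ! j)" "\<phi> ` (Hs ! i) = cyl j (G j i)" if "j < ?m" "i \<in> ?B j" for j i
  proof -
    have "\<phi> ` (Hs ! i) \<in> factor_images Fs ! j" using that(2) unfolding factor_of_def by blast
    then have "\<exists>K. K \<in> snd (Fs ! j) \<and> \<phi> ` (Hs ! i) = cyl j K" unfolding fi[OF that(1)] by blast
    from someI_ex[OF this] show "G j i \<in> snd (Fs ! j)" "\<phi> ` (Hs ! i) = cyl j (G j i)"
      unfolding G_def by blast+
  qed
  have lift: "\<exists>v\<in>carrier_vec l. \<forall>j<?m. component Fs j (\<phi> v) = u j"
    if u: "\<And>j. j < ?m \<Longrightarrow> u j \<in> carrier_vec (fst (Fs ! j))" for u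
  proof -
    obtain w where w: "w \<in> carrier_vec (total_dim Fs)" "\<forall>j<?m. component Fs j w = u j"
      using component_surj[of Fs u] u by blast
    have "w \<in> \<phi> ` carrier_vec l" unfolding bij(2) using w(1) ltd by simp
    then obtain v where "v \<in> carrier_vec l" "w = \<phi> v" by (rule imageE)
    then show ?thesis using w(2) by (intro bexI[of _ v]) simp_all
  qed
  have mem: "v \<in> Hs ! i \<longleftrightarrow> component Fs j (\<phi> v) \<in> G j i"
    if h: "j < ?m" "i \<in> ?B j" "v \<in> carrier_vec l" for j i v
  proof -
    have "Hs ! i \<subseteq> carrier_vec l" by (rule hyperplane_carrier[OF hypA]) (use h(2) in simp)
    then have "v \<in> Hs ! i \<longleftrightarrow> \<phi> v \<in> \<phi> ` (Hs ! i)" using inj_on_image_mem_iff[OF bij(1) h(3)] by simp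
    then show ?thesis unfolding G(2)[OF h(1,2)] cyl_def using phic[OF h(3)] ltd by simp
  qed
  have cyl_inj: "K = K'" if h: "j < ?m" "K \<in> snd (Fs ! j)" "K' \<in> snd (Fs ! j)" "cyl j K = cyl j K'" for j K K'
  proof -
    have "u \<in> K \<longleftrightarrow> u \<in> K'" if u: "u \<in> carrier_vec (fst (Fs ! j))" for u
    proof -
      have "\<exists>w\<in>carrier_vec (total_dim Fs). \<forall>k<?m. component Fs k w = (if k = j then u else 0\<^sub>v (fst (Fs ! k)))"
        by (rule component_surj) (use u in auto)
      then obtain w where "w \<in> carrier_vec (total_dim Fs)" "component Fs j w = u" using h(1) by auto
      then show ?thesis using h(4) unfolding cyl_def by blast
    qed
    moreover have "K \<subseteq> carrier_vec (fst (Fs ! j))" "K' \<subseteq> carrier_vec (fst (Fs ! j))"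
      by (rule hyperplane_carrier[OF hypj[OF h(1,2)]], rule hyperplane_carrier[OF hypj[OF h(1,3)]])
    ultimately show ?thesis by blast
  qed
  have inj_image: "i = i'" if "i < n" "i' < n" "\<phi> ` (Hs ! i) = \<phi> ` (Hs ! i')" for i i'
  proof -
    have "Hs ! i = Hs ! i'"
      using inj_on_image_eq_iff[OF bij(1) hyperplane_carrier[OF hypA[OF that(1)]] hyperplane_carrier[OF hypA[OF that(2)]]]
        that(3) by simp
    then show ?thesis using that Hs by (simp add: nth_eq_iff_index_eq)
  qed
  have Gimg: "G j ` ?B j = snd (Fs ! j)" if j: "j < ?m" for j
  proof (intro equalityI subsetI)
    fix K assume "K \<in> G j ` ?B j" then show "K \<in> snd (Fs ! j)" using G(1)[OF j] by blast
  next
    fix K assume K: "K \<in> snd (Fs ! j)"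
    then have c: "cyl j K \<in> factor_images Fs ! j" using fi[OF j] by blast
    moreover have "factor_images Fs ! j \<in> set (factor_images Fs)" using j by simp
    ultimately have "cyl j K \<in> family_prod Fs" unfolding family_prod_eq_Union by blast
    then obtain H where H: "H \<in> A" "\<phi> ` H = cyl j K" unfolding img[symmetric] by auto
    then obtain i where i: "i < n" "Hs ! i = H" using Hs by (metis in_set_conv_nth)
    have iB: "i \<in> ?B j" unfolding factor_of_def using i H c by simp
    have "G j i = K" using cyl_inj[OF j G(1)[OF j iB] K] G(2)[OF j iB] H(2) i(2) by simp
    then show "K \<in> G j ` ?B j" using iB by blast
  qed
  have sys: "hyperplane_system (fst (Fs ! j)) (?B j) (G j)" if j: "j < ?m" for j
  proof
    show "finite (?B j)" by simp
    show "hyperplane (fst (Fs ! j)) (G j i)" if "i \<in> ?B j" for i by (rule hypj[OF j G(1)[OF j that]])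
    show "inj_on (G j) (?B j)"
    proof (rule inj_onI)
      fix i i' assume h: "i \<in> ?B j" "i' \<in> ?B j" "G j i = G j i'"
      then show "i = i'" using G(2)[OF j h(1)] G(2)[OF j h(2)] inj_image by auto
    qed
  qed
  have cover: "(\<Union>j<?m. ?B j) = {..<n}"
  proof (intro equalityI subsetI)
    fix i assume i: "i \<in> {..<n}"
    then have iA: "Hs ! i \<in> A" using Hs by auto
    then have "\<phi> ` (Hs ! i) \<in> \<Union> (set (factor_images Fs))" using img unfolding family_prod_eq_Union by blast
    then obtain j where "j < ?m" "\<phi> ` (Hs ! i) \<in> factor_images Fs ! j"
      by (auto simp: in_set_conv_nth)
    then show "i \<in> (\<Union>j<?m. ?B j)" using i iA unfolding factor_of_def by blast
  qed auto
  have W: "hyperplane_system l {..<n} ((!) Hs)"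
  proof
    show "inj_on ((!) Hs) {..<n}" using Hs by (simp add: inj_on_nth)
  qed (use hypA in auto)
  have "decomposed_system l n ((!) Hs) ?m (\<lambda>j. fst (Fs ! j)) ?B G (\<lambda>j v. component Fs j (\<phi> v))"
  proof (intro decomposed_system.intro[OF W] decomposed_system_axioms.intro)
    show "irreducible_arr (fst (Fs ! j)) (G j ` ?B j)" if "j < ?m" for j
      unfolding Gimg[OF that] by (rule irrj[OF that])
    show "component Fs j (\<phi> v) \<in> carrier_vec (fst (Fs ! j))" if "j < ?m" "v \<in> carrier_vec l" for j v
      by (rule component_closed[OF _ that(1)]) (use phic[OF that(2)] ltd in simp)
  qed (fact sys cover mem lift)+
  then show ?thesis using Gimg by blast
qed

theorem corollary2p3:
  fixes l n :: nat and A :: "complex vec set set" and Hs :: "complex vec set list"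
    and Fs :: arr_family and \<phi> :: "complex vec \<Rightarrow> complex vec"
    and OS :: "(nat set \<Rightarrow> 'k::field, (nat set \<Rightarrow> 'k) set) module"
  assumes "arrangement l A"
    and "distinct Hs" and "set Hs = A" and "length Hs = n"
    and "irreducible_decomposition l A Fs \<phi>"
    and "OS = os_algebra l Hs"
  shows "singular_variety n OS =
           {x \<in> ext_grade n 1. \<forall>j \<in> central_factors Fs.
              (\<Sum>i | i < n \<and> Hs ! i \<in> factor_of A Fs \<phi> j. coord i x) = 0}
       \<and> VectorSpace.subspace class_ring (singular_variety n OS)
           (ext_subspace n (ext_grade n 1))
       \<and> vectorspace.dim class_ring (ext_subspace n (ext_grade n 1 :: (nat set \<Rightarrow> 'k) set))
           = vectorspace.dim class_ring (ext_subspace n (singular_variety n OS))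
             + card (central_factors Fs)"
proof -
  let ?B = "\<lambda>j. {i. i < n \<and> Hs ! i \<in> factor_of A Fs \<phi> j}"
  obtain G where DG: "decomposed_system l n ((!) Hs) (length Fs) (\<lambda>j. fst (Fs ! j)) ?B G (\<lambda>j v. component Fs j (\<phi> v)) \<and>
      (\<forall>j<length Fs. G j ` ?B j = snd (Fs ! j))"
    using decomposed_system_exists[OF assms(1-5)] by (rule exE)
  note D = conjunct1[OF DG]
  have Gimg: "G j ` ?B j = snd (Fs ! j)" if "j < length Fs" for j using conjunct2[OF DG] that by simp
  interpret D: decomposed_system l n "(!) Hs" "length Fs" "\<lambda>j. fst (Fs ! j)" ?B G "\<lambda>j v. component Fs j (\<phi> v)"
    by (rule D)
  interpret os_blocks n D.W.cmp D.W.cl "\<lambda>S. dependent l ((!) Hs ` S)" "TYPE('k)" "length Fs" ?B D.central_blocks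
    by (rule D.os_blocks_decomposed)
  have cen: "D.central_blocks = central_factors Fs"
  proof -
    have "D.fcmp j (?B j) \<longleftrightarrow> central (fst (Fs ! j)) (snd (Fs ! j))" if "j < length Fs" for j
    proof -
      interpret F: hyperplane_system "fst (Fs ! j)" "?B j" "G j" by (rule D.factor_system[OF that])
      show ?thesis unfolding F.cmp_def central_def F.intersection_image[symmetric] Gimg[OF that] ..
    qed
    then show ?thesis unfolding D.central_blocks_def central_factors_def by blast
  qed
  have "circuit C \<longleftrightarrow> C \<subseteq> {..<n} \<and> minimal_dependent l (hyps Hs C)" for C
  proof (cases "C \<subseteq> {..<n}")
    case True
    have inj: "inj_on ((!) Hs) C" by (rule inj_on_subset[OF D.W.inj_G True])
    have "(\<forall>T. T \<subset> (!) Hs ` C \<longrightarrow> \<not> dependent l T) \<longleftrightarrow> (\<forall>T. T \<subset> C \<longrightarrow> \<not> dependent l ((!) Hs ` T))"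
    proof (intro iffI allI impI)
      fix T assume h: "\<forall>T. T \<subset> (!) Hs ` C \<longrightarrow> \<not> dependent l T" "T \<subset> C"
      have "(!) Hs ` T \<noteq> (!) Hs ` C" using inj_on_image_eq_iff[OF inj, of T C] h(2) by blast
      moreover have "(!) Hs ` T \<subseteq> (!) Hs ` C" by (rule image_mono) (use h(2) in simp)
      ultimately have "(!) Hs ` T \<subset> (!) Hs ` C" by simp
      then show "\<not> dependent l ((!) Hs ` T)" using h(1) by simp
    next
      fix T assume h: "\<forall>T. T \<subset> C \<longrightarrow> \<not> dependent l ((!) Hs ` T)" "T \<subset> (!) Hs ` C"
      then have "T \<subseteq> (!) Hs ` C" by simp
      then obtain T' where T': "T' \<subseteq> C" "T = (!) Hs ` T'" by (rule subset_imageE)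
      then have "T' \<subset> C" using h(2) by auto
      then show "\<not> dependent l T" using h(1) T'(2) by simp
    qed
    then show ?thesis using True unfolding circuit_def minimal_dependent_def hyps_def by simp
  qed (simp add: circuit_def)
  then have circuit: "circuit = (\<lambda>C. C \<subseteq> {..<n} \<and> minimal_dependent l (hyps Hs C))" by (rule ext)
  have empty: "intersection l (hyps Hs S) = {} \<longleftrightarrow> \<not> D.W.cmp S" for S
    unfolding hyps_def D.W.intersection_image D.W.cmp_def by simp
  have "os_relations l Hs = (relations :: (nat set \<Rightarrow> 'k) set)"
    unfolding os_relations_def relations_def circuit empty assms(4) ..
  then have OS: "OS = os_quotient n I"
    unfolding assms(6) os_algebra_quotient os_ideal_def I_def assms(4) by simp
  have sv: "singular_variety n OS = weightless"
    unfolding OS by (rule singular_variety_weightless[OF D.alt_count_block])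
  have weightless: "weightless = {x \<in> ext_grade n 1. \<forall>j \<in> D.central_blocks. (\<Sum>i\<in>?B j. coord i x) = 0}"
    unfolding weightless_def coord_def ..
  show ?thesis
  proof (intro conjI)
    show "singular_variety n OS = {x \<in> ext_grade n 1. \<forall>j \<in> central_factors Fs. (\<Sum>i\<in>?B j. coord i x) = 0}"
      unfolding sv cen[symmetric] by (rule weightless)
    show "VectorSpace.subspace class_ring (singular_variety n OS) (ext_subspace n (ext_grade n 1))"
      unfolding sv by (rule subspace_weightless)
    show "vectorspace.dim class_ring (ext_subspace n (ext_grade n 1 :: (nat set \<Rightarrow> 'k) set))
        = vectorspace.dim class_ring (ext_subspace n (singular_variety n OS)) + card (central_factors Fs)"
      unfolding sv cen[symmetric] by (rule dim_weightless)
  qed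
qed

end
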